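(* Let $H, S$ be nuclear operators on $L^2=L^2(\mathbb{R})$ with kernels $\boldsymbol{H}\neq\theta_1$ and $\boldsymbol{S}$, for $\lambda\in\mathbb{C}$ put $\boldsymbol{T}_\lambda=\boldsymbol{H}-\lambda\boldsymbol{S}$, and suppose that: $\boldsymbol{S}$ is a $K^0$ kernel of Mercer type; $\boldsymbol{T}_\lambda$ is a $K^0$ kernel of Mercer type for every $\lambda\in\mathbb{C}$; and the positive nuclear operators $A=(H^*H+S^*S)^{1/2}$ and $\widetilde{A}=(HH^*+SS^* )^{1/2}$ are induced by $K^0$ kernels $\boldsymbol{A}$, $\widetilde{\boldsymbol{A}}$, which satisfy $\int\boldsymbol{A}(s,s)\,ds=\operatorname{tr}A<+\infty$ and $\int\widetilde{\boldsymbol{A}}(s,s)\,ds=\operatorname{tr}\widetilde{A}<+\infty$. Let $D_p[\boldsymbol{T}_\lambda]$ ($p=0,1,2,\dots$) be the sum of the polynomial $p$-th Fredholm series for $\boldsymbol{T}_\lambda$, and let $D_p^{(j)}[\boldsymbol{T}_{\lambda}]\in C(\mathbb{R}^{2p},\mathbb{C})$ be the $j$-th derivative with respect to $\lambda$ of the entire function $\lambda\mapsto D_p[\boldsymbol{T}_\lambda]\in C(\mathbb{R}^{2p},\mathbb{C})$. Let $\lambda_0\in\mathbb{C}$ be arbitrary but fixed. Then: (I) There are unique non-negative integers $\mathbf{d}=\mathbf{d}(\lambda_0)$, $\mathbf{r}=\mathbf{r}(\lambda_0)$ such that $D_{\mathbf{d}}^{(\mathbf{r})}[\boldsymbol{T}_{\lambda_0}]\neq\theta_{\mathbf{d}}$;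 $D_p^{(k)}[\boldsymbol{T}_{\lambda_0}]=\theta_p$ whenever $0\leqslant k<\mathbf{r}$ and $0\leqslant p$; and $D_p^{(\mathbf{r})}[\boldsymbol{T}_{\lambda_0}]=\theta_p$ whenever $0\leqslant p<\mathbf{d}$. (II) If, in addition, the point $\begin{pmatrix} s_1'&\dots&s_{\mathbf{d}}'\\ t_1'&\dots&t_{\mathbf{d}}'\end{pmatrix}\in\mathbb{R}^{2\mathbf{d}}$ satisfies $\delta:=D_{\mathbf{d}}^{(\mathbf{r})}[\boldsymbol{T}_{\lambda_0}]\begin{pmatrix} s_1'&\dots&s_{\mathbf{d}}'\\ t_1'&\dots&t_{\mathbf{d}}'\end{pmatrix}\neq0$, then the functions $$\phi_i(s)=D_{\mathbf{d}}^{(\mathbf{r})}[\boldsymbol{T}_{\lambda_0}]\begin{pmatrix} s_1'&\dots&s_{i-1}'&s&s_{i+1}'&\dots&s_{\mathbf{d}}'\\ t_1'&\dots&t_{i-1}'&t_i'&t_{i+1}'&\dots&t_{\mathbf{d}}'\end{pmatrix}\qquad(s\in\mathbb{R},\ 1\leqslant i\leqslant\mathbf{d})$$ form a basis for the set of solutions $f\in L^2$ of the homogeneous equation $f(s)+\int\boldsymbol{T}_{\lambda_0}(s,t)f(t)\,dt=0$, and the functions $$\psi_l(t)=\overline{D_{\mathbf{d}}^{(\mathbf{r})}[\boldsymbol{T}_{\lambda_0}]\begin{pmatrix} s_1'&\dots&s_{l-1}'&s_l'&s_{l+1}'&\dots&s_{\mathbf{d}}'\\ t_1'&\dots&t_{l-1}'&t&t_{l+1}'&\dots&t_{\mathbf{d}}'\end{pmatrix}}\qquad(t\in\mathbb{R},\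 1\leqslant l\leqslant\mathbf{d})$$ form a basis for the set of solutions $f\in L^2$ of the conjugate homogeneous equation $f(t)+\int\overline{\boldsymbol{T}_{\lambda_0}(s,t)}f(s)\,ds=0$. For given $g\in L^2$, the equation $$f(s)+\int\boldsymbol{T}_{\lambda_0}(s,t)f(t)\,dt=g(s)\quad\text{for a.e. } s\in\mathbb{R}$$ is solvable for $f\in L^2$ if and only if $\langle g,\psi_l\rangle=0$ for $1\leqslant l\leqslant\mathbf{d}$, and the general solution is then given by $$f(s)=g(s)-\int\frac{D_{\mathbf{d}+1}^{(\mathbf{r})}[\boldsymbol{T}_{\lambda_0}]\begin{pmatrix} s&s_1'&\dots&s_{\mathbf{d}}'\\ t&t_1'&\dots&t_{\mathbf{d}}'\end{pmatrix}}{\delta}\,g(t)\,dt+\sum_{i=1}^{\mathbf{d}}c_i\phi_i(s),$$ where $c_1,\dots,c_{\mathbf{d}}\in\mathbb{C}$ are arbitrary constants. (III) $\mathbf{r}(\lambda_0)=0$, and, if $\mathbf{m}:=\inf_{\lambda\in\mathbb{C}}\mathbf{d}(\lambda)$ and $D_{\mathbf{m}}[\boldsymbol{T}_{\lambda_0}]\neq\theta_{\mathbf{m}}$, then $\mathbf{d}(\lambda_0)=\mathbf{m}$.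
   Context: $L^2=L^2(\mathbb{R})$ is the complex Hilbert space of Lebesgue square-integrable functions with $\langle f,g\rangle=\int f\overline{g}$; integrals without indicated domain are over $\mathbb{R}$ in each variable. For a locally compact space $X$ and a Banach space $B$, $C(X,B)$ is the Banach space of continuous functions $X\to B$ vanishing at infinity (for every $\varepsilon>0$, $\|f(x)\|_B<\varepsilon$ outside some compact set), with norm $\sup_{x\in X}\|f(x)\|_B$; $C(\mathbb{R}^0,B)$ is identified with $B$. $\theta_p$ is the zero element of $C(\mathbb{R}^{2p},\mathbb{C})$ (so $\theta_0=0\in\mathbb{C}$). A bounded operator $T$ on $L^2$ is integral with kernel $\boldsymbol{T}$ (is induced by $\boldsymbol{T}$) if $\boldsymbol{T}:\mathbb{R}^2\to\mathbb{C}$ is measurable and, for each $f\in L^2$, $(Tf)(s)=\int\boldsymbol{T}(s,t)f(t)\,dt$ for a.e. $s$. A bounded operator $A$ on $L^2$ is nuclear if $\sum_n|\langle Au_n,u_n\rangle|<+\infty$ for every orthonormal basis $\{u_n\}$ of $L^2$; every nuclear operator is an integral operator with a Hilbert-Schmidt kernel. A function $\boldsymbol{T}\in C(\mathbb{R}^2,\mathbb{C})$ is a $K^0$ kernel if the maps $s\mapsto\overline{\boldsymbol{T}(s,\cdot)}$ and $s\mapsto\boldsymbol{T}(\cdot,s)$ belong to $C(\mathbb{R},L^2)$. For a bounded operator $T$ on $L^2$, $\mathcal{M}^+(T)$ is the set of all positive bounded operators $P$ on $L^2$ (i.e. $\langle Px,x\rangle\geqslant0$ for all $x$) that can be written as $P=TB$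 or as $P=BT$ with $B$ a bounded operator on $L^2$. A $K^0$ kernel $\boldsymbol{T}$ is of Mercer type if it induces a bounded integral operator $T$ on $L^2$ such that every operator in $\mathcal{M}^+(T)$ is an integral operator induced by a $K^0$ kernel. Polynomial Fredholm series. For $\nu>0$ let $\boldsymbol{T}_\lambda\begin{pmatrix} x_1&\dots&x_\nu\\ y_1&\dots&y_\nu\end{pmatrix}=\det[\boldsymbol{T}_\lambda(x_i,y_j)]_{i,j=1}^{\nu}$, and let this symbol be $1$ for $\nu=0$. For $n,p=0,1,2,\dots$ put $$B_n^p[\boldsymbol{T}_\lambda]\begin{pmatrix} s_1&\dots&s_p\\ t_1&\dots&t_p\end{pmatrix}=\frac1{n!}\int\cdots\int \boldsymbol{T}_\lambda\begin{pmatrix} s_1&\dots&s_p&\xi_1&\dots&\xi_n\\ t_1&\dots&t_p&\xi_1&\dots&\xi_n\end{pmatrix}d\xi_1\dots d\xi_n,$$ a polynomial in $\lambda$ of degree at most $p+n$. The polynomial $p$-th Fredholm series for $\boldsymbol{T}_\lambda$ is $D_p[\boldsymbol{T}_\lambda]=\sum_{n=0}^\infty B_n^p[\boldsymbol{T}_\lambda]$. Under the stated assumptions on the kernels, this series converges in $C(\mathbb{R}^{2p},\mathbb{C})$ uniformly for $\lambda$ in compact subsets of $\mathbb{C}$, so that $\lambda\mapsto D_p[\boldsymbol{T}_\lambda]$ is an entire $C(\mathbb{R}^{2p},\mathbb{C})$-valued function of $\lambda$. $D_p^{(j)}[\boldsymbol{T}_{\lambda_0}]$ denotes its $j$-th derivative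 in $\lambda$ evaluated at $\lambda=\lambda_0$, with $D_p^{(0)}=D_p$. *)

theory Defs
  imports "Jordan_Normal_Form.Determinant" "HOL-Analysis.Analysis"
begin

definition square_integrable :: "(real \<Rightarrow> complex) \<Rightarrow> bool" where
  "square_integrable f \<longleftrightarrow>
     f \<in> borel_measurable lebesgue \<and> integrable lebesgue (\<lambda>x. (cmod (f x))\<^sup>2)"

lemma square_integrable_zero: "square_integrable (\<lambda>x. 0)"
  by (simp add: square_integrable_def)

lemma square_integrable_add:
  assumes "square_integrable f" "square_integrable g"
  shows "square_integrable (\<lambda>x. f x + g x)"
proof -
  have m: "f \<in> borel_measurable lebesgue" "g \<in> borel_measurable lebesgue"
    using assms unfolding square_integrable_def by blast+
  then have s: "(\<lambda>x. f x + g x) \<in> borel_measurable lebesgue"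
    by (rule borel_measurable_add)
  have int: "integrable lebesgue (\<lambda>x. 2 * (cmod (f x))\<^sup>2 + 2 * (cmod (g x))\<^sup>2)"
    using assms unfolding square_integrable_def
    by (intro Bochner_Integration.integrable_add integrable_mult_right) blast+
  have le: "(cmod (f x + g x))\<^sup>2 \<le> 2 * (cmod (f x))\<^sup>2 + 2 * (cmod (g x))\<^sup>2" for x
  proof -
    have "(cmod (f x + g x))\<^sup>2 \<le> (cmod (f x) + cmod (g x))\<^sup>2"
      by (simp add: norm_triangle_ineq power_mono)
    also have "\<dots> \<le> 2 * (cmod (f x))\<^sup>2 + 2 * (cmod (g x))\<^sup>2"
      using zero_le_power2[of "cmod (f x) - cmod (g x)"]
      by (simp add: power2_eq_square algebra_simps)
    finally show ?thesis .
  qed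
  have "integrable lebesgue (\<lambda>x. (cmod (f x + g x))\<^sup>2)"
  proof (rule Bochner_Integration.integrable_bound[OF int])
    show "(\<lambda>x. (cmod (f x + g x))\<^sup>2) \<in> borel_measurable lebesgue"
      by (rule borel_measurable_power[OF measurable_compose[OF s borel_measurable_norm]])
    show "AE x in lebesgue. norm ((cmod (f x + g x))\<^sup>2)
        \<le> norm (2 * (cmod (f x))\<^sup>2 + 2 * (cmod (g x))\<^sup>2)"
    proof (rule AE_I2)
      fix x
      show "norm ((cmod (f x + g x))\<^sup>2) \<le> norm (2 * (cmod (f x))\<^sup>2 + 2 * (cmod (g x))\<^sup>2)"
        using order_trans[OF le[of x] abs_ge_self] by (simp only: real_norm_def abs_power2)
    qed
  qed
  with s show ?thesis unfolding square_integrable_def by blast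
qed

lemma square_integrable_scale:
  assumes "square_integrable f"
  shows "square_integrable (\<lambda>x. c * f x)"
  using assms by (auto simp: square_integrable_def norm_mult power_mult_distrib)

lemma square_integrable_mult_cnj:
  assumes "square_integrable f" "square_integrable g"
  shows "integrable lebesgue (\<lambda>x. f x * cnj (g x))"
proof -
  have m: "f \<in> borel_measurable lebesgue" "g \<in> borel_measurable lebesgue"
    using assms unfolding square_integrable_def by blast+
  have cm: "(\<lambda>x. cnj (g x)) \<in> borel_measurable lebesgue"
    using m(2) by (rule borel_measurable_continuous_on[OF continuous_on_cnj[OF continuous_on_id]])
  have int: "integrable lebesgue (\<lambda>x. (cmod (f x))\<^sup>2 + (cmod (g x))\<^sup>2)"
    using assms unfolding square_integrable_def
    by (intro Bochner_Integration.integrable_add) blast+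
  have le: "cmod (f x * cnj (g x)) \<le> (cmod (f x))\<^sup>2 + (cmod (g x))\<^sup>2" for x
  proof -
    have "2 * (cmod (f x) * cmod (g x)) \<le> (cmod (f x))\<^sup>2 + (cmod (g x))\<^sup>2"
      using zero_le_power2[of "cmod (f x) - cmod (g x)"]
      by (simp add: power2_eq_square algebra_simps)
    moreover have "0 \<le> cmod (f x) * cmod (g x)" by simp
    ultimately show ?thesis unfolding norm_mult complex_mod_cnj by linarith
  qed
  show ?thesis
  proof (rule Bochner_Integration.integrable_bound[OF int])
    show "(\<lambda>x. f x * cnj (g x)) \<in> borel_measurable lebesgue"
      using m(1) cm by (rule borel_measurable_times)
    show "AE x in lebesgue. norm (f x * cnj (g x)) \<le> norm ((cmod (f x))\<^sup>2 + (cmod (g x))\<^sup>2)"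
    proof (rule AE_I2)
      fix x
      show "norm (f x * cnj (g x)) \<le> norm ((cmod (f x))\<^sup>2 + (cmod (g x))\<^sup>2)"
        using le[of x] unfolding real_norm_def by linarith
    qed
  qed
qed

quotient_type L2 = "real \<Rightarrow> complex" / partial:
  "\<lambda>f g. square_integrable f \<and> square_integrable g \<and> (AE x in lebesgue. f x = g x)"
proof (rule part_equivpI)
  show "\<exists>f. square_integrable f \<and> square_integrable f \<and> (AE x in lebesgue. f x = f x)"
    using square_integrable_zero by auto
  show "symp (\<lambda>f g. square_integrable f \<and> square_integrable g \<and> (AE x in lebesgue. f x = g x))"
    by (rule sympI) (auto elim: eventually_mono)
  show "transp (\<lambda>f g. square_integrable f \<and> square_integrable g \<and> (AE x in lebesgue. f x = g x))"
    by (rule transpI) (auto elim: eventually_elim2)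
qed

lemma square_integrable_rep_L2: "square_integrable (rep_L2 f)"
  using Quotient_rep_reflp[OF Quotient_L2, of f] by auto

lift_definition scaleC_L2 :: "complex \<Rightarrow> L2 \<Rightarrow> L2" is "\<lambda>c f x. c * f x"
  by (auto intro: square_integrable_scale elim: eventually_mono)

lift_definition cinner :: "L2 \<Rightarrow> L2 \<Rightarrow> complex"
  is "\<lambda>f g. \<integral>x. f x * cnj (g x) \<partial>lebesgue"
proof -
  fix f f' g g' :: "real \<Rightarrow> complex"
  assume f: "square_integrable f \<and> square_integrable f' \<and> (AE x in lebesgue. f x = f' x)"
    and g: "square_integrable g \<and> square_integrable g' \<and> (AE x in lebesgue. g x = g' x)"
  from f have "AE x in lebesgue. f x = f' x" by blast
  moreover from g have "AE x in lebesgue. g x = g' x" by blast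
  ultimately have "AE x in lebesgue. f x * cnj (g x) = f' x * cnj (g' x)"
    by eventually_elim simp
  moreover have "integrable lebesgue (\<lambda>x. f x * cnj (g x))"
      "integrable lebesgue (\<lambda>x. f' x * cnj (g' x))"
    using f g by (blast intro: square_integrable_mult_cnj)+
  ultimately show "(\<integral>x. f x * cnj (g x) \<partial>lebesgue) = (\<integral>x. f' x * cnj (g' x) \<partial>lebesgue)"
    by (intro integral_cong_AE borel_measurable_integrable)
qed

instantiation L2 :: real_inner
begin

lift_definition zero_L2 :: L2 is "\<lambda>x. 0"
  by (simp add: square_integrable_zero)

lift_definition plus_L2 :: "L2 \<Rightarrow> L2 \<Rightarrow> L2" is "\<lambda>f g x. f x + g x"
  by (auto intro: square_integrable_add elim: eventually_elim2)

definition scaleR_L2 :: "real \<Rightarrow> L2 \<Rightarrow> L2" where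
  "scaleR_L2 r f = scaleC_L2 (complex_of_real r) f"

definition uminus_L2 :: "L2 \<Rightarrow> L2" where
  "uminus_L2 f = scaleC_L2 (-1) f"

definition minus_L2 :: "L2 \<Rightarrow> L2 \<Rightarrow> L2" where
  "minus_L2 f g = f + - (g :: L2)"

definition inner_L2 :: "L2 \<Rightarrow> L2 \<Rightarrow> real" where
  "inner_L2 f g = Re (cinner f g)"

definition norm_L2 :: "L2 \<Rightarrow> real" where
  "norm_L2 f = sqrt (inner f f)"

definition sgn_L2 :: "L2 \<Rightarrow> L2" where
  "sgn_L2 f = inverse (norm f) *\<^sub>R f"

definition dist_L2 :: "L2 \<Rightarrow> L2 \<Rightarrow> real" where
  "dist_L2 f g = norm (f - g)"

definition uniformity_L2 :: "(L2 \<times> L2) filter" where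
  "uniformity_L2 = (INF e\<in>{0<..}. principal {(x, y). dist x y < e})"

definition open_L2 :: "L2 set \<Rightarrow> bool" where
  "open_L2 U \<longleftrightarrow> (\<forall>x\<in>U. \<forall>\<^sub>F (x', y) in uniformity. x' = x \<longrightarrow> y \<in> U)"

instance
proof
  fix f g h :: L2 and a b :: real
  show "f + g + h = f + (g + h)"
    by transfer (auto intro!: square_integrable_add simp: add.assoc)
  show "f + g = g + f"
    by transfer (auto intro!: square_integrable_add simp: add.commute)
  show "0 + f = f"
    by transfer auto
  show "- f + f = 0"
    unfolding uminus_L2_def
    by transfer (auto intro: square_integrable_zero)
  show "f - g = f + - g"
    by (simp add: minus_L2_def)
  show "a *\<^sub>R (f + g) = a *\<^sub>R f + a *\<^sub>R g"
    unfolding scaleR_L2_def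
    by transfer (auto intro!: square_integrable_add square_integrable_scale simp: distrib_left)
  show "(a + b) *\<^sub>R f = a *\<^sub>R f + b *\<^sub>R f"
    unfolding scaleR_L2_def of_real_add
  proof transfer
    fix a b :: real and f :: "real \<Rightarrow> complex"
    assume *: "square_integrable f \<and> square_integrable f \<and> (AE x in lebesgue. f x = f x)"
    then have "square_integrable (\<lambda>x. (complex_of_real a + complex_of_real b) * f x)"
      by (intro square_integrable_scale) auto
    then show "square_integrable (\<lambda>x. (complex_of_real a + complex_of_real b) * f x) \<and>
       square_integrable (\<lambda>x. complex_of_real a * f x + complex_of_real b * f x) \<and>
       (AE x in lebesgue. (complex_of_real a + complex_of_real b) * f x =
          complex_of_real a * f x + complex_of_real b * f x)"
      by (simp add: distrib_right)
  qed
  show "a *\<^sub>R b *\<^sub>R f = (a * b) *\<^sub>R f"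
    unfolding scaleR_L2_def of_real_mult
    by transfer (auto intro!: square_integrable_scale simp: mult.assoc)
  show "1 *\<^sub>R f = f"
    unfolding scaleR_L2_def of_real_1 by transfer auto
  show "inner f g = inner g f"
    unfolding inner_L2_def
  proof transfer
    fix f g :: "real \<Rightarrow> complex"
    have "(\<integral>x. g x * cnj (f x) \<partial>lebesgue) = (\<integral>x. cnj (f x * cnj (g x)) \<partial>lebesgue)"
      by (simp add: mult.commute)
    then show "Re (\<integral>x. f x * cnj (g x) \<partial>lebesgue) = Re (\<integral>x. g x * cnj (f x) \<partial>lebesgue)"
      by (simp del: complex_cnj_mult)
  qed
  show "inner (f + g) h = inner f h + inner g h"
    unfolding inner_L2_def
    by transfer (simp add: distrib_right square_integrable_mult_cnj)
  show "inner (a *\<^sub>R f) g = a * inner f g"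
    unfolding inner_L2_def scaleR_L2_def
    by transfer (simp add: mult.assoc)
  show "0 \<le> inner f f"
    unfolding inner_L2_def
  proof transfer
    fix f :: "real \<Rightarrow> complex"
    have "(\<integral>x. f x * cnj (f x) \<partial>lebesgue) = complex_of_real (\<integral>x. (cmod (f x))\<^sup>2 \<partial>lebesgue)"
      by (simp only: complex_norm_square[symmetric] integral_complex_of_real)
    then show "0 \<le> Re (\<integral>x. f x * cnj (f x) \<partial>lebesgue)"
      by simp
  qed
  show "(inner f f = 0) = (f = 0)"
    unfolding inner_L2_def
  proof transfer
    fix f :: "real \<Rightarrow> complex"
    assume *: "square_integrable f \<and> square_integrable f \<and> (AE x in lebesgue. f x = f x)"
    have "(\<integral>x. f x * cnj (f x) \<partial>lebesgue) = complex_of_real (\<integral>x. (cmod (f x))\<^sup>2 \<partial>lebesgue)"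
      by (simp only: complex_norm_square[symmetric] integral_complex_of_real)
    then have "(Re (\<integral>x. f x * cnj (f x) \<partial>lebesgue) = 0) \<longleftrightarrow>
       (\<integral>x. (cmod (f x))\<^sup>2 \<partial>lebesgue) = 0"
      by simp
    also have "\<dots> \<longleftrightarrow> (AE x in lebesgue. (cmod (f x))\<^sup>2 = 0)"
      by (rule integral_nonneg_eq_0_iff_AE) (use * in \<open>auto simp: square_integrable_def\<close>)
    finally show "(Re (\<integral>x. f x * cnj (f x) \<partial>lebesgue) = 0) =
       (square_integrable f \<and> square_integrable (\<lambda>x. 0) \<and> (AE x in lebesgue. f x = 0))"
      using * by (simp add: square_integrable_zero)
  qed
qed (simp_all add: norm_L2_def sgn_L2_def dist_L2_def uniformity_L2_def open_L2_def)

end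

global_interpretation L2: vector_space scaleC_L2
proof
  fix f g :: L2 and a b :: complex
  show "scaleC_L2 a (f + g) = scaleC_L2 a f + scaleC_L2 a g"
    by transfer (auto intro!: square_integrable_add square_integrable_scale simp: distrib_left)
  show "scaleC_L2 (a + b) f = scaleC_L2 a f + scaleC_L2 b f"
  proof transfer
    fix a b :: complex and f :: "real \<Rightarrow> complex"
    assume *: "square_integrable f \<and> square_integrable f \<and> (AE x in lebesgue. f x = f x)"
    then have "square_integrable (\<lambda>x. (a + b) * f x)"
      by (intro square_integrable_scale) auto
    then show "square_integrable (\<lambda>x. (a + b) * f x) \<and>
       square_integrable (\<lambda>x. a * f x + b * f x) \<and>
       (AE x in lebesgue. (a + b) * f x = a * f x + b * f x)"
      by (simp add: distrib_right)
  qed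
  show "scaleC_L2 a (scaleC_L2 b f) = scaleC_L2 (a * b) f"
    by transfer (auto intro!: square_integrable_scale simp: mult.assoc)
  show "scaleC_L2 1 f = f"
    by transfer auto
qed

text \<open>The family \<open>v 0, \<dots>, v (n - 1)\<close> is a (complex) basis of the set \<open>V\<close>; in particular
  its members are pairwise distinct.\<close>

definition basis_of :: "nat \<Rightarrow> (nat \<Rightarrow> L2) \<Rightarrow> L2 set \<Rightarrow> bool" where
  "basis_of n v V \<longleftrightarrow>
     inj_on v {..<n} \<and> L2.independent (v ` {..<n}) \<and> L2.span (v ` {..<n}) = V"

definition bounded_op :: "(L2 \<Rightarrow> L2) \<Rightarrow> bool" where
  "bounded_op T \<longleftrightarrow>
     bounded_linear T \<and> (\<forall>c f. T (scaleC_L2 c f) = scaleC_L2 c (T f))"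

definition positive_op :: "(L2 \<Rightarrow> L2) \<Rightarrow> bool" where
  "positive_op P \<longleftrightarrow> bounded_op P \<and> (\<forall>f. cinner (P f) f \<in> \<real>\<^sub>\<ge>\<^sub>0)"

definition adjoint_op :: "(L2 \<Rightarrow> L2) \<Rightarrow> (L2 \<Rightarrow> L2)" where
  "adjoint_op T = (THE T'. bounded_op T' \<and> (\<forall>f g. cinner (T f) g = cinner f (T' g)))"

definition is_positive_sqrt :: "(L2 \<Rightarrow> L2) \<Rightarrow> (L2 \<Rightarrow> L2) \<Rightarrow> bool" where
  "is_positive_sqrt A P \<longleftrightarrow> positive_op A \<and> A \<circ> A = P"

text \<open>The space is separable and infinite-dimensional, so orthonormal bases are sequences.\<close>

definition orthonormal_basis :: "(nat \<Rightarrow> L2) \<Rightarrow> bool" where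
  "orthonormal_basis u \<longleftrightarrow>
     (\<forall>m n. cinner (u m) (u n) = (if m = n then 1 else 0)) \<and>
     closure (L2.span (range u)) = UNIV"

definition nuclear :: "(L2 \<Rightarrow> L2) \<Rightarrow> bool" where
  "nuclear A \<longleftrightarrow> bounded_op A \<and>
     (\<forall>u. orthonormal_basis u \<longrightarrow> summable (\<lambda>n. cmod (cinner (A (u n)) (u n))))"

definition op_trace :: "(L2 \<Rightarrow> L2) \<Rightarrow> complex" where
  "op_trace A =
     (THE c. \<forall>u. orthonormal_basis u \<longrightarrow> (\<lambda>n. cinner (A (u n)) (u n)) sums c)"

text \<open>Continuous functions on \<open>X\<close> vanishing at infinity. Members are \<open>undefined\<close> outside \<open>X\<close>,
  so that equality of functions on \<open>X\<close> is equality in HOL. Convergence in the sup norm is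
  \<^const>\<open>uniform_limit\<close> on \<open>X\<close>.\<close>

definition C0 :: "'a::topological_space set \<Rightarrow> ('a \<Rightarrow> 'b::real_normed_vector) set" where
  "C0 X = {f \<in> extensional X. continuous_on X f \<and>
     (\<forall>\<epsilon>>0. \<exists>K. compact K \<and> K \<subseteq> X \<and> (\<forall>x\<in>X - K. norm (f x) < \<epsilon>))}"

text \<open>The Bochner integral of a non-integrable function is \<open>0\<close>, hence the explicit
  integrability requirement.\<close>

definition induces :: "(real \<times> real \<Rightarrow> complex) \<Rightarrow> (L2 \<Rightarrow> L2) \<Rightarrow> bool" where
  "induces K T \<longleftrightarrow> bounded_op T \<and> K \<in> borel_measurable lebesgue \<and>
     (\<forall>f. AE s in lebesgue.
        integrable lebesgue (\<lambda>t. K (s, t) * rep_L2 f t) \<and>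
        rep_L2 (T f) s = (\<integral>t. K (s, t) * rep_L2 f t \<partial>lebesgue))"

definition K0_kernel :: "(real \<times> real \<Rightarrow> complex) \<Rightarrow> bool" where
  "K0_kernel K \<longleftrightarrow> K \<in> C0 UNIV \<and>
     (\<forall>s. square_integrable (\<lambda>t. cnj (K (s, t)))) \<and>
     (\<lambda>s. abs_L2 (\<lambda>t. cnj (K (s, t)))) \<in> C0 UNIV \<and>
     (\<forall>s. square_integrable (\<lambda>t. K (t, s))) \<and>
     (\<lambda>s. abs_L2 (\<lambda>t. K (t, s))) \<in> C0 UNIV"

definition Mplus :: "(L2 \<Rightarrow> L2) \<Rightarrow> (L2 \<Rightarrow> L2) set" where
  "Mplus T = {P. positive_op P \<and> (\<exists>B. bounded_op B \<and> (P = T \<circ> B \<or> P = B \<circ> T))}"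

definition Mercer_kernel :: "(real \<times> real \<Rightarrow> complex) \<Rightarrow> bool" where
  "Mercer_kernel K \<longleftrightarrow> K0_kernel K \<and>
     (\<exists>T. induces K T \<and> (\<forall>P\<in>Mplus T. \<exists>K'. K0_kernel K' \<and> induces K' P))"

definition pencil ::
  "(real \<times> real \<Rightarrow> complex) \<Rightarrow> (real \<times> real \<Rightarrow> complex) \<Rightarrow> complex \<Rightarrow> (real \<times> real \<Rightarrow> complex)"
  where "pencil H S \<mu> = (\<lambda>x. H x - \<mu> * S x)"

text \<open>A point of \<open>p\<close>-dimensional space is a function on \<open>{..<p}\<close>, with coordinates counted
  from \<open>0\<close> and the value \<open>undefined\<close> at larger indices; its topology is inherited from the
  product topology on \<^typ>\<open>nat \<Rightarrow> real\<close>. For \<open>p = 0\<close> there is exactly one point. The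
  \<open>2p\<close> coordinates of an argument of a Fredholm series are grouped as a pair.\<close>

definition Rn :: "nat \<Rightarrow> (nat \<Rightarrow> real) set" where
  "Rn p = ({..<p} \<rightarrow>\<^sub>E UNIV)"

abbreviation Rn2 :: "nat \<Rightarrow> ((nat \<Rightarrow> real) \<times> (nat \<Rightarrow> real)) set" where
  "Rn2 p \<equiv> Rn p \<times> Rn p"

definition theta :: "nat \<Rightarrow> (nat \<Rightarrow> real) \<times> (nat \<Rightarrow> real) \<Rightarrow> complex" where
  "theta p = (\<lambda>x\<in>Rn2 p. 0)"

definition append_pt :: "nat \<Rightarrow> (nat \<Rightarrow> real) \<Rightarrow> (nat \<Rightarrow> real) \<Rightarrow> (nat \<Rightarrow> real)" where
  "append_pt p s \<xi> = (\<lambda>i. if i < p then s i else \<xi> (i - p))"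

definition cons_pt :: "nat \<Rightarrow> real \<Rightarrow> (nat \<Rightarrow> real) \<Rightarrow> (nat \<Rightarrow> real)" where
  "cons_pt p a s = (\<lambda>i\<in>{..<Suc p}. case i of 0 \<Rightarrow> a | Suc k \<Rightarrow> s k)"

definition kernel_minor ::
  "(real \<times> real \<Rightarrow> complex) \<Rightarrow> nat \<Rightarrow> (nat \<Rightarrow> real) \<Rightarrow> (nat \<Rightarrow> real) \<Rightarrow> complex" where
  "kernel_minor K \<nu> x y =
     Determinant.det (Matrix.mat \<nu> \<nu> (\<lambda>(i, j). K (x i, y j)))"

text \<open>The multiple integral is taken over the product Borel measure, which agrees with Lebesgue
  measure on the continuous integrands that occur for continuous kernels.\<close>

definition fredholm_term ::
  "nat \<Rightarrow> nat \<Rightarrow> (real \<times> real \<Rightarrow> complex) \<Rightarrow> (nat \<Rightarrow> real) \<times> (nat \<Rightarrow> real) \<Rightarrow> complex" where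
  "fredholm_term n p K = (\<lambda>x\<in>Rn2 p. 1 / fact n *
     (\<integral>\<xi>. kernel_minor K (p + n) (append_pt p (fst x) \<xi>) (append_pt p (snd x) \<xi>)
        \<partial>(Pi\<^sub>M {..<n} (\<lambda>_. lborel))))"

text \<open>Sum of the series in the Banach space \<^term>\<open>C0 (Rn2 p)\<close>.\<close>

definition fredholm_sum ::
  "nat \<Rightarrow> (real \<times> real \<Rightarrow> complex) \<Rightarrow> (nat \<Rightarrow> real) \<times> (nat \<Rightarrow> real) \<Rightarrow> complex" where
  "fredholm_sum p K = (THE F. F \<in> C0 (Rn2 p) \<and>
     uniform_limit (Rn2 p) (\<lambda>N x. \<Sum>n<N. fredholm_term n p K x) F sequentially)"

text \<open>Complex derivative of a map with values in the Banach space \<^term>\<open>C0 X\<close>.\<close>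

definition C0_deriv ::
  "'a::topological_space set \<Rightarrow> (complex \<Rightarrow> 'a \<Rightarrow> complex) \<Rightarrow> (complex \<Rightarrow> 'a \<Rightarrow> complex)" where
  "C0_deriv X F \<mu> = (THE G. G \<in> C0 X \<and>
     uniform_limit X (\<lambda>h x. (F (\<mu> + h) x - F \<mu> x) / h) G (at 0))"

text \<open>\<open>fredholm_D T p j \<mu>\<close> is the \<open>j\<close>-th derivative at \<open>\<mu>\<close> of the \<open>p\<close>-th series of \<open>T\<close>.\<close>

definition fredholm_D ::
  "(complex \<Rightarrow> real \<times> real \<Rightarrow> complex) \<Rightarrow> nat \<Rightarrow> nat \<Rightarrow> complex \<Rightarrow>
   (nat \<Rightarrow> real) \<times> (nat \<Rightarrow> real) \<Rightarrow> complex" where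
  "fredholm_D T p j = (C0_deriv (Rn2 p) ^^ j) (\<lambda>\<mu>. fredholm_sum p (T \<mu>))"

definition is_index_pair ::
  "(complex \<Rightarrow> real \<times> real \<Rightarrow> complex) \<Rightarrow> complex \<Rightarrow> nat \<times> nat \<Rightarrow> bool" where
  "is_index_pair T \<mu> = (\<lambda>(d, r).
     fredholm_D T d r \<mu> \<noteq> theta d \<and>
     (\<forall>k p. k < r \<longrightarrow> fredholm_D T p k \<mu> = theta p) \<and>
     (\<forall>p<d. fredholm_D T p r \<mu> = theta p))"

definition index_d :: "(complex \<Rightarrow> real \<times> real \<Rightarrow> complex) \<Rightarrow> complex \<Rightarrow> nat" where
  "index_d T \<mu> = fst (THE dr. is_index_pair T \<mu> dr)"

definition index_r :: "(complex \<Rightarrow> real \<times> real \<Rightarrow> complex) \<Rightarrow> complex \<Rightarrow> nat" where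
  "index_r T \<mu> = snd (THE dr. is_index_pair T \<mu> dr)"

definition solutions :: "(real \<times> real \<Rightarrow> complex) \<Rightarrow> L2 \<Rightarrow> L2 set" where
  "solutions K g = {f. AE s in lebesgue.
     integrable lebesgue (\<lambda>t. K (s, t) * rep_L2 f t) \<and>
     rep_L2 f s + (\<integral>t. K (s, t) * rep_L2 f t \<partial>lebesgue) = rep_L2 g s}"

definition homogeneous_solutions :: "(real \<times> real \<Rightarrow> complex) \<Rightarrow> L2 set" where
  "homogeneous_solutions K = {f. AE s in lebesgue.
     integrable lebesgue (\<lambda>t. K (s, t) * rep_L2 f t) \<and>
     rep_L2 f s + (\<integral>t. K (s, t) * rep_L2 f t \<partial>lebesgue) = 0}"

definition conjugate_solutions :: "(real \<times> real \<Rightarrow> complex) \<Rightarrow> L2 set" where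
  "conjugate_solutions K = {f. AE t in lebesgue.
     integrable lebesgue (\<lambda>s. cnj (K (s, t)) * rep_L2 f s) \<and>
     rep_L2 f t + (\<integral>s. cnj (K (s, t)) * rep_L2 f s \<partial>lebesgue) = 0}"

end

theory Submission
  imports Defs
begin

text \<open>Since \<open>H\<^sup>*H\<close> and \<open>S\<^sup>*S\<close> are at most \<open>A\<^sup>2\<close>, and \<open>HH\<^sup>*\<close> and \<open>SS\<^sup>*\<close> are at most \<open>A'\<^sup>2\<close>,
  Kato's mixed Schwarz inequality gives \<open>|\<langle>Hf, g\<rangle>|\<^sup>2 \<le> \<langle>Af, f\<rangle> \<langle>A'g, g\<rangle>\<close>, and testing with
  approximate point masses yields \<open>|H(s, t)|\<^sup>2 \<le> A(t, t) A'(s, s)\<close>, and likewise for \<open>S\<close>. Hence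
  every kernel \<open>T\<^sub>\<lambda>\<close> is dominated by a product \<open>a(s) b(t)\<close> of continuous square integrable functions
  vanishing at infinity. Hadamard's inequality then makes the Fredholm series converge, and the
  classical identities between the first minors give the Fredholm alternative at the smallest
  order \<open>d\<close> whose minor does not vanish identically.

  Such a \<open>d\<close> exists for every \<open>\<lambda>\<close>, so that \<open>r = 0\<close>: the integrals of the minors over the diagonal
  are the derivatives at \<open>z = 1\<close> of the entire function \<open>z \<mapsto> D\<^sub>0[z T\<^sub>\<lambda>]\<close>, which is \<open>1\<close> at \<open>z = 0\<close>.\<close>


section \<open>Positive operators on a real Hilbert space\<close>

text \<open>Everything is done for one fixed \<lambda>. An index pair with r > 0 would make every
  D_p[T_\<lambda>] vanish at that \<lambda>; once some D_p is known to be nonzero, only the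
  derivative of order zero, the sum itself, enters. The obstacle is that the line has infinite
  measure, so boundedness of the kernel does not make the multiple integrals finite. A product bound
  \<open>a s * b t\<close> repairs this: it factors out of the rows and columns of a determinant and
  leaves one factor M, the integral of \<open>a * b\<close>, per integration variable. Hadamard's
  constant sqrt(k)^k for k rows is then beaten by the factorial. The two factors differ because the
  kernels need not be Hermitian: \<open>A\<close> controls the input variable t and
  \<open>A'\<close> the output variable s. Passing to the conjugate transposed kernel exchanges the
  two factors, and rows with columns in every minor, so each integral identity is proved for rows
  and read off for columns. The nonvanishing argument is a Taylor expansion at z = 1 evaluated at z
  = 0, carried out as an alternating double sum over binomial coefficients.\<close>

lemma coercive_representation:
  fixes B :: "'a::{real_inner,complete_space} \<Rightarrow> 'a" and \<phi> :: "'a \<Rightarrow> real"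
  assumes B: "bounded_linear B" and sym: "\<And>f g. inner (B f) g = inner f (B g)"
    and coercive: "\<And>f. \<epsilon> * (norm f)\<^sup>2 \<le> inner (B f) f" and \<epsilon>: "0 < \<epsilon>"
    and \<phi>: "bounded_linear \<phi>"
  shows "\<exists>u. \<forall>f. \<phi> f = inner f (B u)"
proof -
  interpret B: bounded_linear B by fact
  interpret \<phi>: bounded_linear \<phi> by fact
  obtain C where C: "0 < C" "\<And>f. norm (\<phi> f) \<le> norm f * C"
    using \<phi>.pos_bounded by blast
  \<comment> \<open>Energy whose derivative at u in direction f is twice
    \<open>inner (B u) f - \<phi> f\<close>, so a minimiser represents \<open>\<phi>\<close>. With B
    the identity this is Riesz's theorem; with \<open>\<phi>\<close> an inner product it shows that
    B is onto.\<close>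
  define J where "J u = inner (B u) u - 2 * \<phi> u" for u
  have lower: "- C\<^sup>2 / \<epsilon> \<le> J u" for u
  proof -
    have "0 \<le> (\<epsilon> * norm u - C)\<^sup>2 / \<epsilon>" using \<epsilon> by simp
    also have "\<dots> = \<epsilon> * (norm u)\<^sup>2 - 2 * (norm u * C) + C\<^sup>2 / \<epsilon>"
      using \<epsilon> by (simp add: power2_eq_square field_simps)
    finally show ?thesis
      using C(2)[of u] coercive[of u] unfolding J_def by simp
  qed
  define m where "m = Inf (range J)"
  have bdd: "bdd_below (range J)" using lower by (intro bdd_belowI2) blast
  have m_le: "m \<le> J u" for u
    unfolding m_def by (rule cInf_lower[OF _ bdd]) simp
  have "\<exists>u. J u < m + 1 / real (Suc n)" for n
    using cInf_lessD[of "range J" "m + 1 / real (Suc n)"] unfolding m_def by fastforce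
  then obtain u where u: "\<And>n. J (u n) < m + 1 / real (Suc n)" by metis
  \<comment> \<open>Parallelogram identity: the midpoint has energy at least m, so two
    near-minimisers are close to each other.\<close>
  have par: "\<epsilon> * (norm (v - w))\<^sup>2 \<le> 2 * (J v - m) + 2 * (J w - m)" for v w
  proof -
    have s: "inner (B w) v = inner (B v) w" by (metis sym inner_commute)
    have "inner (B (v - w)) (v - w) = 2 * J v + 2 * J w - 4 * J ((1/2) *\<^sub>R (v + w))"
      unfolding J_def
      by (simp add: B.diff B.add B.scaleR \<phi>.scaleR \<phi>.add s algebra_simps inner_add inner_diff)
    also have "\<dots> \<le> 2 * J v + 2 * J w - 4 * m"
      using m_le[of "(1/2) *\<^sub>R (v + w)"] by (intro diff_left_mono mult_left_mono) auto
    finally show ?thesis using coercive[of "v - w"] by argo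
  qed
  have "Cauchy u"
  proof (rule metric_CauchyI)
    fix e :: real assume e: "0 < e"
    obtain M where M: "4 / (\<epsilon> * e\<^sup>2) < real (Suc M)"
      using reals_Archimedean2 by (metis less_Suc_eq of_nat_less_iff order_less_trans lessI)
    have "dist (u k) (u n) < e" if "M \<le> k" "M \<le> n" for k n
    proof -
      have "J (u i) - m < 1 / real (Suc M)" if "M \<le> i" for i
      proof -
        have "1 / real (Suc i) \<le> 1 / real (Suc M)" using that by (simp add: frac_le)
        then show ?thesis using u[of i] by linarith
      qed
      from this[OF that(1)] this[OF that(2)] par[of "u k" "u n"]
      have "\<epsilon> * (norm (u k - u n))\<^sup>2 < 4 * (1 / real (Suc M))" by argo
      also have "4 * (1 / real (Suc M)) < \<epsilon> * e\<^sup>2"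
        using M \<epsilon> e by (simp add: field_simps)
      finally have "(norm (u k - u n))\<^sup>2 < e\<^sup>2" using \<epsilon> by simp
      then show ?thesis using e by (simp add: dist_norm power2_less_imp_less)
    qed
    then show "\<exists>M. \<forall>k\<ge>M. \<forall>n\<ge>M. dist (u k) (u n) < e" by blast
  qed
  then obtain U where U: "u \<longlonglongrightarrow> U" using Cauchy_convergent convergent_def by blast
  have "(\<lambda>n. J (u n)) \<longlonglongrightarrow> J U"
    unfolding J_def by (intro tendsto_intros B.tendsto \<phi>.tendsto U)
  moreover have "(\<lambda>n. m + 1 / real (Suc n)) \<longlonglongrightarrow> m + 0"
    by (intro tendsto_intros LIMSEQ_Suc lim_1_over_n)
  ultimately have "J U \<le> m + 0"
    by (rule LIMSEQ_le) (use u less_imp_le in blast)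
  then have min: "J U \<le> J v" for v using m_le[of v] by simp
  have "\<phi> f = inner f (B U)" for f
  proof -
    define c where "c = inner (B U) f - \<phi> f"
    define a where "a = inner (B f) f"
    \<comment> \<open>The denominator \<open>a + 1\<close> instead of \<open>a\<close> avoids
      division by zero at f = 0; the energy then changes by -t^2 (a + 2), which minimality forces to
      be zero.\<close>
    define t where "t = - c / (a + 1)"
    have a: "0 \<le> a" using coercive[of f] \<epsilon> unfolding a_def
      by (smt (verit) mult_nonneg_nonneg zero_le_power2)
    have s: "inner (B f) U = inner (B U) f" by (metis sym inner_commute)
    have "J (U + t *\<^sub>R f) = J U + t\<^sup>2 * a + 2 * t * c"
      unfolding J_def a_def c_def
      by (simp add: B.add B.scaleR \<phi>.scaleR \<phi>.add s algebra_simps inner_add power2_eq_square)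
    with min[of "U + t *\<^sub>R f"] have "0 \<le> t\<^sup>2 * a + 2 * t * c" by simp
    have c: "c = - t * (a + 1)" using a unfolding t_def by simp
    have "t\<^sup>2 * (a + 2) \<le> 0"
      using \<open>0 \<le> t\<^sup>2 * a + 2 * t * c\<close> unfolding c by (simp add: algebra_simps power2_eq_square)
    then have "t = 0" using a by (simp add: mult_le_0_iff)
    then have "c = 0" by (simp add: c)
    then show ?thesis unfolding c_def by (simp add: inner_commute)
  qed
  then show ?thesis by blast
qed

lemma psd_Cauchy_Schwarz:
  fixes B :: "'a::real_inner \<Rightarrow> 'a"
  assumes B: "bounded_linear B" and sym: "\<And>f g. inner (B f) g = inner f (B g)"
    and psd: "\<And>f. 0 \<le> inner (B f) f"
  shows "(inner (B f) g)\<^sup>2 \<le> inner (B f) f * inner (B g) g"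
proof -
  interpret B: bounded_linear B by fact
  define a b c where "a = inner (B f) f" and "b = inner (B f) g" and "c = inner (B g) g"
  have s: "inner (B g) f = b" unfolding b_def by (metis sym inner_commute)
  have q: "0 \<le> x\<^sup>2 * a + 2 * x * y * b + y\<^sup>2 * c" for x y
  proof -
    have "inner (B (x *\<^sub>R f + y *\<^sub>R g)) (x *\<^sub>R f + y *\<^sub>R g) = x\<^sup>2 * a + 2 * x * y * b + y\<^sup>2 * c"
      by (simp add: B.add B.scaleR inner_add s flip: a_def b_def c_def)
        (simp add: algebra_simps power2_eq_square)
    then show ?thesis using psd[of "x *\<^sub>R f + y *\<^sub>R g"] by simp
  qed
  have ac: "0 \<le> a" "0 \<le> c" using psd unfolding a_def c_def by blast+
  have "b\<^sup>2 \<le> a * c"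
  proof (cases "c = 0")
    case True
    have "b = 0"
    proof (rule ccontr)
      assume "b \<noteq> 0"
      \<comment> \<open>When c = 0 the form is affine in y; at this y its value is -a - 2.\<close>
      with q[of 1 "- (a + 1) / b"] True ac show False by simp
    qed
    then show ?thesis using True by simp
  next
    case False
    then have "0 < c" using ac by simp
    have "0 \<le> c * (a * c - b\<^sup>2)" using q[of c "- b"]
      by (simp add: algebra_simps power2_eq_square)
    with \<open>0 < c\<close> show ?thesis by (simp add: zero_le_mult_iff)
  qed
  then show ?thesis unfolding a_def b_def c_def .
qed

text \<open>For invertible \<open>A\<close> and \<open>A'\<close> the claim says that \<open>X = A\<^sup>-\<^sup>1 H\<^sup>* A'\<^sup>-\<^sup>1 H\<close> is at most \<open>1\<close>
  for the scalar product \<open>[f, g] = \<langle>A f, g\<rangle>\<close>, in which \<open>X\<close> is symmetric. The powers of \<open>X\<close> are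
  bounded since \<open>H\<^sup>* A'\<^sup>-\<^sup>1\<close> and \<open>H A\<^sup>-\<^sup>1\<close> are contractions, and \<open>[X\<^sup>2\<^sup>k f, f]\<close> would
  grow without bound if \<open>[X f, f] > [f, f]\<close>.\<close>

lemma Kato_inequality_coercive:
  fixes H Hs A A' :: "'a::{real_inner,complete_space} \<Rightarrow> 'a"
  assumes A: "bounded_linear A" and symA: "\<And>f g. inner (A f) g = inner f (A g)"
    and A': "bounded_linear A'" and symA': "\<And>f g. inner (A' f) g = inner f (A' g)"
    and co: "\<And>f. \<epsilon> * (norm f)\<^sup>2 \<le> inner (A f) f" and co': "\<And>f. \<epsilon> * (norm f)\<^sup>2 \<le> inner (A' f) f"
    and \<epsilon>: "0 < \<epsilon>"
    and adj: "\<And>f g. inner (H f) g = inner f (Hs g)"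
    and le: "\<And>f. norm (H f) \<le> norm (A f)" and le': "\<And>f. norm (Hs f) \<le> norm (A' f)"
  shows "(inner (H f) g)\<^sup>2 \<le> inner (A f) f * inner (A' g) g"
proof -
  have pos: "0 \<le> inner (A f) f" for f using co[of f] \<epsilon>
    by (smt (verit) mult_nonneg_nonneg zero_le_power2)
  have pos': "0 \<le> inner (A' f) f" for f using co'[of f] \<epsilon>
    by (smt (verit) mult_nonneg_nonneg zero_le_power2)
  have inv: "\<exists>u. B u = h"
    if B: "bounded_linear B" "\<And>f g. inner (B f) g = inner f (B g)"
      "\<And>f. \<epsilon> * (norm f)\<^sup>2 \<le> inner (B f) f" for B and h :: 'a
  proof -
    obtain u where "\<And>f. inner f h = inner f (B u)"
      using coercive_representation[OF B \<epsilon>, of "\<lambda>f. inner f h"] bounded_linear_inner_left by blast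
    then have "inner (h - B u) (h - B u) = 0" by (simp add: inner_diff_right)
    then show ?thesis by auto
  qed
  \<comment> \<open>Coercive symmetric operators are onto, so R and R' play the parts of the
    inverses of A and A'.\<close>
  obtain R where R: "\<And>h. A (R h) = h" using inv[OF A symA co] by metis
  obtain R' where R': "\<And>h. A' (R' h) = h" using inv[OF A' symA' co'] by metis
  define X where "X f = R (Hs (R' (H f)))" for f
  have AX: "inner (A (X f)) g = inner (R' (H f)) (H g)" for f g
    unfolding X_def R by (simp add: adj inner_commute)
  have symR': "inner (R' h) k = inner h (R' k)" for h k
    using symA'[of "R' h" "R' k"] by (simp add: R')
  have symX: "inner (A (X f)) g = inner (A f) (X g)" for f g
    by (metis AX inner_commute symA symR')
  define m where "m k = inner (A ((X ^^ k) f)) f" for k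
  \<comment> \<open>Powers of X can be shared between the two slots, so \<open>m (2 * k)\<close> is
    the squared energy of \<open>(X ^^ k) f\<close>; Cauchy-Schwarz then gives the doubling
    inequality \<open>dbl\<close>.\<close>
  have shift: "inner (A ((X ^^ (i + j)) f)) f = inner (A ((X ^^ i) f)) ((X ^^ j) f)" for i j
  proof (induction j arbitrary: i)
    case (Suc j)
    have "inner (A ((X ^^ (i + Suc j)) f)) f = inner (A ((X ^^ (Suc i + j)) f)) f" by simp
    also have "\<dots> = inner (A ((X ^^ Suc i) f)) ((X ^^ j) f)" by (rule Suc)
    also have "\<dots> = inner (A ((X ^^ i) f)) ((X ^^ Suc j) f)" by (simp add: symX)
    finally show ?case .
  qed simp
  have dbl: "(m k)\<^sup>2 \<le> m 0 * m (2 * k)" for k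
    using psd_Cauchy_Schwarz[OF A symA pos, of "(X ^^ k) f" f] shift[of k k]
    unfolding m_def by (simp add: mult_2 mult.commute[of "inner (A f) f"])
  have contr: "norm (A (X g)) \<le> norm (A g)" for g
  proof -
    have "norm (A (X g)) = norm (Hs (R' (H g)))" by (simp add: X_def R)
    also have "\<dots> \<le> norm (H g)" using le'[of "R' (H g)"] by (simp add: R')
    finally show ?thesis using le[of g] by linarith
  qed
  have "norm (A ((X ^^ k) f)) \<le> norm (A f)" for k
    by (induction k) (auto intro: order_trans[OF contr])
  then have bound: "m k \<le> norm (A f) * norm f" for k
    unfolding m_def by (meson mult_right_mono norm_cauchy_schwarz norm_ge_zero order_trans)
  have m0: "0 \<le> m 0" unfolding m_def using pos by simp
  have m1: "0 \<le> m 1"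
  proof -
    have "m 1 = inner (R' (H f)) (A' (R' (H f)))" unfolding m_def by (simp add: AX R')
    then show ?thesis using pos'[of "R' (H f)"] by (simp add: inner_commute)
  qed
  have "m 1 \<le> m 0"
  proof (rule ccontr)
    assume n: "\<not> m 1 \<le> m 0"
    have "m 0 \<noteq> 0" using dbl[of 1] n m0 by auto
    then have m0: "0 < m 0" using m0 by simp
    define q where "q = m 1 / m 0"
    have q: "1 < q" using n m0 unfolding q_def by simp
    have grow: "m 0 * q ^ (2 ^ j) \<le> m (2 ^ j)" for j
    proof (induction j)
      case 0 then show ?case using m0 by (simp add: q_def)
    next
      case (Suc j)
      have "(m 0 * q ^ (2 ^ j))\<^sup>2 \<le> (m (2 ^ j))\<^sup>2"
        using Suc m0 q by (intro power_mono) auto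
      also have "\<dots> \<le> m 0 * m (2 ^ Suc j)" using dbl[of "2 ^ j"] by simp
      finally have "m 0 * (m 0 * q ^ (2 ^ Suc j)) \<le> m 0 * m (2 ^ Suc j)"
        by (simp add: power2_eq_square power_mult_distrib power_add mult_2 algebra_simps)
      then show ?case using m0 by simp
    qed
    obtain j where j: "norm (A f) * norm f / m 0 < q ^ j" using real_arch_pow[OF q] by blast
    have "q ^ j \<le> q ^ (2 ^ j)" using q by (intro power_increasing) auto
    with j have "norm (A f) * norm f / m 0 < q ^ (2 ^ j)" by linarith
    then have "norm (A f) * norm f < m 0 * q ^ (2 ^ j)" using m0 by (simp add: field_simps)
    with grow[of j] bound[of "2 ^ j"] show False by linarith
  qed
  \<comment> \<open>Writing \<open>H f\<close> as \<open>A' (R' (H f))\<close>, Cauchy-Schwarz for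
    A' reduces the claim to \<open>m 1 \<le> m 0\<close>.\<close>
  have "(inner (H f) g)\<^sup>2 = (inner (A' (R' (H f))) g)\<^sup>2" by (simp add: R')
  also have "\<dots> \<le> inner (A' (R' (H f))) (R' (H f)) * inner (A' g) g"
    by (rule psd_Cauchy_Schwarz[OF A' symA' pos'])
  also have "inner (A' (R' (H f))) (R' (H f)) = m 1"
    using AX[of f f] by (simp add: m_def R' inner_commute[of "H f"])
  also have "m 1 * inner (A' g) g \<le> m 0 * inner (A' g) g"
    using \<open>m 1 \<le> m 0\<close> pos' by (rule mult_right_mono)
  finally show ?thesis unfolding m_def by simp
qed

text \<open>Adding a multiple \<epsilon> of the identity makes both operators coercive. The
  domination hypotheses survive because the cross term 2 \<epsilon> <B h, h> in the squared norm is
  nonnegative; then \<epsilon> tends to 0.\<close>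

lemma Kato_inequality:
  fixes H Hs A A' :: "'a::{real_inner,complete_space} \<Rightarrow> 'a"
  assumes A: "bounded_linear A" and symA: "\<And>f g. inner (A f) g = inner f (A g)"
    and A': "bounded_linear A'" and symA': "\<And>f g. inner (A' f) g = inner f (A' g)"
    and pos: "\<And>f. 0 \<le> inner (A f) f" and pos': "\<And>f. 0 \<le> inner (A' f) f"
    and adj: "\<And>f g. inner (H f) g = inner f (Hs g)"
    and le: "\<And>f. norm (H f) \<le> norm (A f)" and le': "\<And>f. norm (Hs f) \<le> norm (A' f)"
  shows "(inner (H f) g)\<^sup>2 \<le> inner (A f) f * inner (A' g) g"
proof -
  have mono: "norm (B h) \<le> norm (B h + \<epsilon> *\<^sub>R h)"
    if "\<And>f. 0 \<le> inner (B f) f" "0 < \<epsilon>" for B and \<epsilon> :: real and h :: 'a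
  proof -
    have "(norm (B h + \<epsilon> *\<^sub>R h))\<^sup>2 = (norm (B h))\<^sup>2 + 2 * \<epsilon> * inner (B h) h + (\<epsilon> * norm h)\<^sup>2"
      by (simp add: power2_norm_eq_inner inner_add inner_commute algebra_simps) (simp add: power2_eq_square)
    then have "(norm (B h))\<^sup>2 \<le> (norm (B h + \<epsilon> *\<^sub>R h))\<^sup>2"
      using that(1)[of h] that(2) by simp
    then show ?thesis by (rule power2_le_imp_le) simp
  qed
  have eps: "(inner (H f) g)\<^sup>2 \<le> inner (A f + \<epsilon> *\<^sub>R f) f * inner (A' g + \<epsilon> *\<^sub>R g) g" if "0 < \<epsilon>" for \<epsilon>
  proof (rule Kato_inequality_coercive[of "\<lambda>f. A f + \<epsilon> *\<^sub>R f" "\<lambda>f. A' f + \<epsilon> *\<^sub>R f" \<epsilon> H Hs])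
    show "bounded_linear (\<lambda>f. A f + \<epsilon> *\<^sub>R f)" "bounded_linear (\<lambda>f. A' f + \<epsilon> *\<^sub>R f)"
      by (intro bounded_linear_add A A' bounded_linear_scaleR_right)+
    fix h k
    show "norm (H h) \<le> norm (A h + \<epsilon> *\<^sub>R h)" "norm (Hs h) \<le> norm (A' h + \<epsilon> *\<^sub>R h)"
      using le[of h] le'[of h] mono[OF pos that, of h] mono[OF pos' that, of h] by linarith+
  qed (use that pos pos' adj in \<open>auto simp: inner_add symA symA' power2_norm_eq_inner\<close>)
  have "((\<lambda>\<epsilon>. inner (A f + \<epsilon> *\<^sub>R f) f * inner (A' g + \<epsilon> *\<^sub>R g) g) \<longlongrightarrow>
      inner (A f + 0 *\<^sub>R f) f * inner (A' g + 0 *\<^sub>R g) g) (at_right 0)"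
    by (intro tendsto_intros)
  moreover have "eventually (\<lambda>\<epsilon>. (inner (H f) g)\<^sup>2 \<le>
      inner (A f + \<epsilon> *\<^sub>R f) f * inner (A' g + \<epsilon> *\<^sub>R g) g) (at_right 0)"
    using eps by (auto simp: eventually_at_filter)
  ultimately have "(inner (H f) g)\<^sup>2 \<le> inner (A f + 0 *\<^sub>R f) f * inner (A' g + 0 *\<^sub>R g) g"
    by (intro tendsto_lowerbound) auto
  then show ?thesis by simp
qed

section \<open>The Hilbert space of square integrable functions\<close>

lemma square_integrable_measurable: "square_integrable f \<Longrightarrow> f \<in> borel_measurable lebesgue"
  by (simp add: square_integrable_def)

lemma square_integrable_integrable:
  "square_integrable f \<Longrightarrow> integrable lebesgue (\<lambda>x. (cmod (f x))\<^sup>2)"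
  by (simp add: square_integrable_def)

lemma square_integrable_cnj: "square_integrable f \<Longrightarrow> square_integrable (\<lambda>x. cnj (f x))"
  using borel_measurable_continuous_on[OF continuous_on_cnj[OF continuous_on_id]]
  by (auto simp: square_integrable_def)

lemma square_integrable_mult:
  "square_integrable f \<Longrightarrow> square_integrable g \<Longrightarrow> integrable lebesgue (\<lambda>x. f x * g x)"
  using square_integrable_mult_cnj[of f "\<lambda>x. cnj (g x)"] square_integrable_cnj by simp

lemma square_integrable_sum:
  "finite I \<Longrightarrow> (\<And>i. i \<in> I \<Longrightarrow> square_integrable (f i)) \<Longrightarrow> square_integrable (\<lambda>x. \<Sum>i\<in>I. f i x)"
  by (induction rule: finite_induct) (auto intro: square_integrable_zero square_integrable_add)

lemma square_integrable_uminus: "square_integrable f \<Longrightarrow> square_integrable (\<lambda>x. - f x)"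
  using square_integrable_scale[of f "-1"] by simp

lemma square_integrable_diff:
  "square_integrable f \<Longrightarrow> square_integrable g \<Longrightarrow> square_integrable (\<lambda>x. f x - g x)"
  using square_integrable_add[of f "\<lambda>x. - g x"] square_integrable_uminus by simp

lemma square_integrable_bound:
  assumes "f \<in> borel_measurable lebesgue" "integrable lebesgue (\<lambda>x. (a x)\<^sup>2)"
    and "\<And>x. cmod (f x) \<le> a x"
  shows "square_integrable f"
  unfolding square_integrable_def
proof
  show "integrable lebesgue (\<lambda>x. (cmod (f x))\<^sup>2)"
  proof (rule Bochner_Integration.integrable_bound[OF assms(2)])
    show "(\<lambda>x. (cmod (f x))\<^sup>2) \<in> borel_measurable lebesgue"
      using assms(1) by measurable
    show "AE x in lebesgue. norm ((cmod (f x))\<^sup>2) \<le> norm ((a x)\<^sup>2)"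
      using assms(3) by (intro AE_I2) (simp add: power_mono)
  qed
qed fact

lemma abs_rep_L2: "abs_L2 (rep_L2 f) = f"
  by (rule Quotient_abs_rep[OF Quotient_L2])

lemma AE_rep_abs_L2: "square_integrable f \<Longrightarrow> AE x in lebesgue. rep_L2 (abs_L2 f) x = f x"
  using Quotient_rep_abs[OF Quotient_L2, of f] by simp

lemma abs_L2_eq_iff:
  "square_integrable f \<Longrightarrow> square_integrable g \<Longrightarrow>
    abs_L2 f = abs_L2 g \<longleftrightarrow> (AE x in lebesgue. f x = g x)"
  using Quotient_rel[OF Quotient_L2, of f g] by simp

lemma L2_eq_iff: "f = g \<longleftrightarrow> (AE x in lebesgue. rep_L2 f x = rep_L2 g x)"
  using abs_L2_eq_iff[OF square_integrable_rep_L2 square_integrable_rep_L2, of f g]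
  by (simp add: abs_rep_L2)

lemma abs_L2_add:
  "square_integrable f \<Longrightarrow> square_integrable g \<Longrightarrow> abs_L2 f + abs_L2 g = abs_L2 (\<lambda>x. f x + g x)"
  by (rule plus_L2.abs_eq) simp_all

lemma abs_L2_scale: "square_integrable f \<Longrightarrow> scaleC_L2 c (abs_L2 f) = abs_L2 (\<lambda>x. c * f x)"
  by (rule scaleC_L2.abs_eq) simp_all

lemma abs_L2_zero: "abs_L2 (\<lambda>x. 0) = 0"
  by (simp add: zero_L2_def)

lemma abs_L2_sum:
  "finite I \<Longrightarrow> (\<And>i. i \<in> I \<Longrightarrow> square_integrable (f i)) \<Longrightarrow>
    abs_L2 (\<lambda>x. \<Sum>i\<in>I. f i x) = (\<Sum>i\<in>I. abs_L2 (f i))"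
proof (induction rule: finite_induct)
  case empty
  then show ?case by (simp add: abs_L2_zero)
next
  case (insert i I)
  then have "square_integrable (f i)" "square_integrable (\<lambda>x. \<Sum>i\<in>I. f i x)"
    by (auto intro: square_integrable_sum)
  from abs_L2_add[OF this] insert show ?case by simp
qed

lemma cinner_abs_L2:
  "square_integrable f \<Longrightarrow> square_integrable g \<Longrightarrow>
    cinner (abs_L2 f) (abs_L2 g) = (\<integral>x. f x * cnj (g x) \<partial>lebesgue)"
  by (rule cinner.abs_eq) simp_all

lemma cinner_rep: "cinner f g = (\<integral>x. rep_L2 f x * cnj (rep_L2 g x) \<partial>lebesgue)"
  by (simp add: cinner_def)

lemma diff_L2_eq: "f - g = f + scaleC_L2 (-1) g"
  unfolding minus_L2_def uminus_L2_def ..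

lemma AE_rep_add: "AE x in lebesgue. rep_L2 (f + g) x = rep_L2 f x + rep_L2 g x"
  using AE_rep_abs_L2[OF square_integrable_add[OF square_integrable_rep_L2[of f] square_integrable_rep_L2[of g]]]
    abs_L2_add[OF square_integrable_rep_L2[of f] square_integrable_rep_L2[of g]]
  by (simp only: abs_rep_L2)

lemma AE_rep_scale: "AE x in lebesgue. rep_L2 (scaleC_L2 c f) x = c * rep_L2 f x"
  using AE_rep_abs_L2[OF square_integrable_scale[OF square_integrable_rep_L2[of f], of c]]
    abs_L2_scale[OF square_integrable_rep_L2[of f], of c]
  by (simp only: abs_rep_L2)

lemma AE_rep_diff: "AE x in lebesgue. rep_L2 (f - g) x = rep_L2 f x - rep_L2 g x"
  unfolding diff_L2_eq using AE_rep_add[of f "scaleC_L2 (-1) g"] AE_rep_scale[of "-1" g]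
  by eventually_elim (simp only: mult_minus_left mult_1_left diff_conv_add_uminus)

lemma cinner_add_left: "cinner (f + g) h = cinner f h + cinner g h"
  by transfer (simp add: distrib_right square_integrable_mult_cnj)

lemma cinner_scale_left: "cinner (scaleC_L2 c f) g = c * cinner f g"
  by transfer (simp add: mult.assoc)

lemma cinner_commute: "cinner f g = cnj (cinner g f)"
proof transfer
  fix f g :: "real \<Rightarrow> complex"
  have "(\<integral>x. f x * cnj (g x) \<partial>lebesgue) = (\<integral>x. cnj (g x * cnj (f x)) \<partial>lebesgue)"
    by (simp add: mult.commute)
  also have "\<dots> = cnj (\<integral>x. g x * cnj (f x) \<partial>lebesgue)"
    by (simp only: Bochner_Integration.integral_cnj)
  finally show "(\<integral>x. f x * cnj (g x) \<partial>lebesgue) = cnj (\<integral>x. g x * cnj (f x) \<partial>lebesgue)" .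
qed

lemma cinner_add_right: "cinner f (g + h) = cinner f g + cinner f h"
  by (metis cinner_add_left cinner_commute complex_cnj_add)

lemma cinner_scale_right: "cinner f (scaleC_L2 c g) = cnj c * cinner f g"
  by (metis cinner_scale_left cinner_commute complex_cnj_mult)

lemma cinner_diff_right: "cinner f (g - h) = cinner f g - cinner f h"
  unfolding diff_L2_eq cinner_add_right cinner_scale_right by simp

lemma scaleR_scaleC_L2: "r *\<^sub>R f = scaleC_L2 (complex_of_real r) f"
  by (simp add: scaleR_L2_def)

lemma cinner_self: "cinner f f = complex_of_real ((norm f)\<^sup>2)"
proof -
  have "Im (cinner f f) = 0" using arg_cong[OF cinner_commute[of f f], of Im] by simp
  then show ?thesis by (simp add: complex_eq_iff power2_norm_eq_inner inner_L2_def)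
qed

lemma norm_L2_power2: "(norm f)\<^sup>2 = (\<integral>x. (cmod (rep_L2 f x))\<^sup>2 \<partial>lebesgue)"
proof -
  have "complex_of_real ((norm f)\<^sup>2) = (\<integral>x. complex_of_real ((cmod (rep_L2 f x))\<^sup>2) \<partial>lebesgue)"
    unfolding cinner_self[symmetric] cinner_rep by (simp only: complex_norm_square)
  then show ?thesis by (simp only: integral_complex_of_real of_real_eq_iff)
qed

lemma nn_integral_rep_L2:
  "(\<integral>\<^sup>+x. ennreal ((cmod (rep_L2 f x))\<^sup>2) \<partial>lebesgue) = ennreal ((norm f)\<^sup>2)"
  unfolding norm_L2_power2
  by (rule nn_integral_eq_integral) (simp_all add: square_integrable_integrable square_integrable_rep_L2)

lemma complex_phase: obtains c where "cmod c = 1" "c * z = complex_of_real (cmod z)"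
proof (cases "z = 0")
  case True
  then show ?thesis using that[of 1] by simp
next
  case False
  show ?thesis
  proof (rule that)
    show "cmod (cnj z / complex_of_real (cmod z)) = 1" using False by (simp add: norm_divide)
    show "cnj z / complex_of_real (cmod z) * z = complex_of_real (cmod z)"
      using False complex_norm_square[of z] by (simp add: power2_eq_square mult.commute field_simps)
  qed
qed

section \<open>Completeness of \<open>L2\<close> (Riesz-Fischer)\<close>

lemma nn_integral_rep_diff:
  "(\<integral>\<^sup>+x. ennreal ((cmod (rep_L2 f x - rep_L2 g x))\<^sup>2) \<partial>lebesgue) = ennreal ((dist f g)\<^sup>2)"
proof -
  have "(\<integral>\<^sup>+x. ennreal ((cmod (rep_L2 f x - rep_L2 g x))\<^sup>2) \<partial>lebesgue) =
      (\<integral>\<^sup>+x. ennreal ((cmod (rep_L2 (f - g) x))\<^sup>2) \<partial>lebesgue)"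
    by (rule nn_integral_cong_AE) (use AE_rep_diff[of f g] in \<open>auto elim: eventually_mono\<close>)
  then show ?thesis by (simp add: nn_integral_rep_L2 dist_norm)
qed

lemma rep_L2_measurable: "rep_L2 f \<in> borel_measurable lebesgue"
  by (simp add: square_integrable_measurable square_integrable_rep_L2)

text \<open>The rate is chosen so that the squared increments, weighted by 4^k, have integrals at
  most 4^k 16^-k = 4^-k. Their sum is finite almost everywhere, which bounds the k-th increment by a
  multiple of 2^-k and yields a pointwise limit.\<close>

lemma L2_convergent_of_fast:
  assumes fast: "\<And>k. dist (X (Suc k)) (X k) \<le> (1/4) ^ k"
  shows "convergent (X :: nat \<Rightarrow> L2)"
proof -
  note [measurable] = rep_L2_measurable
  define d where "d k x = rep_L2 (X (Suc k)) x - rep_L2 (X k) x" for k x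
  have [measurable]: "d k \<in> borel_measurable lebesgue" for k unfolding d_def by measurable
  have nn: "(\<integral>\<^sup>+x. ennreal (4 ^ k * (cmod (d k x))\<^sup>2) \<partial>lebesgue) \<le> ennreal ((1/4) ^ k)" for k
  proof -
    have "(\<integral>\<^sup>+x. ennreal (4 ^ k * (cmod (d k x))\<^sup>2) \<partial>lebesgue) =
        ennreal (4 ^ k) * (\<integral>\<^sup>+x. ennreal ((cmod (d k x))\<^sup>2) \<partial>lebesgue)"
      by (simp add: ennreal_mult nn_integral_cmult)
    also have "\<dots> = ennreal (4 ^ k * (dist (X (Suc k)) (X k))\<^sup>2)"
      by (simp add: d_def nn_integral_rep_diff ennreal_mult)
    also have "\<dots> \<le> ennreal (4 ^ k * ((1/4) ^ k)\<^sup>2)"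
      by (intro ennreal_leI mult_left_mono power_mono fast) auto
    also have "4 ^ k * ((1/4) ^ k)\<^sup>2 = (1/4 :: real) ^ k"
      by (simp add: power2_eq_square field_simps)
    finally show ?thesis .
  qed
  have "(\<integral>\<^sup>+x. (\<Sum>k. ennreal (4 ^ k * (cmod (d k x))\<^sup>2)) \<partial>lebesgue) =
      (\<Sum>k. \<integral>\<^sup>+x. ennreal (4 ^ k * (cmod (d k x))\<^sup>2) \<partial>lebesgue)"
    by (rule nn_integral_suminf) measurable
  also have "\<dots> \<le> (\<Sum>k. ennreal ((1/4) ^ k))"
    by (rule suminf_le) (use nn in auto)
  also have "\<dots> = ennreal (\<Sum>k. (1/4) ^ k)"
    by (rule suminf_ennreal2) (auto simp: summable_geometric)
  finally have "(\<integral>\<^sup>+x. (\<Sum>k. ennreal (4 ^ k * (cmod (d k x))\<^sup>2)) \<partial>lebesgue) \<noteq> \<infinity>"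
    by (auto simp: top_unique)
  then have AE: "AE x in lebesgue. (\<Sum>k. ennreal (4 ^ k * (cmod (d k x))\<^sup>2)) \<noteq> \<infinity>"
    by (rule nn_integral_noteq_infinite[rotated]) measurable
  have conv: "convergent (\<lambda>k. rep_L2 (X k) x)"
    if fin: "(\<Sum>k. ennreal (4 ^ k * (cmod (d k x))\<^sup>2)) \<noteq> \<infinity>" for x
  proof -
    define C where "C = enn2real (\<Sum>k. ennreal (4 ^ k * (cmod (d k x))\<^sup>2))"
    have C: "0 \<le> C" "(\<Sum>k. ennreal (4 ^ k * (cmod (d k x))\<^sup>2)) = ennreal C"
      unfolding C_def using fin
      by (simp_all only: enn2real_nonneg ennreal_enn2real less_top infinity_ennreal_def not_False_eq_True)
    have bound: "cmod (d k x) \<le> sqrt C * (1/2) ^ k" for k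
    proof -
      have "(\<Sum>j\<in>{k}. ennreal (4 ^ j * (cmod (d j x))\<^sup>2)) \<le> ennreal C"
        unfolding C(2)[symmetric] by (rule sum_le_suminf) auto
      then have "4 ^ k * (cmod (d k x))\<^sup>2 \<le> C" using C(1) by simp
      moreover have "(2 ^ k * cmod (d k x))\<^sup>2 = 4 ^ k * (cmod (d k x))\<^sup>2"
        by (simp add: power_mult_distrib) (simp add: power2_eq_square flip: power_mult_distrib)
      ultimately have "2 ^ k * cmod (d k x) \<le> sqrt C" by (simp add: real_le_rsqrt)
      then show ?thesis by (simp add: field_simps power_one_over)
    qed
    have "summable (\<lambda>k. d k x)"
      by (rule summable_comparison_test[of _ "\<lambda>k. sqrt C * (1/2) ^ k"])
        (use bound in \<open>auto intro!: summable_mult summable_geometric\<close>)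
    then have "convergent (\<lambda>n. \<Sum>k<n. d k x)" by (simp add: summable_iff_convergent)
    moreover have "(\<Sum>k<n. d k x) = rep_L2 (X n) x - rep_L2 (X 0) x" for n
      unfolding d_def by (rule sum_lessThan_telescope)
    ultimately have "convergent (\<lambda>n. rep_L2 (X n) x - rep_L2 (X 0) x)" by simp
    from convergent_add[OF this convergent_const[of "rep_L2 (X 0) x"]] show ?thesis by simp
  qed
  define f where "f x = lim (\<lambda>k. rep_L2 (X k) x)" for x
  have [measurable]: "f \<in> borel_measurable lebesgue"
    unfolding f_def by (rule borel_measurable_lim_metric) measurable
  have lim: "AE x in lebesgue. (\<lambda>k. rep_L2 (X k) x) \<longlonglongrightarrow> f x"
    using AE by eventually_elim (simp add: f_def conv convergent_LIMSEQ_iff[symmetric])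
  have far: "dist (X (k + j)) (X k) \<le> 2 * (1/4) ^ k" for k j
  proof -
    have "dist (X (k + j)) (X k) \<le> (\<Sum>i<j. dist (X (k + Suc i)) (X (k + i)))"
    proof (induction j)
      case (Suc j)
      have "dist (X (k + Suc j)) (X k) \<le> dist (X (k + Suc j)) (X (k + j)) + dist (X (k + j)) (X k)"
        by (rule dist_triangle)
      with Suc show ?case by simp
    qed simp
    also have "\<dots> \<le> (\<Sum>i<j. (1/4) ^ k * (1/4) ^ i)"
      by (intro sum_mono) (use fast in \<open>simp add: power_add[symmetric]\<close>)
    also have "\<dots> = (1/4) ^ k * ((1 - (1/4) ^ j) * (4/3))"
      by (simp add: sum_distrib_left[symmetric] sum_gp_strict)
    also have "\<dots> \<le> (1/4) ^ k * 2"
    proof (rule mult_left_mono)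
      have "(0 :: real) \<le> (1/4) ^ j" by simp
      then show "(1 - (1/4 :: real) ^ j) * (4/3) \<le> 2" by argo
    qed simp
    finally show ?thesis by simp
  qed
  \<comment> \<open>Pointwise convergence alone does not give convergence in norm; Fatou's lemma
    along k + j carries the tail estimate \<open>far\<close> over to the limit.\<close>
  have fatou: "(\<integral>\<^sup>+x. ennreal ((cmod (f x - rep_L2 (X k) x))\<^sup>2) \<partial>lebesgue) \<le> ennreal ((2 * (1/4) ^ k)\<^sup>2)" for k
  proof -
    have "(\<integral>\<^sup>+x. ennreal ((cmod (f x - rep_L2 (X k) x))\<^sup>2) \<partial>lebesgue) =
       (\<integral>\<^sup>+x. liminf (\<lambda>j. ennreal ((cmod (rep_L2 (X (k + j)) x - rep_L2 (X k) x))\<^sup>2)) \<partial>lebesgue)"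
    proof (rule nn_integral_cong_AE, use lim in eventually_elim)
      fix x assume "(\<lambda>j. rep_L2 (X j) x) \<longlonglongrightarrow> f x"
      then have "(\<lambda>j. rep_L2 (X (k + j)) x) \<longlonglongrightarrow> f x"
        using LIMSEQ_ignore_initial_segment[of _ "f x" k] by (simp add: add.commute)
      then have "(\<lambda>j. ennreal ((cmod (rep_L2 (X (k + j)) x - rep_L2 (X k) x))\<^sup>2)) \<longlonglongrightarrow>
          ennreal ((cmod (f x - rep_L2 (X k) x))\<^sup>2)"
        by (intro tendsto_intros)
      then show "ennreal ((cmod (f x - rep_L2 (X k) x))\<^sup>2) =
          liminf (\<lambda>j. ennreal ((cmod (rep_L2 (X (k + j)) x - rep_L2 (X k) x))\<^sup>2))"
        by (rule lim_imp_Liminf[symmetric, rotated]) simp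
    qed
    also have "\<dots> \<le> liminf (\<lambda>j. \<integral>\<^sup>+x. ennreal ((cmod (rep_L2 (X (k + j)) x - rep_L2 (X k) x))\<^sup>2) \<partial>lebesgue)"
      by (rule nn_integral_liminf) measurable
    also have "\<dots> \<le> liminf (\<lambda>j::nat. ennreal ((2 * (1/4) ^ k)\<^sup>2))"
      unfolding nn_integral_rep_diff
      by (intro Liminf_mono always_eventually allI ennreal_leI power_mono far zero_le_dist)
    finally show ?thesis by (simp add: Liminf_const)
  qed
  have "integrable lebesgue (\<lambda>x. (cmod (f x - rep_L2 (X 0) x))\<^sup>2)"
    by (rule integrableI_bounded) (use fatou[of 0] in \<open>auto intro: le_less_trans\<close>)
  then have "square_integrable (\<lambda>x. f x - rep_L2 (X 0) x)" by (simp add: square_integrable_def)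
  from square_integrable_add[OF this square_integrable_rep_L2[of "X 0"]]
  have sq: "square_integrable f" by simp
  have near: "dist (abs_L2 f) (X k) \<le> 2 * (1/4) ^ k" for k
  proof -
    have "ennreal ((dist (abs_L2 f) (X k))\<^sup>2) =
        (\<integral>\<^sup>+x. ennreal ((cmod (f x - rep_L2 (X k) x))\<^sup>2) \<partial>lebesgue)"
      unfolding nn_integral_rep_diff[symmetric]
      by (rule nn_integral_cong_AE) (use AE_rep_abs_L2[OF sq] in \<open>auto elim: eventually_mono\<close>)
    also have "\<dots> \<le> ennreal ((2 * (1/4) ^ k)\<^sup>2)" by (rule fatou)
    finally have "(dist (abs_L2 f) (X k))\<^sup>2 \<le> (2 * (1/4) ^ k)\<^sup>2"
      by (subst (asm) ennreal_le_iff) auto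
    then show ?thesis by (rule power2_le_imp_le) simp
  qed
  have "(\<lambda>k. 2 * (1/4 :: real) ^ k) \<longlonglongrightarrow> 2 * 0"
    by (rule tendsto_mult_left[OF LIMSEQ_realpow_zero]) auto
  then have lim0: "(\<lambda>k. 2 * (1/4 :: real) ^ k) \<longlonglongrightarrow> 0" by (simp only: mult_zero_right)
  have "(\<lambda>k. dist (X k) (abs_L2 f)) \<longlonglongrightarrow> 0"
  proof (rule Lim_null_comparison[OF always_eventually lim0], rule allI)
    fix k show "norm (dist (X k) (abs_L2 f)) \<le> 2 * (1/4) ^ k"
      using near[of k] by (simp only: real_norm_def abs_of_nonneg zero_le_dist dist_commute)
  qed
  then have "X \<longlonglongrightarrow> abs_L2 f" by (rule tendsto_dist_iff[THEN iffD2])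
  then show ?thesis by (rule convergentI)
qed

instance L2 :: complete_space
proof
  fix X :: "nat \<Rightarrow> L2"
  assume X: "Cauchy X"
  have "\<exists>N. \<forall>m\<ge>N. \<forall>n\<ge>N. dist (X m) (X n) < (1/4) ^ k" for k
    by (rule metric_CauchyD[OF X]) simp
  then obtain N where N: "\<And>k m n. N k \<le> m \<Longrightarrow> N k \<le> n \<Longrightarrow> dist (X m) (X n) < (1/4) ^ k"
    by metis
  \<comment> \<open>The running maximum keeps r strictly increasing while r k stays at or beyond N
    k.\<close>
  define r where "r = rec_nat (N 0) (\<lambda>k i. Suc (max i (N (Suc k))))"
  have r: "r 0 = N 0" "r (Suc k) = Suc (max (r k) (N (Suc k)))" for k
    unfolding r_def by simp_all
  have ge: "N k \<le> r k" for k by (cases k) (simp_all only: r le_SucI max.cobounded2 order_refl)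
  have r_mono: "strict_mono r" unfolding strict_mono_Suc_iff r(2) by (simp add: less_Suc_eq_le)
  have "dist (X (r (Suc k))) (X (r k)) \<le> (1/4) ^ k" for k
  proof (rule less_imp_le, rule N)
    show "N k \<le> r (Suc k)" using ge[of k] unfolding r(2) by linarith
  qed (rule ge)
  then have "convergent (\<lambda>k. X (r k))" by (rule L2_convergent_of_fast)
  then have "(X \<circ> r) \<longlonglongrightarrow> lim (X \<circ> r)" unfolding comp_def convergent_LIMSEQ_iff .
  with X r_mono have "X \<longlonglongrightarrow> lim (X \<circ> r)" by (rule Cauchy_converges_subseq)
  then show "convergent X" by (rule convergentI)
qed


section \<open>Adjoints and positive square roots\<close>

lemma bounded_op_linear: "bounded_op T \<Longrightarrow> bounded_linear T"
  by (simp add: bounded_op_def)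

lemma bounded_op_scale: "bounded_op T \<Longrightarrow> T (scaleC_L2 c f) = scaleC_L2 c (T f)"
  by (simp add: bounded_op_def)

lemma L2_eqI_cinner: "(\<And>h. cinner h f = cinner h g) \<Longrightarrow> f = g"
proof -
  assume "\<And>h. cinner h f = cinner h g"
  then have "cinner (f - g) (f - g) = 0" by (subst cinner_diff_right) simp
  then show "f = g" by (simp add: cinner_self)
qed

text \<open>Riesz representation for the real inner product, the real part of \<open>cinner\<close>,
  yields the adjoint; complex linearity of T then upgrades the real identity to the complex
  one.\<close>

lemma bounded_op_has_adjoint:
  assumes T: "bounded_op T"
  shows "\<exists>T'. bounded_op T' \<and> (\<forall>f g. cinner (T f) g = cinner f (T' g))"
proof -
  interpret T: bounded_linear T using T by (rule bounded_op_linear)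
  have "\<exists>u. \<forall>f. inner (T f) g = inner f u" for g
  proof -
    have "bounded_linear (\<lambda>f. inner (T f) g)"
      using bounded_linear_compose[OF bounded_linear_inner_left T.bounded_linear_axioms] by simp
    with coercive_representation[of "\<lambda>x. x" 1 "\<lambda>f. inner (T f) g"]
    show ?thesis by (simp add: power2_norm_eq_inner bounded_linear_ident)
  qed
  then obtain T' where T': "\<And>f g. inner (T f) g = inner f (T' g)" by metis
  have adj: "cinner (T f) g = cinner f (T' g)" for f g
  proof (rule complex_eqI)
    show "Re (cinner (T f) g) = Re (cinner f (T' g))" using T'[of f g] by (simp add: inner_L2_def)
    \<comment> \<open>The real part at \<i> f is minus the imaginary part at f.\<close>
    have "Re (cinner (scaleC_L2 \<i> (T f)) g) = Re (cinner (scaleC_L2 \<i> f) (T' g))"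
      using T'[of "scaleC_L2 \<i> f" g] by (simp add: inner_L2_def bounded_op_scale[OF T])
    then show "Im (cinner (T f) g) = Im (cinner f (T' g))" by (simp add: cinner_scale_left)
  qed
  have scale: "T' (scaleC_L2 c g) = scaleC_L2 c (T' g)" for c g
    by (rule L2_eqI_cinner) (simp only: adj[symmetric] cinner_scale_right)
  have "bounded_linear T'"
  proof (rule bounded_linear_intro)
    show "T' (f + g) = T' f + T' g" for f g
      by (rule L2_eqI_cinner) (simp only: adj[symmetric] cinner_add_right)
    show "T' (r *\<^sub>R f) = r *\<^sub>R T' f" for r f
      by (simp only: scaleR_scaleC_L2 scale)
    show "norm (T' f) \<le> norm f * onorm T" for f
    proof (cases "T' f = 0")
      case True
      then show ?thesis using onorm_pos_le[OF T.bounded_linear_axioms] by simp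
    next
      case False
      have "(norm (T' f))\<^sup>2 = inner (T (T' f)) f" by (simp add: T' power2_norm_eq_inner)
      also have "\<dots> \<le> norm (T (T' f)) * norm f" by (rule norm_cauchy_schwarz)
      also have "\<dots> \<le> (onorm T * norm (T' f)) * norm f"
        by (intro mult_right_mono onorm[OF T.bounded_linear_axioms]) simp
      finally have "norm (T' f) * norm (T' f) \<le> norm (T' f) * (norm f * onorm T)"
        by (simp add: power2_eq_square algebra_simps)
      then show ?thesis using False by simp
    qed
  qed
  with scale adj show ?thesis unfolding bounded_op_def by blast
qed

lemma adjoint_op:
  assumes "bounded_op T"
  shows "bounded_op (adjoint_op T)" "cinner (T f) g = cinner f (adjoint_op T g)"
proof -
  obtain T' where T': "bounded_op T'" "\<And>f g. cinner (T f) g = cinner f (T' g)"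
    using bounded_op_has_adjoint[OF assms] by blast
  have "adjoint_op T = T'"
    unfolding adjoint_op_def
  proof (rule the_equality)
    fix U assume U: "bounded_op U \<and> (\<forall>f g. cinner (T f) g = cinner f (U g))"
    have "U g = T' g" for g
      by (rule L2_eqI_cinner) (use U T'(2) in metis)
    then show "U = T'" ..
  qed (use T' in blast)
  with T' show "bounded_op (adjoint_op T)" "cinner (T f) g = cinner f (adjoint_op T g)" by simp_all
qed

lemma positive_op_bounded: "positive_op P \<Longrightarrow> bounded_op P"
  by (simp add: positive_op_def)

lemma positive_op_real: "positive_op P \<Longrightarrow> Im (cinner (P f) f) = 0"
  and positive_op_nonneg: "positive_op P \<Longrightarrow> 0 \<le> Re (cinner (P f) f)"
  unfolding positive_op_def by (auto simp: complex_nonneg_Reals_iff)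

text \<open>Polarisation: reality of the form at f + g relates the imaginary parts of <P f, g> and
  <P g, f>, and replacing g by \<i> g does the same for the real parts. Complex scalars are
  essential here.\<close>

lemma positive_op_hermitian:
  assumes P: "positive_op P"
  shows "cinner (P f) g = cinner f (P g)"
proof -
  interpret P: bounded_linear P
    using P by (intro bounded_op_linear positive_op_bounded)
  have Im: "Im (cinner (P f) g) + Im (cinner (P g) f) = 0" for f g
    using positive_op_real[OF P, of "f + g"] positive_op_real[OF P, of f] positive_op_real[OF P, of g]
    by (simp add: P.add cinner_add_left cinner_add_right)
  have Re: "Re (cinner (P f) g) = Re (cinner (P g) f)"
    using Im[of f "scaleC_L2 \<i> g"]
    by (simp add: bounded_op_scale[OF positive_op_bounded[OF P]] cinner_scale_left cinner_scale_right)
  have "cinner (P f) g = cnj (cinner (P g) f)"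
    using Im[of f g] Re by (simp add: complex_eq_iff)
  then show ?thesis using cinner_commute[of f "P g"] by simp
qed

text \<open>Multiplying f by a phase makes \<open>cinner (H f) g\<close> real and nonnegative, so
  that the real inequality sees its full modulus; the right side does not change because the phase
  has modulus one.\<close>

lemma cinner_Kato:
  assumes H: "bounded_op H" and A: "positive_op A" and A': "positive_op A'"
    and le: "\<And>f. norm (H f) \<le> norm (A f)" and le': "\<And>g. norm (adjoint_op H g) \<le> norm (A' g)"
  shows "(cmod (cinner (H f) g))\<^sup>2 \<le> Re (cinner (A f) f) * Re (cinner (A' g) g)"
proof -
  have sym: "inner (P f) g = inner f (P g)" if "positive_op P" for P f g
    using positive_op_hermitian[OF that, of f g] by (simp add: inner_L2_def)
  have pos: "0 \<le> inner (P f) f" if "positive_op P" for P f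
    using positive_op_nonneg[OF that, of f] by (simp add: inner_L2_def)
  have adj: "inner (H f) g = inner f (adjoint_op H g)" for f g
    using adjoint_op(2)[OF H, of f g] by (simp add: inner_L2_def)
  obtain c where c: "cmod c = 1" "c * cinner (H f) g = complex_of_real (cmod (cinner (H f) g))"
    by (rule complex_phase)
  have cc: "c * cnj c = 1" using complex_norm_square[of c] c(1) by simp
  have "cmod (cinner (H f) g) = inner (H (scaleC_L2 c f)) g"
    by (simp add: inner_L2_def bounded_op_scale[OF H] cinner_scale_left c)
  then have "(cmod (cinner (H f) g))\<^sup>2 = (inner (H (scaleC_L2 c f)) g)\<^sup>2" by simp
  also have "\<dots> \<le> Re (cinner (A (scaleC_L2 c f)) (scaleC_L2 c f)) * Re (cinner (A' g) g)"
    unfolding inner_L2_def[symmetric]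
    by (rule Kato_inequality[OF _ sym[OF A] _ sym[OF A'] pos[OF A] pos[OF A'] adj le le'])
      (intro bounded_op_linear positive_op_bounded A A')+
  also have "cinner (A (scaleC_L2 c f)) (scaleC_L2 c f) = (c * cnj c) * cinner (A f) f"
    by (simp only: bounded_op_scale[OF positive_op_bounded[OF A]] cinner_scale_left
        cinner_scale_right ac_simps)
  finally show ?thesis by (simp only: cc mult_1_left)
qed

text \<open>||A f||^2 = <A^2 f, f> = ||U f||^2 + ||V f||^2. The pairs U', U are kept abstract so
  that the lemma serves both H, S and their adjoints.\<close>

lemma positive_sqrt_dominates:
  assumes A: "is_positive_sqrt A (\<lambda>f. U' (U f) + V' (V f))"
    and adjU: "\<And>f g. cinner (U' f) g = cinner f (U g)" and adjV: "\<And>f g. cinner (V' f) g = cinner f (V g)"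
  shows "norm (U f) \<le> norm (A f)" "norm (V f) \<le> norm (A f)"
proof -
  have pos: "positive_op A" and sq: "A (A f) = U' (U f) + V' (V f)"
    using A unfolding is_positive_sqrt_def by (simp_all add: fun_eq_iff)
  have "cinner (A f) (A f) = cinner (A (A f)) f"
    by (simp only: positive_op_hermitian[OF pos])
  also have "\<dots> = cinner (U f) (U f) + cinner (V f) (V f)"
    by (simp only: sq cinner_add_left adjU adjV)
  finally have "complex_of_real ((norm (A f))\<^sup>2) = complex_of_real ((norm (U f))\<^sup>2 + (norm (V f))\<^sup>2)"
    by (simp only: cinner_self of_real_add)
  then have eq: "(norm (A f))\<^sup>2 = (norm (U f))\<^sup>2 + (norm (V f))\<^sup>2"
    by (simp only: of_real_eq_iff)
  then have "(norm (U f))\<^sup>2 \<le> (norm (A f))\<^sup>2" "(norm (V f))\<^sup>2 \<le> (norm (A f))\<^sup>2" by simp_all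
  then show "norm (U f) \<le> norm (A f)" "norm (V f) \<le> norm (A f)"
    by (auto intro: power2_le_imp_le)
qed

section \<open>Pointwise bounds of kernels\<close>

text \<open>Approximate point mass at x: a normalised indicator with integral 1, concentrating at x
  as h tends to 0.\<close>

definition bump :: "real \<Rightarrow> real \<Rightarrow> real \<Rightarrow> complex" where
  "bump x h y = complex_of_real (indicator {x..x + h} y / h)"

lemma bump_facts:
  assumes "0 < h"
  shows "integrable lebesgue (bump x h)" "(\<integral>y. bump x h y \<partial>lebesgue) = 1"
    "integrable lebesgue (\<lambda>y. cmod (bump x h y))" "(\<integral>y. cmod (bump x h y) \<partial>lebesgue) = 1"
    "square_integrable (bump x h)"
proof -
  have int: "integrable lebesgue (indicator {x..x + h} :: real \<Rightarrow> real)"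
    by (intro integrable_real_indicator) (auto simp: emeasure_lborel_Icc_eq)
  have val: "(\<integral>y. indicator {x..x + h} y \<partial>lebesgue) = h"
    using assms by simp
  have c: "cmod (bump x h y) = indicator {x..x + h} y / h" for y
    using assms unfolding bump_def norm_of_real by (simp add: indicator_def)
  have d: "integrable lebesgue (\<lambda>y. indicator {x..x + h} y / h)" "(\<integral>y. indicator {x..x + h} y / h \<partial>lebesgue) = 1"
    using int val assms by (simp_all add: integrable_divide)
  show b: "integrable lebesgue (bump x h)" unfolding bump_def using d(1) by (rule integrable_of_real)
  show "(\<integral>y. bump x h y \<partial>lebesgue) = 1" unfolding bump_def by (subst integral_complex_of_real) (simp only: d of_real_1)
  show "integrable lebesgue (\<lambda>y. cmod (bump x h y))" "(\<integral>y. cmod (bump x h y) \<partial>lebesgue) = 1"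
    using d by (simp_all only: c)
  have sq: "(cmod (bump x h y))\<^sup>2 = (1/h) * (indicator {x..x + h} y / h)" for y
    unfolding c by (simp add: indicator_def power2_eq_square)
  show "square_integrable (bump x h)"
    unfolding square_integrable_def sq using d(1) b by (intro conjI borel_measurable_integrable integrable_mult_right) auto
qed

text \<open>The closeness is assumed only almost everywhere because F will also be a representative
  of an image under the operator, which is determined only up to null sets.\<close>

lemma bump_average:
  assumes h: "0 < h" and int: "integrable lebesgue (\<lambda>y. F y * bump x h y)"
    and near: "AE y in lebesgue. y \<in> {x..x + h} \<longrightarrow> cmod (F y - c) \<le> e"
  shows "cmod ((\<integral>y. F y * bump x h y \<partial>lebesgue) - c) \<le> e"
proof -
  note b = bump_facts[OF h, of x]
  have "(\<integral>y. F y * bump x h y \<partial>lebesgue) - c = (\<integral>y. F y * bump x h y - c * bump x h y \<partial>lebesgue)"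
    using int b by simp
  also have "cmod \<dots> \<le> (\<integral>y. cmod (F y * bump x h y - c * bump x h y) \<partial>lebesgue)"
    by (rule integral_norm_bound)
  also have "\<dots> \<le> (\<integral>y. e * cmod (bump x h y) \<partial>lebesgue)"
  proof (rule integral_mono_AE)
    show "integrable lebesgue (\<lambda>y. cmod (F y * bump x h y - c * bump x h y))" using int b by simp
    show "integrable lebesgue (\<lambda>y. e * cmod (bump x h y))" using b by simp
    show "AE y in lebesgue. norm (F y * bump x h y - c * bump x h y) \<le> e * cmod (bump x h y)"
      using near
    proof eventually_elim
      case (elim y)
      have "norm (F y * bump x h y - c * bump x h y) = cmod (F y - c) * cmod (bump x h y)"
        by (simp add: left_diff_distrib flip: norm_mult)
      also have "\<dots> \<le> e * cmod (bump x h y)"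
        by (cases "y \<in> {x..x + h}") (use elim in \<open>auto simp: bump_def intro!: divide_right_mono mult_right_mono\<close>)
      finally show ?case .
    qed
  qed
  also have "\<dots> = e" using b by simp
  finally show ?thesis .
qed

text \<open>The form is a double average of K over a small square with corner (s, t). Averaging
  first in \<tau> and then in \<sigma> keeps the deviation below e / 2, by continuity of K.\<close>

lemma induced_form_limit:
  assumes K: "induces K T" and cont: "continuous_on UNIV K"
  shows "(\<lambda>n. cinner (T (abs_L2 (bump t (1 / real (Suc n))))) (abs_L2 (bump s (1 / real (Suc n)))))
    \<longlonglongrightarrow> K (s, t)"
proof (rule LIMSEQ_I)
  fix e :: real assume e: "0 < e"
  have "isCont K (s, t)" using cont by (simp add: continuous_on_eq_continuous_at)
  then obtain d where d: "0 < d" "\<And>z. dist z (s, t) < d \<Longrightarrow> dist (K z) (K (s, t)) < e / 2"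
    using e unfolding continuous_at_eps_delta by (metis half_gt_zero)
  obtain N where N: "1 / real (Suc N) < d / 2" using d(1) nat_approx_posE by (metis half_gt_zero)
  have "cmod (cinner (T (abs_L2 (bump t h))) (abs_L2 (bump s h)) - K (s, t)) < e"
    if n: "N \<le> n" and h_def: "h = 1 / real (Suc n)" for n h
  proof -
    have "h \<le> 1 / real (Suc N)" unfolding h_def using n by (simp add: frac_le)
    then have h: "0 < h" "h < d / 2" using N by (simp_all add: h_def)
    have near: "cmod (K (\<sigma>, \<tau>) - K (s, t)) \<le> e / 2" if "\<sigma> \<in> {s..s + h}" "\<tau> \<in> {t..t + h}" for \<sigma> \<tau>
    proof -
      have "dist (\<sigma>, \<tau>) (s, t) \<le> \<bar>\<sigma> - s\<bar> + \<bar>\<tau> - t\<bar>"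
        by (simp add: dist_Pair_Pair dist_real_def sqrt_sum_squares_le_sum_abs)
      also have "\<dots> < d" using that h by auto
      finally show ?thesis using d(2)[of "(\<sigma>, \<tau>)"] by (simp add: dist_norm)
    qed
    define u where "u = abs_L2 (bump t h)"
    have u: "AE \<tau> in lebesgue. rep_L2 u \<tau> = bump t h \<tau>"
      unfolding u_def by (rule AE_rep_abs_L2[OF bump_facts(5)[OF h(1)]])
    have "AE \<sigma> in lebesgue. \<sigma> \<in> {s..s + h} \<longrightarrow> cmod (rep_L2 (T u) \<sigma> - K (s, t)) \<le> e / 2"
    proof -
      from K have "AE \<sigma> in lebesgue. integrable lebesgue (\<lambda>\<tau>. K (\<sigma>, \<tau>) * rep_L2 u \<tau>) \<and>
          rep_L2 (T u) \<sigma> = (\<integral>\<tau>. K (\<sigma>, \<tau>) * rep_L2 u \<tau> \<partial>lebesgue)"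
        unfolding induces_def by blast
      then show ?thesis
      proof (eventually_elim, intro impI)
        fix \<sigma> assume \<sigma>: "\<sigma> \<in> {s..s + h}"
          and *: "integrable lebesgue (\<lambda>\<tau>. K (\<sigma>, \<tau>) * rep_L2 u \<tau>) \<and>
            rep_L2 (T u) \<sigma> = (\<integral>\<tau>. K (\<sigma>, \<tau>) * rep_L2 u \<tau> \<partial>lebesgue)"
        have cont\<sigma>: "continuous_on UNIV (\<lambda>\<tau>. K (\<sigma>, \<tau>))"
          by (rule continuous_on_compose2[OF cont]) (auto intro!: continuous_intros)
        have "(\<lambda>\<tau>. K (\<sigma>, \<tau>)) \<in> borel_measurable lebesgue"
          by (rule measurable_completion) (use cont\<sigma> in \<open>simp add: borel_measurable_continuous_onI\<close>)
        then have meas: "(\<lambda>\<tau>. K (\<sigma>, \<tau>) * bump t h \<tau>) \<in> borel_measurable lebesgue"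
          by (rule borel_measurable_times[OF _ borel_measurable_integrable[OF bump_facts(1)[OF h(1)]]])
        \<comment> \<open>\<open>induces\<close> speaks about the chosen representative of the class
          of the bump; integrability and the value of the integral are transferred to the bump
          itself.\<close>
        have AE: "AE \<tau> in lebesgue. K (\<sigma>, \<tau>) * rep_L2 u \<tau> = K (\<sigma>, \<tau>) * bump t h \<tau>"
          using u by eventually_elim simp
        have int: "integrable lebesgue (\<lambda>\<tau>. K (\<sigma>, \<tau>) * bump t h \<tau>)"
          by (rule integrable_cong_AE_imp[OF conjunct1[OF *] meas AE])
        have "rep_L2 (T u) \<sigma> = (\<integral>\<tau>. K (\<sigma>, \<tau>) * bump t h \<tau> \<partial>lebesgue)"
          by (rule trans[OF conjunct2[OF *]
              integral_cong_AE[OF borel_measurable_integrable[OF conjunct1[OF *]] meas AE]])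
        moreover have "cmod ((\<integral>\<tau>. K (\<sigma>, \<tau>) * bump t h \<tau> \<partial>lebesgue) - K (s, t)) \<le> e / 2"
          by (rule bump_average[OF h(1) int]) (use near \<sigma> in auto)
        ultimately show "cmod (rep_L2 (T u) \<sigma> - K (s, t)) \<le> e / 2" by simp
      qed
    qed
    then have "cmod ((\<integral>\<sigma>. rep_L2 (T u) \<sigma> * bump s h \<sigma> \<partial>lebesgue) - K (s, t)) \<le> e / 2"
      by (intro bump_average[OF h(1)] square_integrable_mult square_integrable_rep_L2 bump_facts(5)[OF h(1)])
    also have "(\<integral>\<sigma>. rep_L2 (T u) \<sigma> * bump s h \<sigma> \<partial>lebesgue) = cinner (T u) (abs_L2 (bump s h))"
      using cinner_abs_L2[OF square_integrable_rep_L2 bump_facts(5)[OF h(1)], of "T u" s]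
      by (simp add: abs_rep_L2 bump_def)
    finally show ?thesis using e by (simp add: u_def)
  qed
  then show "\<exists>N. \<forall>n\<ge>N. norm (cinner (T (abs_L2 (bump t (1 / real (Suc n)))))
      (abs_L2 (bump s (1 / real (Suc n)))) - K (s, t)) < e"
    by auto
qed

text \<open>The operator inequality tested with bumps, at t in the argument of H and at s in the
  second slot; hence A is taken at t and A' at s.\<close>

lemma kernel_Kato:
  assumes H: "induces KH H" "continuous_on UNIV KH"
    and A: "positive_op A" "induces KA A" "continuous_on UNIV KA"
    and A': "positive_op A'" "induces KA' A'" "continuous_on UNIV KA'"
    and le: "\<And>f. norm (H f) \<le> norm (A f)" and le': "\<And>g. norm (adjoint_op H g) \<le> norm (A' g)"
  shows "(cmod (KH (s, t)))\<^sup>2 \<le> Re (KA (t, t)) * Re (KA' (s, s))"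
proof -
  let ?b = "\<lambda>x n. abs_L2 (bump x (1 / real (Suc n)))"
  have "bounded_op H" using H(1) by (simp add: induces_def)
  have "(\<lambda>n. (cmod (cinner (H (?b t n)) (?b s n)))\<^sup>2) \<longlonglongrightarrow> (cmod (KH (s, t)))\<^sup>2"
    by (intro tendsto_power tendsto_norm induced_form_limit H)
  moreover have "(\<lambda>n. Re (cinner (A (?b t n)) (?b t n)) * Re (cinner (A' (?b s n)) (?b s n)))
      \<longlonglongrightarrow> Re (KA (t, t)) * Re (KA' (s, s))"
    by (intro tendsto_mult tendsto_Re induced_form_limit A A')
  ultimately show ?thesis
    by (rule LIMSEQ_le) (use cinner_Kato[OF \<open>bounded_op H\<close> A(1) A'(1) le le'] in blast)
qed

lemma kernel_diagonal_nonneg: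
  assumes "positive_op A" "induces KA A" "continuous_on UNIV KA"
  shows "0 \<le> Re (KA (t, t))"
proof -
  let ?b = "\<lambda>x n. abs_L2 (bump x (1 / real (Suc n)))"
  have "(\<lambda>n. Re (cinner (A (?b t n)) (?b t n))) \<longlonglongrightarrow> Re (KA (t, t))"
    by (intro tendsto_Re induced_form_limit assms)
  then show ?thesis
    by (rule LIMSEQ_le_const) (use positive_op_nonneg[OF assms(1)] in blast)
qed

section \<open>Determinants\<close>

text \<open>Entries are given by a function on all pairs of indices, so rows and columns can be
  permuted or updated without tracking matrix dimensions.\<close>

definition fdet :: "nat \<Rightarrow> (nat \<Rightarrow> nat \<Rightarrow> 'a::comm_ring_1) \<Rightarrow> 'a" where
  "fdet n f = Determinant.det (Matrix.mat n n (\<lambda>(i, j). f i j))"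

lemma fdet_leibniz: "fdet n f = (\<Sum>p | p permutes {0..<n}. signof p * (\<Prod>i = 0..<n. f i (p i)))"
proof -
  have "fdet n f = (\<Sum>p | p permutes {0..<n}. signof p *
      (\<Prod>i = 0..<n. Matrix.mat n n (\<lambda>(i, j). f i j) $$ (i, p i)))"
    unfolding fdet_def by (rule det_def') simp
  also have "\<dots> = (\<Sum>p | p permutes {0..<n}. signof p * (\<Prod>i = 0..<n. f i (p i)))"
  proof (intro sum.cong refl arg_cong2[where f = "(*)"] prod.cong)
    fix p i assume "p \<in> {p. p permutes {0..<n}}" "i \<in> {0..<n}"
    then have "p i < n" using permutes_in_image[of p "{0..<n}" i] by simp
    with \<open>i \<in> {0..<n}\<close> show "Matrix.mat n n (\<lambda>(i, j). f i j) $$ (i, p i) = f i (p i)" by simp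
  qed
  finally show ?thesis .
qed

lemma fdet_cong: "(\<And>i j. i < n \<Longrightarrow> j < n \<Longrightarrow> f i j = g i j) \<Longrightarrow> fdet n f = fdet n g"
  unfolding fdet_def by (intro arg_cong[where f = Determinant.det] eq_matI) auto

lemma fdet_transpose: "fdet n (\<lambda>i j. f j i) = fdet n f"
proof -
  have "transpose_mat (Matrix.mat n n (\<lambda>(i, j). f i j)) = Matrix.mat n n (\<lambda>(i, j). f j i)"
    by (intro eq_matI) auto
  with Determinant.det_transpose[OF mat_carrier[of n n "\<lambda>(i, j). f i j"]] show ?thesis by (simp add: fdet_def)
qed

lemma fdet_permute_rows:
  assumes "\<sigma> permutes {0..<n}"
  shows "fdet n (\<lambda>i j. f (\<sigma> i) j) = signof \<sigma> * fdet n f"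
proof -
  have "Matrix.mat n n (\<lambda>(i, j). Matrix.mat n n (\<lambda>(i, j). f i j) $$ (\<sigma> i, j)) =
      Matrix.mat n n (\<lambda>(i, j). f (\<sigma> i) j)"
    by (intro eq_matI) (use permutes_in_image[OF assms] in auto)
  with Determinant.det_permute_rows[OF mat_carrier[of n n "\<lambda>(i, j). f i j"] assms] show ?thesis
    by (simp add: fdet_def)
qed

lemma fdet_permute_cols:
  "\<sigma> permutes {0..<n} \<Longrightarrow> fdet n (\<lambda>i j. f i (\<sigma> j)) = signof \<sigma> * fdet n f"
  using fdet_permute_rows[of \<sigma> n "\<lambda>i j. f j i"] fdet_transpose[of n "\<lambda>i j. f i (\<sigma> j)"]
    fdet_transpose[of n f] by simp

lemma fdet_permute_both:
  assumes "\<sigma> permutes {0..<n}"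
  shows "fdet n (\<lambda>i j. f (\<sigma> i) (\<sigma> j)) = fdet n f"
proof -
  have "signof \<sigma> * (signof \<sigma> * fdet n f) = fdet n f"
    by (simp add: sign_def)
  then show ?thesis
    using fdet_permute_rows[OF assms, of "\<lambda>i j. f i (\<sigma> j)"] fdet_permute_cols[OF assms, of f] by simp
qed

lemma fdet_equal_rows:
  assumes "k \<noteq> l" "k < n" "l < n" "\<And>j. j < n \<Longrightarrow> f k j = f l j"
  shows "fdet n f = 0"
  unfolding fdet_def
proof (rule Determinant.det_identical_rows[OF mat_carrier \<open>k \<noteq> l\<close> \<open>k < n\<close> \<open>l < n\<close>])
  show "Matrix.row (Matrix.mat n n (\<lambda>(i, j). f i j)) k = Matrix.row (Matrix.mat n n (\<lambda>(i, j). f i j)) l"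
    using assms by (intro eq_vecI) auto
qed

lemma fdet_scale:
  "fdet n (\<lambda>i j. u i * f i j * v j) = prod u {0..<n} * prod v {0..<n} * fdet n f"
  unfolding fdet_leibniz sum_distrib_left
proof (rule sum.cong[OF refl])
  fix p assume "p \<in> {p. p permutes {0..<n}}"
  then have "(\<Prod>i = 0..<n. v (p i)) = prod v {0..<n}"
    using prod.permute[of p "{0..<n}" v] by (simp add: comp_def)
  then show "signof p * (\<Prod>i = 0..<n. u i * f i (p i) * v (p i)) =
      prod u {0..<n} * prod v {0..<n} * (signof p * (\<Prod>i = 0..<n. f i (p i)))"
    by (simp add: prod.distrib ac_simps)
qed

lemma fdet_first_row_unit:
  assumes "\<And>j. j < m \<Longrightarrow> f 0 (Suc j) = 0"
  shows "fdet (Suc m) f = f 0 0 * fdet m (\<lambda>i j. f (Suc i) (Suc j))"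
proof -
  let ?A = "Matrix.mat (Suc m) (Suc m) (\<lambda>(i, j). f i j)"
  have "fdet (Suc m) f = (\<Sum>j<Suc m. ?A $$ (0, j) * cofactor ?A 0 j)"
    unfolding fdet_def by (rule laplace_expansion_row) auto
  also have "\<dots> = f 0 0 * cofactor ?A 0 0"
    unfolding sum.lessThan_Suc_shift using assms by simp
  also have "cofactor ?A 0 0 = fdet m (\<lambda>i j. f (Suc i) (Suc j))"
    unfolding cofactor_def fdet_def mat_delete_def
    by (simp, intro arg_cong[where f = Determinant.det] eq_matI) auto
  finally show ?thesis .
qed

text \<open>Laplace expansion along row 0. In the k-th term column 0 takes the place of the removed
  column instead of standing in front; this costs a single transposition, so all these terms carry
  the same sign.\<close>

lemma fdet_bordered:
  "fdet (Suc m) f = f 0 0 * fdet m (\<lambda>i j. f (Suc i) (Suc j)) -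
    (\<Sum>k<m. f 0 (Suc k) * fdet m (\<lambda>i j. f (Suc i) (if j = k then 0 else Suc j)))"
proof -
  let ?A = "Matrix.mat (Suc m) (Suc m) (\<lambda>(i, j). f i j)"
  \<comment> \<open>Row 0 replaced by a unit vector: this turns a cofactor into a full determinant,
    whose columns can be permuted.\<close>
  let ?e = "\<lambda>k i j. if i = 0 then (if j = k then 1 else 0) else f i j"
  have cof: "cofactor ?A 0 k = fdet (Suc m) (?e k)" if k: "k < Suc m" for k
  proof -
    let ?B = "Matrix.mat (Suc m) (Suc m) (\<lambda>(i, j). ?e k i j)"
    have "fdet (Suc m) (?e k) = (\<Sum>j<Suc m. ?B $$ (0, j) * cofactor ?B 0 j)"
      unfolding fdet_def by (rule laplace_expansion_row) auto
    also have "\<dots> = (\<Sum>j<Suc m. if j = k then cofactor ?B 0 j else 0)"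
      by (rule sum.cong) auto
    also have "\<dots> = cofactor ?B 0 k" using k by simp
    also have "\<dots> = cofactor ?A 0 k"
    proof -
      have "mat_delete ?B 0 k = mat_delete ?A 0 k"
        unfolding mat_delete_def by (intro eq_matI) auto
      then show ?thesis by (simp add: cofactor_def)
    qed
    finally show ?thesis by simp
  qed
  have first: "fdet (Suc m) (?e 0) = fdet m (\<lambda>i j. f (Suc i) (Suc j))"
    by (subst fdet_first_row_unit) auto
  have later: "fdet (Suc m) (?e (Suc k)) = - fdet m (\<lambda>i j. f (Suc i) (if j = k then 0 else Suc j))"
    if k: "k < m" for k
  proof -
    let ?t = "Transposition.transpose 0 (Suc k)"
    have t: "?t permutes {0..<Suc m}" using k by (intro permutes_swap_id) auto
    have "signof ?t * fdet (Suc m) (?e (Suc k)) = fdet (Suc m) (\<lambda>i j. ?e (Suc k) i (?t j))"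
      by (rule fdet_permute_cols[OF t, symmetric])
    also have "\<dots> = fdet m (\<lambda>i j. f (Suc i) (?t (Suc j)))"
    proof (subst fdet_first_row_unit)
      show "?e (Suc k) 0 (?t (Suc j)) = 0" if "j < m" for j
        by (simp add: Transposition.transpose_def)
    qed simp
    also have "\<dots> = fdet m (\<lambda>i j. f (Suc i) (if j = k then 0 else Suc j))"
      by (rule fdet_cong) (simp add: Transposition.transpose_def)
    finally show ?thesis by (simp add: sign_swap_id minus_equation_iff)
  qed
  have "fdet (Suc m) f = (\<Sum>j<Suc m. ?A $$ (0, j) * cofactor ?A 0 j)"
    unfolding fdet_def by (rule laplace_expansion_row) auto
  also have "\<dots> = (\<Sum>j<Suc m. f 0 j * fdet (Suc m) (?e j))"
    by (intro sum.cong refl) (simp add: cof)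
  also have "\<dots> = f 0 0 * fdet m (\<lambda>i j. f (Suc i) (Suc j)) +
      (\<Sum>k<m. - (f 0 (Suc k) * fdet m (\<lambda>i j. f (Suc i) (if j = k then 0 else Suc j))))"
    unfolding sum.lessThan_Suc_shift first
    by (intro arg_cong2[where f = "(+)"] refl sum.cong) (simp only: later lessThan_iff mult_minus_right)
  finally show ?thesis by (simp add: sum_negf)
qed

lemma fdet_add_row:
  assumes "k < n" "l < n" "k \<noteq> l"
  shows "fdet n (f(k := \<lambda>j. f k j + a * f l j)) = fdet n f"
proof -
  have "Matrix.mat n n (\<lambda>(i, j). (f(k := \<lambda>j. f k j + a * f l j)) i j) =
      addrow a k l (Matrix.mat n n (\<lambda>(i, j). f i j))"
    using assms by (intro eq_matI) (auto simp: mat_addrow_def)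
  then have "fdet n (f(k := \<lambda>j. f k j + a * f l j)) =
      Determinant.det (addrow a k l (Matrix.mat n n (\<lambda>(i, j). f i j)))"
    unfolding fdet_def by (rule arg_cong)
  also have "\<dots> = fdet n f"
    unfolding fdet_def by (rule det_addrow[OF assms(2,3) mat_carrier])
  finally show ?thesis .
qed

lemma fdet_add_rows:
  assumes "k < n" "finite I" "I \<subseteq> {..<n} - {k}"
  shows "fdet n (f(k := \<lambda>j. f k j + (\<Sum>l\<in>I. a l * f l j))) = fdet n f"
  using assms(2,3)
proof (induction rule: finite_induct)
  case (insert l I)
  let ?g = "f(k := \<lambda>j. f k j + (\<Sum>l\<in>I. a l * f l j))"
  have "f(k := \<lambda>j. f k j + (\<Sum>l\<in>insert l I. a l * f l j)) = ?g(k := \<lambda>j. ?g k j + a l * ?g l j)"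
    using insert by (auto simp: fun_eq_iff algebra_simps)
  moreover have "l < n" "k \<noteq> l" using insert by auto
  ultimately show ?case
    using insert fdet_add_row[of k n l ?g "a l"] assms(1) by (simp del: fun_upd_apply)
qed simp

section \<open>Hadamard's inequality\<close>

lemma fdet_cnj: "cnj (fdet n f) = fdet n (\<lambda>i j. cnj (f i j))"
proof -
  have "cnj (signof p) = signof p" for p :: "nat \<Rightarrow> nat" by (simp add: sign_def)
  then show ?thesis by (simp add: fdet_leibniz)
qed

text \<open>The product of the matrix with its conjugate transpose is the Gram matrix of the rows,
  here diagonal, and its determinant is the squared modulus.\<close>

lemma Hadamard_orthogonal:
  assumes orth: "\<And>i l. i < n \<Longrightarrow> l < n \<Longrightarrow> i \<noteq> l \<Longrightarrow> (\<Sum>j<n. f i j * cnj (f l j)) = 0"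
  shows "(cmod (fdet n f))\<^sup>2 = (\<Prod>i<n. \<Sum>j<n. (cmod (f i j))\<^sup>2)"
proof -
  let ?F = "Matrix.mat n n (\<lambda>(i, j). f i j)" and ?G = "Matrix.mat n n (\<lambda>(i, j). cnj (f j i))"
  let ?P = "Matrix.mat n n (\<lambda>(i, l). \<Sum>j<n. f i j * cnj (f l j))"
  have FG: "?F * ?G = ?P"
    by (intro eq_matI) (auto simp: scalar_prod_def atLeast0LessThan)
  have "complex_of_real ((cmod (fdet n f))\<^sup>2) = fdet n f * cnj (fdet n f)"
    by (rule complex_norm_square)
  also have "cnj (fdet n f) = Determinant.det ?G"
    unfolding fdet_cnj by (subst fdet_transpose[symmetric]) (simp add: fdet_def)
  also have "fdet n f * Determinant.det ?G = Determinant.det (?F * ?G)"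
    unfolding fdet_def by (rule Determinant.det_mult[symmetric]) auto
  also have "\<dots> = prod_list (diag_mat ?P)"
    unfolding FG by (rule Determinant.det_upper_triangular[of _ n]) (auto simp: orth)
  also have "\<dots> = (\<Prod>i<n. \<Sum>j<n. f i j * cnj (f i j))"
    by (simp add: prod_list_diag_prod atLeast0LessThan)
  also have "\<dots> = (\<Prod>i<n. complex_of_real (\<Sum>j<n. (cmod (f i j))\<^sup>2))"
    by (simp only: complex_norm_square of_real_sum)
  finally show ?thesis by (simp only: of_real_prod[symmetric] of_real_eq_iff)
qed

text \<open>Gram-Schmidt, run as a downward induction on the number k of leading rows that are
  already orthogonal. Making row k orthogonal to its predecessors keeps the determinant and does not
  lengthen the row.\<close>

lemma Hadamard_rows: "(cmod (fdet n f))\<^sup>2 \<le> (\<Prod>i<n. \<Sum>j<n. (cmod (f i j))\<^sup>2)"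
proof -
  have "(cmod (fdet n f))\<^sup>2 \<le> (\<Prod>i<n. \<Sum>j<n. (cmod (f i j))\<^sup>2)"
    if "k \<le> n" and "\<And>i l. i < k \<Longrightarrow> l < k \<Longrightarrow> i \<noteq> l \<Longrightarrow> (\<Sum>j<n. f i j * cnj (f l j)) = 0" for k f
    using that
  proof (induction k arbitrary: f rule: inc_induct)
    case base
    then show ?case using Hadamard_orthogonal[of n f] by simp
  next
    case (step k)
    note orth = step.prems
    define ip where "ip u v = (\<Sum>j<n. u j * cnj (v j))" for u v :: "nat \<Rightarrow> complex"
    have ip_cnj: "cnj (ip u v) = ip v u" for u v
      by (simp add: ip_def mult.commute)
    have orth': "ip (f i) (f l) = 0" if "i < k" "l < k" "i \<noteq> l" for i l
      using orth[OF that] by (simp add: ip_def)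
    \<comment> \<open>Negated projection coefficients. For a zero row the quotient is 0 / 0 = 0, and
      \<open>new\<close> treats that case separately.\<close>
    define a where "a l = - ip (f k) (f l) / ip (f l) (f l)" for l
    define w where "w j = (\<Sum>l<k. a l * f l j)" for j
    define g where "g = f(k := \<lambda>j. f k j + w j)"
    have det: "fdet n g = fdet n f"
      unfolding g_def w_def using step.hyps by (intro fdet_add_rows) auto
    have ip_w: "ip w v = (\<Sum>l<k. a l * ip (f l) v)" for v
      unfolding ip_def w_def sum_distrib_right sum_distrib_left
      by (subst sum.swap) (simp add: mult.assoc)
    have new: "ip (g k) (f i) = 0" if i: "i < k" for i
    proof -
      have "ip (g k) (f i) = ip (f k) (f i) + ip w (f i)"
        by (simp add: g_def ip_def distrib_right sum.distrib)
      also have "ip w (f i) = (\<Sum>l<k. if l = i then a i * ip (f i) (f i) else 0)"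
        unfolding ip_w by (intro sum.cong refl) (use i orth' in auto)
      also have "\<dots> = a i * ip (f i) (f i)" using i by simp
      also have "ip (f k) (f i) + a i * ip (f i) (f i) = 0"
      proof (cases "ip (f i) (f i) = 0")
        case True
        have "complex_of_real (\<Sum>j<n. (cmod (f i j))\<^sup>2) = 0"
          using True by (simp only: ip_def of_real_sum complex_norm_square)
        then have "(\<Sum>j<n. (cmod (f i j))\<^sup>2) = 0" by (simp only: of_real_eq_0_iff)
        then have "\<forall>j\<in>{..<n}. (cmod (f i j))\<^sup>2 = 0" by (subst (asm) sum_nonneg_eq_0_iff) auto
        then have "f i j = 0" if "j < n" for j using that by simp
        then show ?thesis by (simp add: ip_def)
      qed (simp add: a_def)
      finally show ?thesis .
    qed
    have gi: "g i = f i" if "i \<noteq> k" for i using that by (simp add: g_def)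
    have orth_g: "(\<Sum>j<n. g i j * cnj (g l j)) = 0" if il: "i < Suc k" "l < Suc k" "i \<noteq> l" for i l
    proof -
      consider "i < k" "l < k" | "i = k" "l < k" | "i < k" "l = k"
        using il by (auto simp: less_Suc_eq)
      then have "ip (g i) (g l) = 0"
      proof cases
        case 1 then show ?thesis using orth' il gi by simp
      next
        case 2 then show ?thesis using new gi by simp
      next
        case 3
        then have "ip (g l) (g i) = 0" using new gi by simp
        then show ?thesis using ip_cnj[of "g l" "g i"] by simp
      qed
      then show ?thesis by (simp add: ip_def)
    qed
    have "(cmod (fdet n f))\<^sup>2 \<le> (\<Prod>i<n. \<Sum>j<n. (cmod (g i j))\<^sup>2)"
      using step.IH[of g] orth_g unfolding det by blast
    also have "\<dots> \<le> (\<Prod>i<n. \<Sum>j<n. (cmod (f i j))\<^sup>2)"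
    proof (rule prod_mono, intro conjI)
      fix i assume "i \<in> {..<n}"
      show "(\<Sum>j<n. (cmod (g i j))\<^sup>2) \<le> (\<Sum>j<n. (cmod (f i j))\<^sup>2)"
      proof (cases "i = k")
        case True
        \<comment> \<open>w combines earlier rows, to which the new row is orthogonal; since the old
          row is \<open>g k - w\<close>, Pythagoras gives the comparison of lengths.\<close>
        have "ip w (g k) = 0"
          unfolding ip_w by (intro sum.neutral) (use new ip_cnj in \<open>metis complex_cnj_zero lessThan_iff mult_zero_right\<close>)
        then have wg: "Re (\<Sum>j<n. w j * cnj (g k j)) = 0" by (simp add: ip_def)
        have "(cmod (f k j))\<^sup>2 = (cmod (g k j))\<^sup>2 - 2 * Re (w j * cnj (g k j)) + (cmod (w j))\<^sup>2" for j
          unfolding g_def cmod_power2 by (simp add: power2_eq_square algebra_simps)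
        then have "(\<Sum>j<n. (cmod (f k j))\<^sup>2) =
            (\<Sum>j<n. (cmod (g k j))\<^sup>2) - 2 * Re (\<Sum>j<n. w j * cnj (g k j)) + (\<Sum>j<n. (cmod (w j))\<^sup>2)"
          by (simp only: sum.distrib sum_subtractf sum_distrib_left Re_sum)
        with wg True show ?thesis by (simp add: sum_nonneg)
      qed (simp add: gi)
    qed (simp add: sum_nonneg)
    finally show ?case .
  qed
  from this[of 0] show ?thesis by simp
qed

lemma Hadamard_unit_entries:
  assumes "\<And>i j. i < n \<Longrightarrow> j < n \<Longrightarrow> cmod (f i j) \<le> 1"
  shows "cmod (fdet n f) \<le> sqrt (real n) ^ n"
proof -
  have "(cmod (fdet n f))\<^sup>2 \<le> (\<Prod>i<n. \<Sum>j<n. (cmod (f i j))\<^sup>2)" by (rule Hadamard_rows)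
  also have "\<dots> \<le> (\<Prod>i<n. real n)"
  proof (rule prod_mono, intro conjI)
    fix i assume i: "i \<in> {..<n}"
    have "(\<Sum>j<n. (cmod (f i j))\<^sup>2) \<le> (\<Sum>j<n. 1)"
      using assms i by (intro sum_mono power_le_one) auto
    then show "(\<Sum>j<n. (cmod (f i j))\<^sup>2) \<le> real n" by simp
  qed (simp add: sum_nonneg)
  also have "\<dots> = (sqrt (real n) ^ n)\<^sup>2"
    by (simp add: power_mult[symmetric] mult.commute[of n]) (simp add: power_mult)
  finally show ?thesis by (rule power2_le_imp_le) simp
qed

text \<open>Taking u i out of row i and v j out of column j leaves entries of modulus at most 1. The
  factors recombine as a product over single indices, which is what separates the integration
  variables later.\<close>

lemma Hadamard_product_bound:
  assumes "\<And>i j. i < n \<Longrightarrow> j < n \<Longrightarrow> cmod (f i j) \<le> u i * v j"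
    and "\<And>i. i < n \<Longrightarrow> 0 \<le> u i" "\<And>j. j < n \<Longrightarrow> 0 \<le> v j"
  shows "cmod (fdet n f) \<le> sqrt (real n) ^ n * (\<Prod>i<n. u i * v i)"
proof -
  \<comment> \<open>If \<open>u i * v j = 0\<close>, the bound forces \<open>f i j = 0\<close>, so
    the quotient 0 / 0 = 0 is consistent with \<open>fg\<close>.\<close>
  define g where "g i j = f i j / complex_of_real (u i * v j)" for i j
  have fg: "f i j = complex_of_real (u i) * g i j * complex_of_real (v j)" if "i < n" "j < n" for i j
    using assms(1)[OF that] by (cases "u i * v j = 0") (auto simp: g_def)
  have g: "cmod (g i j) \<le> 1" if "i < n" "j < n" for i j
  proof -
    have "0 \<le> u i * v j" using assms(2)[OF that(1)] assms(3)[OF that(2)] by simp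
    then show ?thesis using assms(1)[OF that] unfolding g_def norm_divide norm_of_real
      by (simp only: abs_of_nonneg divide_le_eq_1) auto
  qed
  have "fdet n f = fdet n (\<lambda>i j. complex_of_real (u i) * g i j * complex_of_real (v j))"
    by (rule fdet_cong) (rule fg)
  also have "\<dots> = (\<Prod>i<n. complex_of_real (u i * v i)) * fdet n g"
    unfolding fdet_scale by (simp add: prod.distrib atLeast0LessThan)
  finally have "cmod (fdet n f) = \<bar>\<Prod>i<n. u i * v i\<bar> * cmod (fdet n g)"
    by (simp only: of_real_prod[symmetric] norm_mult norm_of_real)
  also have "\<bar>\<Prod>i<n. u i * v i\<bar> = (\<Prod>i<n. u i * v i)"
    using assms by (intro abs_of_nonneg prod_nonneg) auto
  also have "(\<Prod>i<n. u i * v i) * cmod (fdet n g) \<le> (\<Prod>i<n. u i * v i) * sqrt (real n) ^ n"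
    using assms by (intro mult_left_mono Hadamard_unit_entries g prod_nonneg) auto
  finally show ?thesis by (simp only: mult.commute)
qed

lemma kernel_minor_fdet: "kernel_minor K n x y = fdet n (\<lambda>i j. K (x i, y j))"
  by (simp add: kernel_minor_def fdet_def)

section \<open>Fredholm series of a dominated kernel\<close>

lemma kernel_minor_cong:
  "(\<And>i. i < n \<Longrightarrow> x i = x' i) \<Longrightarrow> (\<And>i. i < n \<Longrightarrow> y i = y' i) \<Longrightarrow>
    kernel_minor K n x y = kernel_minor K n x' y'"
  unfolding kernel_minor_fdet by (rule fdet_cong) simp

lemma kernel_minor_permute:
  assumes "\<sigma> permutes {0..<n}"
  shows "kernel_minor K n (x \<circ> \<sigma>) (y \<circ> \<sigma>) = kernel_minor K n x y"
  unfolding kernel_minor_fdet using fdet_permute_both[OF assms, of "\<lambda>i j. K (x i, y j)"] by simp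

lemma kernel_minor_bordered:
  "kernel_minor K (Suc m) (case_nat s x) (case_nat t y) =
    K (s, t) * kernel_minor K m x y - (\<Sum>k<m. K (s, y k) * kernel_minor K m x (y(k := t)))"
proof -
  have "fdet m (\<lambda>i j. K (case_nat s x (Suc i), case_nat t y (if j = k then 0 else Suc j))) =
      fdet m (\<lambda>i j. K (x i, (y(k := t)) j))" for k
    by (rule fdet_cong) simp
  then show ?thesis
    unfolding kernel_minor_fdet fdet_bordered[of m] by simp
qed

text \<open>Moving the first row and column to the last place is a simultaneous permutation.\<close>

lemma kernel_minor_case_nat:
  "kernel_minor K (Suc N) (case_nat s x) (case_nat t y) =
    kernel_minor K (Suc N) (x(N := s)) (y(N := t))"
proof -
  define \<sigma> where "\<sigma> i = (if i = 0 then N else if i \<le> N then i - 1 else i)" for i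
  have "bij_betw \<sigma> {0..<Suc N} {0..<Suc N}"
    by (rule bij_betw_byWitness[where f' = "\<lambda>i. if i = N then 0 else Suc i"]) (auto simp: \<sigma>_def)
  then have "\<sigma> permutes {0..<Suc N}"
    by (rule bij_imp_permutes) (auto simp: \<sigma>_def)
  from kernel_minor_permute[OF this, of K "x(N := s)" "y(N := t)"] show ?thesis
    by (subst kernel_minor_cong[of _ "case_nat s x" "x(N := s) \<circ> \<sigma>" "case_nat t y" "y(N := t) \<circ> \<sigma>"])
      (auto simp: \<sigma>_def split: nat.split)
qed

lemma append_pt_case_nat: "append_pt (Suc p) (case_nat s x) \<xi> = case_nat s (append_pt p x \<xi>)"
  by (auto simp: append_pt_def fun_eq_iff split: nat.split)

lemma append_pt_upd_left: "j < p \<Longrightarrow> (append_pt p x \<xi>)(j := t) = append_pt p (x(j := t)) \<xi>"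
  by (auto simp: append_pt_def fun_eq_iff)

lemma append_pt_upd_right: "(append_pt p x \<xi>)(p + k := t) = append_pt p x (\<xi>(k := t))"
  by (auto simp: append_pt_def fun_eq_iff)

lemma sum_lessThan_add: "(\<Sum>k<p + n. g k) = (\<Sum>k<p. g k) + (\<Sum>k<(n::nat). (g (p + k) :: 'a::comm_monoid_add))"
  by (induction n) (simp_all add: ac_simps)

lemma prod_lessThan_add: "(\<Prod>k<p + n. g k) = (\<Prod>k<p. g k) * (\<Prod>k<(n::nat). (g (p + k) :: 'a::comm_monoid_mult))"
  by (induction n) (simp_all add: ac_simps)

section \<open>Symmetry of the product measure and Fubini in its last coordinate\<close>

interpretation lborel_product: product_sigma_finite "\<lambda>_::nat. lborel :: real measure"
  by standard

abbreviation leb :: "nat \<Rightarrow> (nat \<Rightarrow> real) measure" where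
  "leb n \<equiv> Pi\<^sub>M {..<n} (\<lambda>_. lborel)"

lemma space_leb: "space (leb n) = {..<n} \<rightarrow>\<^sub>E UNIV"
  by (simp add: space_PiM)

lemma leb_permute_measurable:
  assumes "\<sigma> permutes {..<n}"
  shows "(\<lambda>\<xi>. \<xi> \<circ> \<sigma>) \<in> leb n \<rightarrow>\<^sub>M leb n"
  unfolding comp_def
proof (rule measurable_PiM_single')
  show "(\<lambda>\<xi>. \<xi> (\<sigma> i)) \<in> leb n \<rightarrow>\<^sub>M lborel" if "i \<in> {..<n}" for i
    using permutes_in_image[OF assms, of i] that by (intro measurable_component_singleton) simp
  show "(\<lambda>\<xi> i. \<xi> (\<sigma> i)) \<in> space (leb n) \<rightarrow> (\<Pi>\<^sub>E i\<in>{..<n}. space lborel)"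
    using permutes_not_in[OF assms] by (auto simp: space_leb PiE_def extensional_def)
qed

text \<open>It suffices to compare both measures on boxes: the preimage of a box is the box with its
  sides permuted, and the product of the lengths is symmetric.\<close>

lemma leb_permute:
  assumes \<sigma>: "\<sigma> permutes {..<n}"
  shows "distr (leb n) (leb n) (\<lambda>\<xi>. \<xi> \<circ> \<sigma>) = leb n"
proof (rule lborel_product.PiM_eqI)
  fix A :: "nat \<Rightarrow> real set" assume A: "\<And>i. i \<in> {..<n} \<Longrightarrow> A i \<in> sets lborel"
  define \<tau> where "\<tau> = inv_into UNIV \<sigma>"
  note \<tau> = permutes_inv[OF \<sigma>, folded \<tau>_def] and inverses = permutes_inverses[OF \<sigma>, folded \<tau>_def]
  have inv: "\<tau> i \<in> {..<n}" if "i \<in> {..<n}" for i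
    using permutes_in_image[OF \<tau>, of i] that by simp
  have "(\<lambda>\<xi>. \<xi> \<circ> \<sigma>) -` (\<Pi>\<^sub>E i\<in>{..<n}. A i) \<inter> space (leb n) = (\<Pi>\<^sub>E i\<in>{..<n}. A (\<tau> i))"
  proof (rule Set.set_eqI, rule iffI)
    fix \<xi> assume *: "\<xi> \<in> (\<lambda>\<xi>. \<xi> \<circ> \<sigma>) -` (\<Pi>\<^sub>E i\<in>{..<n}. A i) \<inter> space (leb n)"
    have "\<xi> i \<in> A (\<tau> i)" if "i \<in> {..<n}" for i
    proof -
      have "(\<xi> \<circ> \<sigma>) (\<tau> i) \<in> A (\<tau> i)" using * inv[OF that] by (auto simp: PiE_def Pi_def)
      then show ?thesis using inverses(1) by simp
    qed
    with * show "\<xi> \<in> (\<Pi>\<^sub>E i\<in>{..<n}. A (\<tau> i))" by (auto simp: space_leb PiE_def)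
  next
    fix \<xi> assume *: "\<xi> \<in> (\<Pi>\<^sub>E i\<in>{..<n}. A (\<tau> i))"
    have "(\<xi> \<circ> \<sigma>) i \<in> A i" if "i \<in> {..<n}" for i
    proof -
      have "\<xi> (\<sigma> i) \<in> A (\<tau> (\<sigma> i))"
        using * permutes_in_image[OF \<sigma>, of i] that by (auto simp: PiE_def Pi_def)
      then show ?thesis using inverses(2) by simp
    qed
    moreover have "(\<xi> \<circ> \<sigma>) i = undefined" if "i \<notin> {..<n}" for i
      using * permutes_not_in[OF \<sigma> that] that by (auto simp: PiE_def extensional_def)
    ultimately show "\<xi> \<in> (\<lambda>\<xi>. \<xi> \<circ> \<sigma>) -` (\<Pi>\<^sub>E i\<in>{..<n}. A i) \<inter> space (leb n)"
      using * by (auto simp: space_leb PiE_def extensional_def)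
  qed
  then have "emeasure (distr (leb n) (leb n) (\<lambda>\<xi>. \<xi> \<circ> \<sigma>)) (\<Pi>\<^sub>E i\<in>{..<n}. A i) =
      emeasure (leb n) (\<Pi>\<^sub>E i\<in>{..<n}. A (\<tau> i))"
    using A by (subst emeasure_distr[OF leb_permute_measurable[OF \<sigma>]]) (auto intro!: sets_PiM_I_finite)
  also have "\<dots> = (\<Prod>i<n. emeasure lborel (A (\<tau> i)))"
    using A inv by (intro lborel_product.emeasure_PiM) auto
  also have "\<dots> = (\<Prod>i<n. emeasure lborel (A i))"
    using prod.permute[OF \<tau>, of "\<lambda>i. emeasure lborel (A i)"] by (simp add: comp_def)
  finally show "emeasure (distr (leb n) (leb n) (\<lambda>\<xi>. \<xi> \<circ> \<sigma>)) (\<Pi>\<^sub>E i\<in>{..<n}. A i) =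
      (\<Prod>i<n. emeasure lborel (A i))" .
qed simp_all

lemma integral_leb_permute:
  fixes f :: "(nat \<Rightarrow> real) \<Rightarrow> complex"
  assumes \<sigma>: "\<sigma> permutes {..<n}" and f: "f \<in> borel_measurable (leb n)"
  shows "(\<integral>\<xi>. f (\<xi> \<circ> \<sigma>) \<partial>leb n) = (\<integral>\<xi>. f \<xi> \<partial>leb n)"
  using integral_distr[OF leb_permute_measurable[OF \<sigma>] f] by (simp add: leb_permute[OF \<sigma>])

text \<open>Fubini with the last coordinate outermost. The inner integral is passed as g so that its
  measurability can be supplied by continuity of a Fredholm term.\<close>

lemma integral_leb_Suc:
  fixes f :: "(nat \<Rightarrow> real) \<Rightarrow> complex"
  assumes f: "integrable (leb (Suc m)) f" and g: "g \<in> borel_measurable lborel"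
    and fg: "\<And>\<eta>. (\<integral>\<xi>. f (\<xi>(m := \<eta>)) \<partial>leb m) = g \<eta>"
  shows "(\<integral>\<xi>. f \<xi> \<partial>leb (Suc m)) = (\<integral>\<eta>. g \<eta> \<partial>lborel)"
proof -
  have eq: "{..<Suc m} = {m} \<union> {..<m}" by auto
  have "(\<integral>\<xi>. f \<xi> \<partial>leb (Suc m)) =
      (\<integral>x. (\<integral>\<xi>. f (merge {m} {..<m} (x, \<xi>)) \<partial>leb m) \<partial>Pi\<^sub>M {m} (\<lambda>_. lborel))"
    unfolding eq by (rule lborel_product.product_integral_fold) (use f in \<open>auto simp: eq\<close>)
  also have "\<dots> = (\<integral>x. g (x m) \<partial>Pi\<^sub>M {m} (\<lambda>_. lborel))"
  proof (rule Bochner_Integration.integral_cong[OF refl])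
    fix x :: "nat \<Rightarrow> real"
    have "(\<integral>\<xi>. f (merge {m} {..<m} (x, \<xi>)) \<partial>leb m) = (\<integral>\<xi>. f (\<xi>(m := x m)) \<partial>leb m)"
    proof (rule Bochner_Integration.integral_cong[OF refl])
      fix \<xi> assume "\<xi> \<in> space (leb m)"
      then have "merge {m} {..<m} (x, \<xi>) = \<xi>(m := x m)"
        by (auto simp: merge_def fun_eq_iff space_leb PiE_def extensional_def)
      then show "f (merge {m} {..<m} (x, \<xi>)) = f (\<xi>(m := x m))" by simp
    qed
    then show "(\<integral>\<xi>. f (merge {m} {..<m} (x, \<xi>)) \<partial>leb m) = g (x m)" by (simp add: fg)
  qed
  also have "\<dots> = (\<integral>\<eta>. g \<eta> \<partial>lborel)"
    by (rule lborel_product.product_integral_singleton) (rule g)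
  finally show ?thesis .
qed

section \<open>Terms of the series and their algebra\<close>

abbreviation ext_minor ::
  "(real \<times> real \<Rightarrow> complex) \<Rightarrow> nat \<Rightarrow> nat \<Rightarrow> (nat \<Rightarrow> real) \<Rightarrow> (nat \<Rightarrow> real) \<Rightarrow> (nat \<Rightarrow> real) \<Rightarrow> (nat \<Rightarrow> real) \<Rightarrow> complex"
  where "ext_minor K p n x y \<xi> \<upsilon> \<equiv> kernel_minor K (p + n) (append_pt p x \<xi>) (append_pt p y \<upsilon>)"

text \<open>Counterpart of \<open>fredholm_term\<close> without the restriction to
  \<open>Rn2\<close>: it is total in both points and depends only on their first p coordinates, so
  coordinates can be updated or prepended freely.\<close>

definition Bterm :: "(real \<times> real \<Rightarrow> complex) \<Rightarrow> nat \<Rightarrow> nat \<Rightarrow> (nat \<Rightarrow> real) \<Rightarrow> (nat \<Rightarrow> real) \<Rightarrow> complex" where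
  "Bterm K n p x y =
    (\<integral>\<xi>. ext_minor K p n x y \<xi> \<xi> \<partial>leb n) / fact n"

definition Dsum :: "(real \<times> real \<Rightarrow> complex) \<Rightarrow> nat \<Rightarrow> (nat \<Rightarrow> real) \<Rightarrow> (nat \<Rightarrow> real) \<Rightarrow> complex" where
  "Dsum K p x y = (\<Sum>n. Bterm K n p x y)"

lemma Bterm_cong:
  assumes "\<And>i. i < p \<Longrightarrow> x i = x' i" "\<And>i. i < p \<Longrightarrow> y i = y' i"
  shows "Bterm K n p x y = Bterm K n p x' y'"
proof -
  have "ext_minor K p n x y \<xi> \<xi> =
      ext_minor K p n x' y' \<xi> \<xi>" for \<xi>
    by (rule kernel_minor_cong) (simp_all add: append_pt_def assms)
  then show ?thesis by (simp add: Bterm_def)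
qed

lemma Dsum_cong:
  "(\<And>i. i < p \<Longrightarrow> x i = x' i) \<Longrightarrow> (\<And>i. i < p \<Longrightarrow> y i = y' i) \<Longrightarrow> Dsum K p x y = Dsum K p x' y'"
  unfolding Dsum_def using Bterm_cong[of p x x' y y'] by simp

lemma Bterm_permute:
  assumes \<sigma>: "\<sigma> permutes {0..<p}"
  shows "Bterm K n p (x \<circ> \<sigma>) (y \<circ> \<sigma>) = Bterm K n p x y"
proof -
  have \<sigma>': "\<sigma> permutes {0..<p + n}" by (rule permutes_subset[OF \<sigma>]) auto
  have app: "append_pt p (x \<circ> \<sigma>) \<xi> = append_pt p x \<xi> \<circ> \<sigma>" for x and \<xi> :: "nat \<Rightarrow> real"
  proof
    fix i show "append_pt p (x \<circ> \<sigma>) \<xi> i = (append_pt p x \<xi> \<circ> \<sigma>) i"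
      using permutes_in_image[OF \<sigma>, of i] permutes_not_in[OF \<sigma>, of i]
      by (cases "i < p") (auto simp: append_pt_def)
  qed
  show ?thesis unfolding Bterm_def app kernel_minor_permute[OF \<sigma>'] ..
qed

lemma Bterm_equal_rows:
  assumes "i \<noteq> j" "i < p" "j < p" "x i = x j"
  shows "Bterm K n p x y = 0"
proof -
  have "ext_minor K p n x y \<xi> \<xi> = 0" for \<xi>
    unfolding kernel_minor_fdet
    by (rule fdet_equal_rows[of i j]) (use assms in \<open>auto simp: append_pt_def\<close>)
  then show ?thesis by (simp add: Bterm_def)
qed

text \<open>The kernel of the adjoint operator; it interchanges the rows and columns of every minor,
  up to conjugation.\<close>

definition dual_kernel :: "(real \<times> real \<Rightarrow> complex) \<Rightarrow> real \<times> real \<Rightarrow> complex" where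
  "dual_kernel K = (\<lambda>(t, s). cnj (K (s, t)))"

lemma dual_kernel_apply [simp]: "dual_kernel K (t, s) = cnj (K (s, t))"
  by (simp add: dual_kernel_def)

lemma kernel_minor_dual: "kernel_minor (dual_kernel K) n y x = cnj (kernel_minor K n x y)"
  unfolding kernel_minor_fdet fdet_cnj
  by (subst fdet_transpose[symmetric]) (simp add: fdet_cnj)

lemma Bterm_dual: "Bterm (dual_kernel K) n p y x = cnj (Bterm K n p x y)"
  by (simp add: Bterm_def kernel_minor_dual)

text \<open>The empty product measure is a unit point mass and the empty determinant is 1. This
  constant term is what contradicts the vanishing of all sums in
  \<open>Dsum_nonzero\<close>.\<close>

lemma Bterm_zero_zero: "Bterm K 0 0 x y = 1"
proof -
  have "(\<integral>\<xi>. 1 \<partial>leb 0) = (1 :: complex)"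
    unfolding lessThan_0 PiM_empty by (subst lebesgue_integral_count_space_finite) simp_all
  moreover have "kernel_minor K 0 u v = 1" for u v
    by (simp add: kernel_minor_def)
  ultimately show ?thesis by (simp add: Bterm_def)
qed

text \<open>Hadamard's inequality bounds the terms of the series by multiples of this sequence, where
  \<open>M\<close> is the integral of \<open>a b\<close>.\<close>

definition fredholm_coeff :: "real \<Rightarrow> nat \<Rightarrow> nat \<Rightarrow> real" where
  "fredholm_coeff M p n = sqrt (real (p + n)) ^ (p + n) * M ^ n / fact n"

text \<open>(1 + 1/k)^k is at most e, rounded up to 4 so that the square root is the constant
  2.\<close>

lemma sqrt_Suc_power_le: "sqrt (real (Suc k)) ^ k \<le> 2 * sqrt (real k) ^ k"
proof (cases "k = 0")
  case False
  have "(1 + 1 / real k) ^ k \<le> exp 1"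
    using exp_ge_one_plus_x_over_n_power_n[of k 1] False by simp
  also have "\<dots> \<le> 4" using exp_le by simp
  finally have 4: "(1 + 1 / real k) ^ k \<le> 4" .
  have "real (Suc k) = real k * (1 + 1 / real k)" using False by (simp add: field_simps)
  then have "sqrt (real (Suc k)) ^ k = sqrt (real k) ^ k * sqrt ((1 + 1 / real k) ^ k)"
    by (simp only: real_sqrt_mult power_mult_distrib real_sqrt_power)
  also have "\<dots> \<le> sqrt (real k) ^ k * sqrt 4"
    using 4 by (intro mult_left_mono real_sqrt_le_mono) auto
  finally show ?thesis by (simp add: mult.commute)
qed simp

text \<open>Consecutive terms have ratio at most C / sqrt (n + 1): the Hadamard factor grows by at
  most 2 sqrt (p + n + 1), which is at most 2 sqrt (p + 1) sqrt (n + 1), while the factorial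
  contributes 1 / (n + 1).\<close>

lemma summable_fredholm_coeff:
  assumes M: "0 \<le> M"
  shows "summable (fredholm_coeff M p)"
proof -
  define C where "C = 2 * M * sqrt (real (Suc p))"
  have C: "0 \<le> C" using M by (simp add: C_def)
  have nonneg: "0 \<le> fredholm_coeff M p n" for n using M by (simp add: fredholm_coeff_def)
  have step: "sqrt (real (Suc n)) * fredholm_coeff M p (Suc n) \<le> C * fredholm_coeff M p n" for n
  proof -
    let ?k = "p + n"
    have "sqrt (real (p + Suc n)) ^ (p + Suc n) = sqrt (real (Suc ?k)) * sqrt (real (Suc ?k)) ^ ?k"
      by simp
    also have "\<dots> \<le> (sqrt (real (Suc p)) * sqrt (real (Suc n))) * (2 * sqrt (real ?k) ^ ?k)"
    proof (intro mult_mono sqrt_Suc_power_le)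
      have "real (Suc ?k) \<le> real (Suc p) * real (Suc n)" by (simp add: algebra_simps)
      then show "sqrt (real (Suc ?k)) \<le> sqrt (real (Suc p)) * sqrt (real (Suc n))"
        unfolding real_sqrt_mult[symmetric] by (rule real_sqrt_le_mono)
    qed auto
    finally have "sqrt (real (Suc n)) * fredholm_coeff M p (Suc n) \<le>
        sqrt (real (Suc n)) * ((sqrt (real (Suc p)) * sqrt (real (Suc n))) * (2 * sqrt (real ?k) ^ ?k)
          * M ^ Suc n / fact (Suc n))"
      unfolding fredholm_coeff_def using M by (intro mult_left_mono divide_right_mono mult_right_mono) auto
    also have "\<dots> = C * fredholm_coeff M p n"
    proof -
      have "s * ((u * s) * (2 * Q) * (M * m) / (r * f)) = 2 * M * u * (Q * m / f)"
        if "s * s = r" "r \<noteq> 0" for s u Q m r f :: real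
      proof -
        have "s * ((u * s) * (2 * Q) * (M * m) / (r * f)) = (s * s / r) * (2 * M * u * (Q * m / f))"
          by simp
        then show ?thesis using that by simp
      qed
      from this[of "sqrt (real (Suc n))" "real (Suc n)" "sqrt (real (Suc p))" "sqrt (real ?k) ^ ?k" "M ^ n" "fact n"]
      show ?thesis
        unfolding C_def fredholm_coeff_def fact_Suc power_Suc of_nat_mult of_nat_fact by simp
    qed
    finally show ?thesis .
  qed
  \<comment> \<open>Beyond this N the ratio is at most 1/2.\<close>
  from real_arch_simple[of "(2 * C)\<^sup>2"] obtain N :: nat where N: "(2 * C)\<^sup>2 \<le> real N" ..
  show ?thesis
  proof (rule summable_ratio_test[of "1/2" N])
    fix n assume n: "N \<le> n"
    have "2 * C \<le> sqrt (real (Suc n))" using N n by (intro real_le_rsqrt) linarith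
    then have "2 * C * fredholm_coeff M p (Suc n) \<le> sqrt (real (Suc n)) * fredholm_coeff M p (Suc n)"
      by (intro mult_right_mono nonneg)
    with step[of n] have *: "2 * C * fredholm_coeff M p (Suc n) \<le> C * fredholm_coeff M p n" by linarith
    have "fredholm_coeff M p (Suc n) \<le> fredholm_coeff M p n / 2"
    proof (cases "C = 0")
      case True
      then have "sqrt (real (Suc n)) * fredholm_coeff M p (Suc n) \<le> 0" using step[of n] by simp
      then have "fredholm_coeff M p (Suc n) \<le> 0" by (simp add: mult_le_0_iff)
      then show ?thesis using nonneg[of n] by linarith
    next
      case False
      then show ?thesis using * C by (simp add: field_simps)
    qed
    then show "norm (fredholm_coeff M p (Suc n)) \<le> 1 / 2 * norm (fredholm_coeff M p n)"
      using nonneg by simp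
  qed simp
qed

text \<open>The interface between operators and series. Square integrability makes the integrals
  over the line finite and the operator map into L2; vanishing at infinity places the sums in
  \<open>C0\<close>.\<close>

locale dominated_kernel =
  fixes K :: "real \<times> real \<Rightarrow> complex" and a b :: "real \<Rightarrow> real"
  assumes K_cont: "continuous_on UNIV K"
    and a_cont: "continuous_on UNIV a" and b_cont: "continuous_on UNIV b"
    and a_nonneg: "0 \<le> a s" and b_nonneg: "0 \<le> b s"
    and a_vanish: "(a \<longlongrightarrow> 0) at_infinity" and b_vanish: "(b \<longlongrightarrow> 0) at_infinity"
    and a_sq: "integrable lebesgue (\<lambda>s. (a s)\<^sup>2)" and b_sq: "integrable lebesgue (\<lambda>s. (b s)\<^sup>2)"
    and K_bound: "cmod (K (s, t)) \<le> a s * b t"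
begin

lemma dual: "dominated_kernel (dual_kernel K) b a"
proof
  have "continuous_on UNIV (\<lambda>z. cnj (K (snd z, fst z)))"
    by (intro continuous_on_cnj continuous_on_compose2[OF K_cont]) (auto intro!: continuous_intros)
  then show "continuous_on UNIV (dual_kernel K)" by (simp add: dual_kernel_def case_prod_beta')
  show "cmod (dual_kernel K (s, t)) \<le> b s * a t" for s t
    using K_bound[of t s] by (simp add: mult.commute)
qed (fact a_cont b_cont a_nonneg b_nonneg a_vanish b_vanish a_sq b_sq)+

lemma a_measurable [measurable]: "a \<in> borel_measurable borel"
  and b_measurable [measurable]: "b \<in> borel_measurable borel"
  and K_measurable [measurable]: "K \<in> borel_measurable borel"
  using a_cont b_cont K_cont by (auto intro: borel_measurable_continuous_onI)

lemma integrable_ab: "integrable lborel (\<lambda>s. a s * b s)"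
proof -
  have "integrable lborel (\<lambda>s. (a s)\<^sup>2 + (b s)\<^sup>2)"
    using a_sq b_sq by (simp add: integrable_completion)
  then show ?thesis
  proof (rule Bochner_Integration.integrable_bound)
    show "AE s in lborel. norm (a s * b s) \<le> norm ((a s)\<^sup>2 + (b s)\<^sup>2)"
    proof (rule AE_I2)
      fix s
      have "2 * (a s * b s) \<le> (a s)\<^sup>2 + (b s)\<^sup>2" using sum_squares_bound[of "a s" "b s"] by simp
      moreover have "0 \<le> a s * b s" using a_nonneg b_nonneg by simp
      ultimately show "norm (a s * b s) \<le> norm ((a s)\<^sup>2 + (b s)\<^sup>2)" by simp
    qed
  qed simp
qed

definition M :: real where "M = (\<integral>s. a s * b s \<partial>lborel)"

lemma M_nonneg: "0 \<le> M"
  unfolding M_def by (rule Bochner_Integration.integral_nonneg) (simp add: a_nonneg b_nonneg)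

definition bnd :: "nat \<Rightarrow> (nat \<Rightarrow> real) \<Rightarrow> (nat \<Rightarrow> real) \<Rightarrow> real" where
  "bnd p x y = (\<Prod>i<p. a (x i) * b (y i))"

lemma bnd_nonneg: "0 \<le> bnd p x y"
  unfolding bnd_def by (intro prod_nonneg) (simp add: a_nonneg b_nonneg)

lemma bnd_append: "bnd (p + n) (append_pt p x \<xi>) (append_pt p y \<xi>') = bnd p x y * bnd n \<xi> \<xi>'"
  unfolding bnd_def prod_lessThan_add by (simp add: append_pt_def)

lemma bnd_case_nat: "bnd (Suc p) (case_nat s x) (case_nat t y) = a s * b t * bnd p x y"
  unfolding bnd_def prod.lessThan_Suc_shift by simp

lemma minor_bound: "cmod (kernel_minor K n x y) \<le> sqrt (real n) ^ n * bnd n x y"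
  unfolding kernel_minor_fdet bnd_def
  by (rule Hadamard_product_bound) (simp_all add: K_bound a_nonneg b_nonneg)

lemma integrable_bnd: "integrable (leb n) (\<lambda>\<xi>. bnd n \<xi> \<xi>)"
  and integral_bnd: "(\<integral>\<xi>. bnd n \<xi> \<xi> \<partial>leb n) = M ^ n"
  unfolding bnd_def
  using lborel_product.product_integrable_prod[of "{..<n}" "\<lambda>_ s. a s * b s"]
    lborel_product.product_integral_prod[of "{..<n}" "\<lambda>_ s. a s * b s"] integrable_ab
  by (simp_all add: M_def)

lemma minor_measurable:
  assumes "\<And>i. i < n \<Longrightarrow> (\<lambda>\<xi>. X \<xi> i) \<in> borel_measurable N" "\<And>i. i < n \<Longrightarrow> (\<lambda>\<xi>. Y \<xi> i) \<in> borel_measurable N"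
  shows "(\<lambda>\<xi>. kernel_minor K n (X \<xi>) (Y \<xi>)) \<in> borel_measurable N"
  unfolding kernel_minor_fdet fdet_leibniz
proof (intro borel_measurable_sum borel_measurable_times borel_measurable_prod borel_measurable_const)
  fix p i assume "p \<in> {p. p permutes {0..<n}}" "i \<in> {0..<n}"
  then have "i < n" "p i < n" using permutes_in_image[of p "{0..<n}" i] by auto
  with assms have "(\<lambda>\<xi>. (X \<xi> i, Y \<xi> (p i))) \<in> borel_measurable N" by simp
  then show "(\<lambda>\<xi>. K (X \<xi> i, Y \<xi> (p i))) \<in> borel_measurable N"
    by (rule measurable_compose[OF _ K_measurable])
qed

lemma append_measurable:
  assumes "\<And>i. i < n \<Longrightarrow> (\<lambda>\<xi>. Z \<xi> i) \<in> borel_measurable N" "i < p + n"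
  shows "(\<lambda>\<xi>. append_pt p x (Z \<xi>) i) \<in> borel_measurable N"
  using assms by (cases "i < p") (simp_all add: append_pt_def)

lemma coord_measurable: "i < n \<Longrightarrow> (\<lambda>\<xi>. \<xi> i) \<in> borel_measurable (leb n)"
  using measurable_component_singleton[of i "{..<n}" "\<lambda>_. lborel"] by simp

lemma upd_measurable: "i < n \<Longrightarrow> (\<lambda>\<xi>. (\<xi>(k := t)) i) \<in> borel_measurable (leb n)"
  using coord_measurable by (cases "i = k") simp_all

lemma minor_append_measurable:
  "(\<lambda>\<xi>. ext_minor K p n x y \<xi> \<xi>) \<in> borel_measurable (leb n)"
  by (intro minor_measurable append_measurable coord_measurable)

lemma minor_append_bound:
  "cmod (ext_minor K p n x y \<xi> \<xi>) \<le>
    sqrt (real (p + n)) ^ (p + n) * bnd p x y * bnd n \<xi> \<xi>"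
  using minor_bound[of "p + n" "append_pt p x \<xi>" "append_pt p y \<xi>"] by (simp only: bnd_append mult.assoc)

lemma integrable_minor:
  "integrable (leb n) (\<lambda>\<xi>. ext_minor K p n x y \<xi> \<xi>)"
proof (rule Bochner_Integration.integrable_bound)
  show "integrable (leb n) (\<lambda>\<xi>. sqrt (real (p + n)) ^ (p + n) * bnd p x y * bnd n \<xi> \<xi>)"
    using integrable_bnd by simp
  show "AE \<xi> in leb n. norm (ext_minor K p n x y \<xi> \<xi>)
      \<le> norm (sqrt (real (p + n)) ^ (p + n) * bnd p x y * bnd n \<xi> \<xi>)"
    unfolding real_norm_def by (intro AE_I2 order_trans[OF minor_append_bound] abs_ge_self)
qed (rule minor_append_measurable)

lemma Bterm_bound: "cmod (Bterm K n p x y) \<le> fredholm_coeff M p n * bnd p x y"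
proof -
  have "cmod (\<integral>\<xi>. ext_minor K p n x y \<xi> \<xi> \<partial>leb n) \<le>
      (\<integral>\<xi>. sqrt (real (p + n)) ^ (p + n) * bnd p x y * bnd n \<xi> \<xi> \<partial>leb n)"
    by (rule order_trans[OF integral_norm_bound integral_mono[OF integrable_norm[OF integrable_minor]]])
      (simp add: integrable_bnd, rule minor_append_bound)
  also have "\<dots> = sqrt (real (p + n)) ^ (p + n) * bnd p x y * M ^ n"
    by (simp add: integral_bnd)
  finally show ?thesis
    unfolding Bterm_def fredholm_coeff_def norm_divide by (simp add: field_simps)
qed

lemma fredholm_coeff_nonneg: "0 \<le> fredholm_coeff M p n"
  using M_nonneg by (simp add: fredholm_coeff_def)

lemma summable_norm_Bterm: "summable (\<lambda>n. cmod (Bterm K n p x y))"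
  by (rule summable_comparison_test[of _ "\<lambda>n. fredholm_coeff M p n * bnd p x y"])
    (use Bterm_bound in \<open>auto intro!: summable_mult2 summable_fredholm_coeff M_nonneg\<close>)

lemma Bterm_sums: "(\<lambda>n. Bterm K n p x y) sums Dsum K p x y"
  unfolding Dsum_def by (rule summable_sums[OF summable_norm_cancel[OF summable_norm_Bterm]])

definition C :: "nat \<Rightarrow> real" where "C p = (\<Sum>n. fredholm_coeff M p n)"

lemma C_nonneg: "0 \<le> C p"
  unfolding C_def by (intro suminf_nonneg summable_fredholm_coeff M_nonneg fredholm_coeff_nonneg)

lemma Dsum_bound: "cmod (Dsum K p x y) \<le> C p * bnd p x y"
proof -
  have "cmod (Dsum K p x y) \<le> (\<Sum>n. cmod (Bterm K n p x y))"
    unfolding Dsum_def by (rule summable_norm[OF summable_norm_Bterm])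
  also have "\<dots> \<le> (\<Sum>n. fredholm_coeff M p n * bnd p x y)"
    by (intro suminf_le Bterm_bound summable_norm_Bterm summable_mult2 summable_fredholm_coeff M_nonneg)
  also have "\<dots> = C p * bnd p x y"
    unfolding C_def by (intro suminf_mult2[symmetric] summable_fredholm_coeff M_nonneg)
  finally show ?thesis .
qed

lemma ab_bounded: "\<exists>c. 1 \<le> c \<and> (\<forall>s. a s \<le> c) \<and> (\<forall>s. b s \<le> c)"
proof -
  have bdd: "\<exists>c. \<forall>s. f s \<le> c"
    if cont: "continuous_on UNIV f" and van: "(f \<longlongrightarrow> 0) at_infinity" for f :: "real \<Rightarrow> real"
  proof -
    obtain r where r: "\<And>s. r \<le> norm s \<Longrightarrow> norm (f s) < 1"
      using tendstoD[OF van, of 1] unfolding eventually_at_infinity by auto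
    have "compact (f ` {-r..r})"
      by (intro compact_continuous_image continuous_on_subset[OF cont]) auto
    then have "bounded (f ` {-r..r})" by (rule compact_imp_bounded)
    then obtain c where "\<forall>x\<in>f ` {-r..r}. norm x \<le> c" unfolding bounded_iff ..
    then have c: "norm (f s) \<le> c" if "s \<in> {-r..r}" for s using that by (rule bspec[OF _ imageI])
    have "f s \<le> max c 1" for s
    proof (cases "s \<in> {-r..r}")
      case True
      then show ?thesis using c[OF True] by simp
    next
      case False
      then have "r \<le> norm s" by auto
      then show ?thesis using r[of s] by simp
    qed
    then show ?thesis by (intro exI allI)
  qed
  from bdd[OF a_cont a_vanish] obtain c where "\<forall>s. a s \<le> c" ..
  moreover from bdd[OF b_cont b_vanish] obtain d where "\<forall>s. b s \<le> d" ..
  ultimately have "1 \<le> max 1 (max c d) \<and> (\<forall>s. a s \<le> max 1 (max c d)) \<and> (\<forall>s. b s \<le> max 1 (max c d))"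
    by (auto simp: le_max_iff_disj)
  then show ?thesis ..
qed

lemma bnd_le: assumes "1 \<le> c" "\<And>s. a s \<le> c" "\<And>s. b s \<le> c" shows "bnd p x y \<le> (c * c) ^ p"
proof -
  have "bnd p x y \<le> (\<Prod>i<p. c * c)"
    unfolding bnd_def using assms by (intro prod_mono conjI mult_mono) (auto simp: a_nonneg b_nonneg)
  then show ?thesis by simp
qed

lemma minor_tendsto:
  assumes "\<And>i. i < n \<Longrightarrow> (\<lambda>k. X k i) \<longlonglongrightarrow> x i" "\<And>i. i < n \<Longrightarrow> (\<lambda>k. Y k i) \<longlonglongrightarrow> y i"
  shows "(\<lambda>k. kernel_minor K n (X k) (Y k)) \<longlonglongrightarrow> kernel_minor K n x y"
  unfolding kernel_minor_fdet fdet_leibniz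
proof (intro tendsto_sum tendsto_mult tendsto_prod tendsto_const)
  fix p i assume "p \<in> {p. p permutes {0..<n}}" "i \<in> {0..<n}"
  then have "i < n" "p i < n" using permutes_in_image[of p "{0..<n}" i] by auto
  with assms have "(\<lambda>k. (X k i, Y k (p i))) \<longlonglongrightarrow> (x i, y (p i))" by (intro tendsto_Pair) auto
  then show "(\<lambda>k. K (X k i, Y k (p i))) \<longlonglongrightarrow> K (x i, y (p i))"
    by (rule continuous_on_tendsto_compose[OF K_cont]) simp_all
qed

text \<open>Dominated convergence; replacing \<open>bnd p\<close> by the constant (c * c)^p makes
  the majorant independent of k.\<close>

lemma Bterm_tendsto:
  assumes "\<And>i. i < p \<Longrightarrow> (\<lambda>k. X k i) \<longlonglongrightarrow> x i" "\<And>i. i < p \<Longrightarrow> (\<lambda>k. Y k i) \<longlonglongrightarrow> y i"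
  shows "(\<lambda>k. Bterm K n p (X k) (Y k)) \<longlonglongrightarrow> Bterm K n p x y"
proof -
  obtain c where c: "1 \<le> c" "\<And>s. a s \<le> c" "\<And>s. b s \<le> c" using ab_bounded by blast
  have "(\<lambda>k. \<integral>\<xi>. ext_minor K p n (X k) (Y k) \<xi> \<xi> \<partial>leb n)
      \<longlonglongrightarrow> (\<integral>\<xi>. ext_minor K p n x y \<xi> \<xi> \<partial>leb n)"
  proof (rule integral_dominated_convergence)
    show "integrable (leb n) (\<lambda>\<xi>. sqrt (real (p + n)) ^ (p + n) * (c * c) ^ p * bnd n \<xi> \<xi>)"
      using integrable_bnd by simp
    show "AE \<xi> in leb n. (\<lambda>k. ext_minor K p n (X k) (Y k) \<xi> \<xi>)
        \<longlonglongrightarrow> ext_minor K p n x y \<xi> \<xi>"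
      by (intro AE_I2 minor_tendsto) (simp_all add: append_pt_def assms)
    show "AE \<xi> in leb n. norm (ext_minor K p n (X k) (Y k) \<xi> \<xi>)
        \<le> sqrt (real (p + n)) ^ (p + n) * (c * c) ^ p * bnd n \<xi> \<xi>" for k
    proof (rule AE_I2)
      fix \<xi>
      have "norm (ext_minor K p n (X k) (Y k) \<xi> \<xi>) \<le>
          sqrt (real (p + n)) ^ (p + n) * (bnd p (X k) (Y k) * bnd n \<xi> \<xi>)"
        using minor_append_bound by (simp only: mult.assoc)
      also have "\<dots> \<le> sqrt (real (p + n)) ^ (p + n) * ((c * c) ^ p * bnd n \<xi> \<xi>)"
        by (intro mult_left_mono mult_right_mono bnd_le c bnd_nonneg) auto
      finally show "norm (ext_minor K p n (X k) (Y k) \<xi> \<xi>)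
        \<le> sqrt (real (p + n)) ^ (p + n) * (c * c) ^ p * bnd n \<xi> \<xi>" by (simp only: mult.assoc)
    qed
  qed (rule minor_append_measurable)+
  then show ?thesis unfolding Bterm_def by (intro tendsto_divide tendsto_const) auto
qed

lemma Dsum_uniform_limit:
  "uniform_limit UNIV (\<lambda>N z. \<Sum>n<N. Bterm K n p (fst z) (snd z)) (\<lambda>z. Dsum K p (fst z) (snd z)) sequentially"
proof -
  obtain c where c: "1 \<le> c" "\<And>s. a s \<le> c" "\<And>s. b s \<le> c" using ab_bounded by blast
  have "cmod (Bterm K n p x y) \<le> fredholm_coeff M p n * (c * c) ^ p" for n x y
    by (rule order_trans[OF Bterm_bound]) (intro mult_left_mono bnd_le c fredholm_coeff_nonneg)
  then show ?thesis
    unfolding Dsum_def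
    by (intro Weierstrass_m_test[where M = "\<lambda>n. fredholm_coeff M p n * (c * c) ^ p"])
      (auto intro!: summable_mult2 summable_fredholm_coeff M_nonneg)
qed

lemma continuous_on_Bterm: "continuous_on UNIV (\<lambda>z. Bterm K n p (fst z) (snd z))"
proof -
  have "continuous (at z) (\<lambda>z. Bterm K n p (fst z) (snd z))" for z
  \<comment> \<open>Sequences suffice because the product topology on
    \<open>nat \<Rightarrow> real\<close> is first countable; this makes dominated convergence
    applicable.\<close>
  proof (rule continuous_within_sequentiallyI)
    fix u :: "nat \<Rightarrow> (nat \<Rightarrow> real) \<times> (nat \<Rightarrow> real)" assume u: "u \<longlonglongrightarrow> z"
    have coord: "isCont (\<lambda>x :: nat \<Rightarrow> real. x i) x" for i x
      using continuous_on_eq_continuous_at[OF open_UNIV, THEN iffD1, OF continuous_on_product_coordinates]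
      by blast
    show "(\<lambda>k. Bterm K n p (fst (u k)) (snd (u k))) \<longlonglongrightarrow> Bterm K n p (fst z) (snd z)"
      by (rule Bterm_tendsto)
        (rule isCont_tendsto_compose[OF coord tendsto_fst[OF u]] isCont_tendsto_compose[OF coord tendsto_snd[OF u]])+
  qed
  then show ?thesis by (simp add: continuous_on_eq_continuous_at)
qed

lemma continuous_on_Dsum: "continuous_on UNIV (\<lambda>z. Dsum K p (fst z) (snd z))"
  by (rule uniform_limit_theorem[OF _ Dsum_uniform_limit])
    (auto intro!: always_eventually continuous_on_sum continuous_on_Bterm)

lemma continuous_on_Dsum_compose:
  assumes "\<And>i. continuous_on S (\<lambda>s. X s i)" "\<And>i. continuous_on S (\<lambda>s. Y s i)"
  shows "continuous_on S (\<lambda>s. Dsum K p (X s) (Y s))" "continuous_on S (\<lambda>s. Bterm K n p (X s) (Y s))"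
proof -
  have "continuous_on S (\<lambda>s. (X s, Y s))"
    using assms by (intro continuous_on_Pair) (auto simp: continuous_on_coordinatewise_then_product)
  from continuous_on_compose2[OF continuous_on_Dsum this] continuous_on_compose2[OF continuous_on_Bterm this]
  show "continuous_on S (\<lambda>s. Dsum K p (X s) (Y s))" "continuous_on S (\<lambda>s. Bterm K n p (X s) (Y s))"
    by simp_all
qed

end

lemma real_binomial_le_two_power: "real (m choose q) \<le> 2 ^ m"
  using of_nat_mono[OF binomial_le_pow2[of m q], where 'a = real] by simp

text \<open>The moments are the Taylor coefficients at 1 of the power series with coefficients c;
  summing them with signs (-1)^q evaluates it at 0. Binomial rows sum to 2^m, so the hypothesis
  makes the double series absolutely convergent and the order of summation can be exchanged: summing
  over m gives the moments, summing over q gives 0 unless m = 0.\<close>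

lemma binomial_moments_eq_0:
  fixes c :: "nat \<Rightarrow> complex"
  assumes c: "summable (\<lambda>m. 2 ^ m * cmod (c m))"
    and moments: "\<And>q. (\<Sum>m. of_nat (m choose q) * c m) = 0"
  shows "c 0 = 0"
proof -
  define f where "f = (\<lambda>(m, q). (-1) ^ q * of_nat (m choose q) * c m)"
  \<comment> \<open>Each row has finite support. The function g stands for the norm in the absolute
    estimate and for the identity in the evaluation.\<close>
  have row: "infsum (\<lambda>q. g (f (m, q))) UNIV = (\<Sum>q\<le>m. g (f (m, q)))" "(\<lambda>q. g (f (m, q))) summable_on UNIV"
    if "g 0 = (0 :: 'x :: real_normed_vector)" for g m
  proof -
    have z: "g (f (m, q)) = 0" if "q \<notin> {..m}" for q
      using that \<open>g 0 = 0\<close> by (simp add: f_def binomial_eq_0)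
    have "infsum (\<lambda>q. g (f (m, q))) UNIV = infsum (\<lambda>q. g (f (m, q))) {..m}"
      by (rule infsum_cong_neutral) (use z in auto)
    then show "infsum (\<lambda>q. g (f (m, q))) UNIV = (\<Sum>q\<le>m. g (f (m, q)))" by simp
    have "(\<lambda>q. g (f (m, q))) summable_on {..m} \<longleftrightarrow> (\<lambda>q. g (f (m, q))) summable_on UNIV"
      by (rule summable_on_cong_neutral) (use z in auto)
    then show "(\<lambda>q. g (f (m, q))) summable_on UNIV" by simp
  qed
  have row_norm: "infsum (\<lambda>q. norm (f (m, q))) UNIV = 2 ^ m * cmod (c m)" for m
  proof -
    have "(\<Sum>q\<le>m. norm (f (m, q))) = (\<Sum>q\<le>m. real (m choose q)) * cmod (c m)"
      by (simp add: f_def norm_mult norm_power sum_distrib_right)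
    also have "(\<Sum>q\<le>m. real (m choose q)) = 2 ^ m"
      by (simp add: choose_row_sum flip: of_nat_sum)
    finally show ?thesis using row(1)[of norm m] by simp
  qed
  have "(\<lambda>z. norm (f z)) summable_on UNIV \<times> UNIV"
    unfolding Infinite_Sum.abs_summable_on_Sigma_iff row_norm
  proof (intro conjI ballI)
    show "(\<lambda>q. norm (f (m, q))) summable_on UNIV" for m
      by (rule row(2)) simp
    have "summable (\<lambda>m. norm (norm (2 ^ m * cmod (c m))))"
      using c by (simp add: norm_mult)
    then show "(\<lambda>m. norm (2 ^ m * cmod (c m))) summable_on UNIV"
      by (rule norm_summable_imp_summable_on)
  qed
  then have summable: "f summable_on UNIV \<times> UNIV" by (rule Infinite_Sum.abs_summable_summable)
  have "infsum (\<lambda>q. f (m, q)) UNIV = (if m = 0 then c 0 else 0)" for m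
  proof -
    have "infsum (\<lambda>q. f (m, q)) UNIV = (\<Sum>q\<le>m. (-1) ^ q * of_nat (m choose q)) * c m"
      using row(1)[of "\<lambda>z. z" m] by (simp add: f_def sum_distrib_right)
    then show ?thesis by (simp add: choose_alternating_sum)
  qed
  then have "infsum (\<lambda>m. infsum (\<lambda>q. f (m, q)) UNIV) UNIV = infsum (\<lambda>m::nat. if m = 0 then c 0 else 0) UNIV"
    by (simp only:)
  also have "\<dots> = infsum (\<lambda>m. if m = 0 then c 0 else 0) {0 :: nat}"
    by (rule infsum_cong_neutral) auto
  also have "\<dots> = c 0" by simp
  finally have total: "infsum (\<lambda>m. infsum (\<lambda>q. f (m, q)) UNIV) UNIV = c 0" .
  have "infsum (\<lambda>m. f (m, q)) UNIV = 0" for q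
  proof -
    have S: "summable (\<lambda>m. norm (of_nat (m choose q) * c m))"
    proof (rule summable_comparison_test[OF _ c], intro exI allI impI)
      fix m
      show "norm (norm (of_nat (m choose q) * c m)) \<le> 2 ^ m * cmod (c m)"
        using real_binomial_le_two_power[of m q] by (simp add: norm_mult mult_right_mono)
    qed
    have "((\<lambda>m. of_nat (m choose q) * c m) has_sum (\<Sum>m. of_nat (m choose q) * c m)) UNIV"
      by (rule norm_summable_imp_has_sum[OF S summable_sums[OF summable_norm_cancel[OF S]]])
    then have "((\<lambda>m. (-1) ^ q * (of_nat (m choose q) * c m)) has_sum ((-1) ^ q * 0)) UNIV"
      unfolding moments by (rule has_sum_cmult_right)
    then show ?thesis by (intro infsumI) (simp only: f_def mult.assoc prod.case mult_zero_right)
  qed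
  then have "infsum (\<lambda>q. infsum (\<lambda>m. f (m, q)) UNIV) UNIV = 0" by (simp only: infsum_0)
  moreover have "infsum (\<lambda>m. infsum (\<lambda>q. f (m, q)) UNIV) UNIV = infsum (\<lambda>q. infsum (\<lambda>m. f (m, q)) UNIV) UNIV"
    by (rule infsum_swap_banach) (use summable in \<open>simp only: case_prod_eta\<close>)
  ultimately show ?thesis using total by (simp only:)
qed

text \<open>The majorant separates the index from the variable, which is the form in which
  Hadamard's bound arrives.\<close>

lemma sums_integral_dominated:
  fixes F :: "nat \<Rightarrow> 'b \<Rightarrow> complex"
  assumes meas: "\<And>m. F m \<in> borel_measurable N" and w: "integrable N w"
    and c: "summable c" and le: "\<And>m \<eta>. cmod (F m \<eta>) \<le> c m * w \<eta>"
  shows "(\<lambda>m. \<integral>\<eta>. F m \<eta> \<partial>N) sums (\<integral>\<eta>. (\<Sum>m. F m \<eta>) \<partial>N)"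
proof (rule sums_integral)
  have cw: "integrable N (\<lambda>\<eta>. c m * w \<eta>)" for m using w by simp
  show int: "integrable N (F m)" for m
    by (rule Bochner_Integration.integrable_bound[OF cw[of m] meas])
      (intro AE_I2, rule order_trans[OF le], simp)
  show "AE \<eta> in N. summable (\<lambda>m. norm (F m \<eta>))"
    by (intro AE_I2 summable_comparison_test[OF _ summable_mult2[OF c]]) (use le in auto)
  show "summable (\<lambda>m. \<integral>\<eta>. norm (F m \<eta>) \<partial>N)"
  proof (rule summable_comparison_test[OF _ summable_mult2[OF c]], intro exI allI impI)
    fix m
    have "(\<integral>\<eta>. norm (F m \<eta>) \<partial>N) \<le> (\<integral>\<eta>. c m * w \<eta> \<partial>N)"
      by (intro integral_mono integrable_norm int cw le)
    then show "norm (\<integral>\<eta>. norm (F m \<eta>) \<partial>N) \<le> c m * (\<integral>\<eta>. w \<eta> \<partial>N)" by simp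
  qed
qed

text \<open>Coordinates from p on are pinned at \<open>undefined\<close>, so the box is a full
  product of intervals and singletons, compact by Tychonoff.\<close>

lemma compact_box_Rn: "compact (({..<p} \<rightarrow>\<^sub>E {-r..r}) :: (nat \<Rightarrow> real) set)"
proof -
  have "(({..<p} \<rightarrow>\<^sub>E {-r..r}) :: (nat \<Rightarrow> real) set) =
      (\<Pi>\<^sub>E i\<in>UNIV. if i < p then {-r..r} else {undefined})"
    by (auto simp: PiE_def Pi_def extensional_def split: if_splits)
  then have "compactin (product_topology (\<lambda>i. euclidean) UNIV) (({..<p} \<rightarrow>\<^sub>E {-r..r}) :: (nat \<Rightarrow> real) set)"
    by (simp add: compactin_PiE)
  then show ?thesis by (simp add: euclidean_product_topology)
qed

section \<open>Sums in \<open>C0\<close>, integral identities between consecutive orders, and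
  nonvanishing\<close>

context dominated_kernel
begin

text \<open>Outside a large box some coordinate of x or y is large, which makes one factor of
  \<open>bnd p x y\<close> small while the others stay bounded.\<close>

lemma Dsum_in_C0: "(\<lambda>z\<in>Rn2 p. Dsum K p (fst z) (snd z)) \<in> C0 (Rn2 p)"
proof -
  obtain c where c: "1 \<le> c" "\<And>s. a s \<le> c" "\<And>s. b s \<le> c" using ab_bounded by blast
  have "\<exists>Q. compact Q \<and> Q \<subseteq> Rn2 p \<and> (\<forall>z\<in>Rn2 p - Q. cmod (Dsum K p (fst z) (snd z)) < \<epsilon>)"
    if \<epsilon>: "0 < \<epsilon>" for \<epsilon>
  proof -
    \<comment> \<open>The constant in front of e in the estimate below, plus 1 to make it positive
      and the last inequality strict.\<close>
    define W where "W = C p * (c * c) ^ p * c + 1"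
    have W: "0 < W" unfolding W_def using C_nonneg[of p] c(1) by (intro add_nonneg_pos) auto
    define e where "e = \<epsilon> / W"
    have e: "0 < e" using \<epsilon> W by (simp add: e_def)
    obtain ra where ra: "\<And>s. ra \<le> norm s \<Longrightarrow> norm (a s) < e"
      using tendstoD[OF a_vanish e] unfolding eventually_at_infinity by auto
    obtain rb where rb: "\<And>s. rb \<le> norm s \<Longrightarrow> norm (b s) < e"
      using tendstoD[OF b_vanish e] unfolding eventually_at_infinity by auto
    define r where "r = max ra rb"
    let ?Q = "({..<p} \<rightarrow>\<^sub>E {-r..r}) \<times> ({..<p} \<rightarrow>\<^sub>E {-r..r})"
    have factor: "a s * b t \<le> e * c" if "s \<notin> {-r..r} \<or> t \<notin> {-r..r}" for s t
    proof -
      have "r < \<bar>s\<bar> \<or> r < \<bar>t\<bar>" using that by auto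
      then have "ra \<le> norm s \<or> rb \<le> norm t" by (auto simp: r_def)
      then have "a s \<le> e \<or> b t \<le> e" using ra[of s] rb[of t] by auto
      then show ?thesis
      proof
        assume "a s \<le> e"
        then show ?thesis using c(3)[of t] e by (intro mult_mono) (auto simp: b_nonneg)
      next
        assume "b t \<le> e"
        then have "a s * b t \<le> c * e" using c(2)[of s] c(1) by (intro mult_mono) (auto simp: b_nonneg)
        then show ?thesis by (simp add: mult.commute)
      qed
    qed
    have "cmod (Dsum K p x y) < \<epsilon>" if xy: "(x, y) \<in> Rn2 p - ?Q" for x y
    proof -
      obtain i where i: "i < p" "x i \<notin> {-r..r} \<or> y i \<notin> {-r..r}"
        using xy by (auto simp: Rn_def PiE_def Pi_def)
      have "bnd p x y = a (x i) * b (y i) * (\<Prod>j\<in>{..<p} - {i}. a (x j) * b (y j))"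
        unfolding bnd_def using i(1) by (intro prod.remove) auto
      also have "\<dots> \<le> (e * c) * (\<Prod>j\<in>{..<p} - {i}. c * c)"
        using c e by (intro mult_mono prod_mono conjI factor[OF i(2)] prod_nonneg)
          (auto simp: a_nonneg b_nonneg)
      also have "(\<Prod>j\<in>{..<p} - {i}. c * c) = (c * c) ^ (p - 1)" using i(1) by simp
      \<comment> \<open>Raising the exponent, possible since 1 \<le> c, removes the natural number
        subtraction.\<close>
      also have "(e * c) * (c * c) ^ (p - 1) \<le> (e * c) * (c * c) ^ p"
        using c(1) e by (intro mult_left_mono power_increasing) (auto simp: mult_ge1_I)
      finally have "C p * bnd p x y \<le> C p * ((e * c) * (c * c) ^ p)"
        by (rule mult_left_mono[OF _ C_nonneg])
      also have "\<dots> = e * (C p * (c * c) ^ p * c)" by (simp add: ac_simps)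
      also have "\<dots> < e * W" unfolding W_def using e by (intro mult_strict_left_mono) auto
      also have "\<dots> = \<epsilon>" using W by (simp add: e_def)
      finally show ?thesis using Dsum_bound[of p x y] by linarith
    qed
    then have "cmod (Dsum K p (fst z) (snd z)) < \<epsilon>" if "z \<in> Rn2 p - ?Q" for z
      using that by (simp only: prod.collapse)
    then show ?thesis
      unfolding Rn_def
      by (intro exI[of _ ?Q] conjI ballI compact_Times compact_box_Rn Sigma_mono PiE_mono subset_UNIV)
  qed
  note vanish = this
  show ?thesis
    unfolding C0_def mem_Collect_eq
  proof (intro conjI allI impI)
    show "continuous_on (Rn2 p) (\<lambda>z\<in>Rn2 p. Dsum K p (fst z) (snd z))"
      by (rule continuous_on_eq[OF continuous_on_subset[OF continuous_on_Dsum subset_UNIV]])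
        (simp only: restrict_apply if_True)
    fix \<epsilon> :: real assume "0 < \<epsilon>"
    from vanish[OF this] obtain Q where Q: "compact Q" "Q \<subseteq> Rn2 p"
        "\<forall>z\<in>Rn2 p - Q. cmod (Dsum K p (fst z) (snd z)) < \<epsilon>"
      by (elim exE conjE)
    show "\<exists>Q. compact Q \<and> Q \<subseteq> Rn2 p \<and>
      (\<forall>z\<in>Rn2 p - Q. cmod ((\<lambda>z\<in>Rn2 p. Dsum K p (fst z) (snd z)) z) < \<epsilon>)"
    proof (intro exI conjI ballI)
      fix z assume z: "z \<in> Rn2 p - Q"
      show "cmod ((\<lambda>z\<in>Rn2 p. Dsum K p (fst z) (snd z)) z) < \<epsilon>"
        using bspec[OF Q(3) z] DiffD1[OF z] by (simp only: restrict_apply')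
    qed (rule Q)+
  qed (rule restrict_extensional)
qed

lemma fredholm_term_eq: "z \<in> Rn2 p \<Longrightarrow> fredholm_term n p K z = Bterm K n p (fst z) (snd z)"
  by (simp add: fredholm_term_def Bterm_def)

text \<open>The definite description is resolved by uniqueness of limits together with the
  extensionality built into \<open>C0\<close>.\<close>

lemma fredholm_sum_eq: "fredholm_sum p K = (\<lambda>z\<in>Rn2 p. Dsum K p (fst z) (snd z))"
proof -
  have lim: "uniform_limit (Rn2 p) (\<lambda>N z. \<Sum>n<N. fredholm_term n p K z)
      (\<lambda>z\<in>Rn2 p. Dsum K p (fst z) (snd z)) sequentially"
    using uniform_limit_on_subset[OF Dsum_uniform_limit, of "Rn2 p" p]
    by (rule uniform_limit_cong'[THEN iffD1, rotated -1]) (auto simp: fredholm_term_eq)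
  show ?thesis
    unfolding fredholm_sum_def
  proof (rule the_equality)
    fix F assume F: "F \<in> C0 (Rn2 p) \<and>
      uniform_limit (Rn2 p) (\<lambda>N z. \<Sum>n<N. fredholm_term n p K z) F sequentially"
    show "F = (\<lambda>z\<in>Rn2 p. Dsum K p (fst z) (snd z))"
    proof (rule extensionalityI[of _ "Rn2 p"])
      show "F \<in> extensional (Rn2 p)" using F by (simp add: C0_def)
      fix z assume z: "z \<in> Rn2 p"
      show "F z = (\<lambda>z\<in>Rn2 p. Dsum K p (fst z) (snd z)) z"
        using tendsto_uniform_limitI[OF conjunct2[OF F] z] tendsto_uniform_limitI[OF lim z]
        by (rule LIMSEQ_unique)
    qed simp
  qed (use lim Dsum_in_C0 in blast)
qed

text \<open>When t replaces the k-th column variable, the bound loses \<open>b (y k)\<close>. The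
  kernel entry of the expansion supplies exactly this factor, so the expanded terms remain dominated
  by an integrable product.\<close>

lemma bnd_upd:
  assumes "k < n"
  shows "b (y k) * bnd n x (y(k := t)) = b t * bnd n x y"
proof -
  have "(\<Prod>i\<in>{..<n} - {k}. a (x i) * b ((y(k := t)) i)) = (\<Prod>i\<in>{..<n} - {k}. a (x i) * b (y i))"
    by (rule prod.cong) auto
  moreover have "bnd n x y' = a (x k) * b (y' k) * (\<Prod>i\<in>{..<n} - {k}. a (x i) * b (y' i))" for y'
    unfolding bnd_def using assms by (intro prod.remove) auto
  ultimately show ?thesis by simp
qed

lemma case_nat_continuous:
  "continuous_on UNIV (\<lambda>\<eta> :: real. (case_nat \<eta> x :: nat \<Rightarrow> real) i)"
  "continuous_on UNIV (\<lambda>\<eta> :: real. (case_nat s x :: nat \<Rightarrow> real) i)"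
  by (cases i; simp add: continuous_on_id)+

lemma continuous_on_case_nat:
  "continuous_on UNIV (\<lambda>\<eta>. Dsum K p (case_nat \<eta> x) (case_nat t y))"
  "continuous_on UNIV (\<lambda>\<eta>. Bterm K n p (case_nat \<eta> x) (case_nat t y))"
  "continuous_on UNIV (\<lambda>\<eta>. Bterm K n p (case_nat \<eta> x) (case_nat \<eta> y))"
  by (intro continuous_on_Dsum_compose case_nat_continuous)+

lemma K_slice_continuous:
  "continuous_on UNIV (\<lambda>\<eta>. K (s, \<eta>))" "continuous_on UNIV (\<lambda>\<eta>. K (\<eta>, t))"
  by (auto intro!: continuous_on_compose2[OF K_cont] continuous_intros)

text \<open>The extra diagonal variable becomes one more integration variable; the factor n + 1 is
  the quotient of the two factorials.\<close>

lemma Bterm_trace: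
  "(\<integral>\<eta>. Bterm K n (Suc p) (case_nat \<eta> x) (case_nat \<eta> y) \<partial>lborel) = of_nat (Suc n) * Bterm K (Suc n) p x y"
proof -
  have "(\<integral>\<xi>. kernel_minor K (p + Suc n) (append_pt p x \<xi>) (append_pt p y \<xi>) \<partial>leb (Suc n)) =
      (\<integral>\<eta>. fact n * Bterm K n (Suc p) (case_nat \<eta> x) (case_nat \<eta> y) \<partial>lborel)"
  proof (rule integral_leb_Suc[OF integrable_minor])
    show "(\<lambda>\<eta>. fact n * Bterm K n (Suc p) (case_nat \<eta> x) (case_nat \<eta> y)) \<in> borel_measurable lborel"
      using borel_measurable_continuous_onI[OF continuous_on_case_nat(3)] by simp
    show "(\<integral>\<xi>. kernel_minor K (p + Suc n) (append_pt p x (\<xi>(n := \<eta>))) (append_pt p y (\<xi>(n := \<eta>))) \<partial>leb n) =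
        fact n * Bterm K n (Suc p) (case_nat \<eta> x) (case_nat \<eta> y)" for \<eta>
      by (simp add: Bterm_def append_pt_case_nat kernel_minor_case_nat append_pt_upd_right)
  qed
  also have "\<dots> = fact n * (\<integral>\<eta>. Bterm K n (Suc p) (case_nat \<eta> x) (case_nat \<eta> y) \<partial>lborel)"
    by (rule integral_mult_right_zero)
  finally have "Bterm K (Suc n) p x y =
      fact n * (\<integral>\<eta>. Bterm K n (Suc p) (case_nat \<eta> x) (case_nat \<eta> y) \<partial>lborel) / fact (Suc n)"
    by (simp only: Bterm_def[of K "Suc n"])
  then show ?thesis by (simp add: fact_Suc del: of_nat_Suc)
qed

text \<open>Expand along the first row. The terms whose column is one of the integration variables all
  have the same integral by symmetry, and each of them reproduces the bordered determinant with one
  integration variable less.\<close>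

lemma Bterm_row:
  "Bterm K n (Suc p) (case_nat s x) (case_nat t y) =
    K (s, t) * Bterm K n p x y - (\<Sum>j<p. K (s, y j) * Bterm K n p x (y(j := t))) -
    (case n of 0 \<Rightarrow> 0 | Suc m \<Rightarrow>
      \<integral>\<eta>. K (s, \<eta>) * Bterm K m (Suc p) (case_nat \<eta> x) (case_nat t y) \<partial>lborel)"
proof -
  \<comment> \<open>The expansion term whose column is the k-th integration variable: there the
    column variable is replaced by t, while the row variable remains.\<close>
  define T where "T k \<xi> = K (s, \<xi> k) *
    ext_minor K p n x y \<xi> (\<xi>(k := t))" for k \<xi>
  have T_int: "integrable (leb n) (T k)" if k: "k < n" for k
  proof (rule Bochner_Integration.integrable_bound)
    show "integrable (leb n) (\<lambda>\<xi>. a s * b t * sqrt (real (p + n)) ^ (p + n) * bnd p x y * bnd n \<xi> \<xi>)"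
      using integrable_bnd by simp
    have "(\<lambda>\<xi>. K (s, \<xi> k)) \<in> borel_measurable (leb n)"
      using measurable_compose[OF coord_measurable[OF k] borel_measurable_continuous_onI[OF K_slice_continuous(1)]]
      by simp
    then show "T k \<in> borel_measurable (leb n)"
      unfolding T_def
      by (intro borel_measurable_times minor_measurable append_measurable coord_measurable upd_measurable)
    show "AE \<xi> in leb n. norm (T k \<xi>) \<le>
        norm (a s * b t * sqrt (real (p + n)) ^ (p + n) * bnd p x y * bnd n \<xi> \<xi>)"
    proof (rule AE_I2)
      fix \<xi>
      have "norm (T k \<xi>) \<le> (a s * b (\<xi> k)) * (sqrt (real (p + n)) ^ (p + n) * (bnd p x y * bnd n \<xi> (\<xi>(k := t))))"
        unfolding T_def norm_mult bnd_append[symmetric]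
        by (intro mult_mono K_bound minor_bound) (auto simp: a_nonneg b_nonneg)
      also have "\<dots> = a s * sqrt (real (p + n)) ^ (p + n) * bnd p x y * (b (\<xi> k) * bnd n \<xi> (\<xi>(k := t)))"
        by (simp only: ac_simps)
      also have "\<dots> = a s * b t * sqrt (real (p + n)) ^ (p + n) * bnd p x y * bnd n \<xi> \<xi>"
        unfolding bnd_upd[OF k] by (simp only: ac_simps)
      finally show "norm (T k \<xi>) \<le>
        norm (a s * b t * sqrt (real (p + n)) ^ (p + n) * bnd p x y * bnd n \<xi> \<xi>)" by simp
    qed
  qed
  \<comment> \<open>Exchanging integration variables k and m permutes rows and columns
    simultaneously, so no sign appears.\<close>
  have T_sym: "(\<integral>\<xi>. T k \<xi> \<partial>leb n) = (\<integral>\<xi>. T m \<xi> \<partial>leb n)" if k: "k < n" and m: "n = Suc m" for k m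
  proof -
    define \<sigma> \<sigma>' where "\<sigma> = Transposition.transpose k m" and "\<sigma>' = Transposition.transpose (p + k) (p + m)"
    have \<sigma>: "\<sigma> permutes {..<n}" unfolding \<sigma>_def using k m by (intro permutes_swap_id) auto
    have \<sigma>': "\<sigma>' permutes {0..<p + n}" unfolding \<sigma>'_def using k m by (intro permutes_swap_id) auto
    have "T k (\<xi> \<circ> \<sigma>) = T m \<xi>" for \<xi>
    proof -
      have "append_pt p x (\<xi> \<circ> \<sigma>) = append_pt p x \<xi> \<circ> \<sigma>'"
        by (auto simp: append_pt_def fun_eq_iff \<sigma>_def \<sigma>'_def Transposition.transpose_def)
      moreover have "append_pt p y ((\<xi> \<circ> \<sigma>)(k := t)) = append_pt p y (\<xi>(m := t)) \<circ> \<sigma>'"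
        by (auto simp: append_pt_def fun_eq_iff \<sigma>_def \<sigma>'_def Transposition.transpose_def)
      ultimately show ?thesis
        unfolding T_def by (simp only: kernel_minor_permute[OF \<sigma>']) (simp add: \<sigma>_def)
    qed
    then show ?thesis
      using integral_leb_permute[OF \<sigma> borel_measurable_integrable[OF T_int[OF k]]] by simp
  qed
  \<comment> \<open>In the last place the row variable is \<eta> and the column variable is t;
    moving this pair to the front gives a term of order p + 1 with one integration variable
    less.\<close>
  have T_last: "(\<integral>\<xi>. T m \<xi> \<partial>leb n) =
      fact m * (\<integral>\<eta>. K (s, \<eta>) * Bterm K m (Suc p) (case_nat \<eta> x) (case_nat t y) \<partial>lborel)"
    if m: "n = Suc m" for m
  proof -
    have "(\<integral>\<xi>. T m \<xi> \<partial>leb (Suc m)) =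
        (\<integral>\<eta>. fact m * (K (s, \<eta>) * Bterm K m (Suc p) (case_nat \<eta> x) (case_nat t y)) \<partial>lborel)"
    proof (rule integral_leb_Suc)
      show "integrable (leb (Suc m)) (T m)" using T_int[of m] m by simp
      show "(\<lambda>\<eta>. fact m * (K (s, \<eta>) * Bterm K m (Suc p) (case_nat \<eta> x) (case_nat t y)))
          \<in> borel_measurable lborel"
        using borel_measurable_continuous_onI[OF continuous_on_mult[OF K_slice_continuous(1)
            continuous_on_case_nat(2)]] by simp
      fix \<eta>
      have "T m (\<xi>(m := \<eta>)) = K (s, \<eta>) * kernel_minor K (Suc p + m)
          (append_pt (Suc p) (case_nat \<eta> x) \<xi>) (append_pt (Suc p) (case_nat t y) \<xi>)" for \<xi>
        unfolding T_def m append_pt_case_nat by (simp add: kernel_minor_case_nat append_pt_upd_right)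
      then show "(\<integral>\<xi>. T m (\<xi>(m := \<eta>)) \<partial>leb m) =
          fact m * (K (s, \<eta>) * Bterm K m (Suc p) (case_nat \<eta> x) (case_nat t y))"
        by (simp add: Bterm_def)
    qed
    then show ?thesis using m by simp
  qed
  have expand: "kernel_minor K (Suc p + n) (append_pt (Suc p) (case_nat s x) \<xi>) (append_pt (Suc p) (case_nat t y) \<xi>) =
      K (s, t) * ext_minor K p n x y \<xi> \<xi> -
      ((\<Sum>j<p. K (s, y j) * ext_minor K p n x (y(j := t)) \<xi> \<xi>) +
       (\<Sum>k<n. T k \<xi>))" for \<xi>
  proof -
    have "(\<Sum>j<p. K (s, append_pt p y \<xi> j) * kernel_minor K (p + n) (append_pt p x \<xi>) ((append_pt p y \<xi>)(j := t))) =
        (\<Sum>j<p. K (s, y j) * ext_minor K p n x (y(j := t)) \<xi> \<xi>)"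
      by (intro sum.cong refl) (simp add: append_pt_upd_left, simp add: append_pt_def)
    moreover have "(\<Sum>k<n. K (s, append_pt p y \<xi> (p + k)) * kernel_minor K (p + n) (append_pt p x \<xi>)
          ((append_pt p y \<xi>)(p + k := t))) = (\<Sum>k<n. T k \<xi>)"
      unfolding T_def append_pt_upd_right by (simp add: append_pt_def)
    ultimately show ?thesis
      unfolding append_pt_case_nat add_Suc kernel_minor_bordered sum_lessThan_add by simp
  qed
  have "fact n * Bterm K n (Suc p) (case_nat s x) (case_nat t y) =
      K (s, t) * (fact n * Bterm K n p x y) -
      ((\<Sum>j<p. K (s, y j) * (fact n * Bterm K n p x (y(j := t)))) + (\<Sum>k<n. \<integral>\<xi>. T k \<xi> \<partial>leb n))"
  proof -
    have i1: "integrable (leb n) (\<lambda>\<xi>. K (s, t) * ext_minor K p n x y \<xi> \<xi>)"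
      by (intro integrable_mult_right integrable_minor)
    have i2: "integrable (leb n) (\<lambda>\<xi>. \<Sum>j<p. K (s, y j) *
        ext_minor K p n x (y(j := t)) \<xi> \<xi>)"
      by (intro Bochner_Integration.integrable_sum integrable_mult_right integrable_minor)
    have i3: "integrable (leb n) (\<lambda>\<xi>. \<Sum>k<n. T k \<xi>)"
      by (intro Bochner_Integration.integrable_sum T_int) simp
    have "fact n * Bterm K n (Suc p) (case_nat s x) (case_nat t y) =
      (\<integral>\<xi>. K (s, t) * ext_minor K p n x y \<xi> \<xi> -
      ((\<Sum>j<p. K (s, y j) * ext_minor K p n x (y(j := t)) \<xi> \<xi>) +
       (\<Sum>k<n. T k \<xi>)) \<partial>leb n)"
      unfolding Bterm_def expand by simp
    also have "\<dots> = (\<integral>\<xi>. K (s, t) * ext_minor K p n x y \<xi> \<xi> \<partial>leb n) -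
      ((\<integral>\<xi>. (\<Sum>j<p. K (s, y j) * ext_minor K p n x (y(j := t)) \<xi> \<xi>) \<partial>leb n) +
       (\<integral>\<xi>. (\<Sum>k<n. T k \<xi>) \<partial>leb n))"
      by (simp only: Bochner_Integration.integral_diff[OF i1 Bochner_Integration.integrable_add[OF i2 i3]]
          Bochner_Integration.integral_add[OF i2 i3])
    also have "(\<integral>\<xi>. K (s, t) * ext_minor K p n x y \<xi> \<xi> \<partial>leb n) =
        K (s, t) * (fact n * Bterm K n p x y)"
      by (simp add: Bterm_def)
    also have "(\<integral>\<xi>. (\<Sum>j<p. K (s, y j) * ext_minor K p n x (y(j := t)) \<xi> \<xi>) \<partial>leb n) =
        (\<Sum>j<p. K (s, y j) * (fact n * Bterm K n p x (y(j := t))))"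
      by (subst Bochner_Integration.integral_sum) (simp_all add: integrable_minor Bterm_def)
    also have "(\<integral>\<xi>. (\<Sum>k<n. T k \<xi>) \<partial>leb n) = (\<Sum>k<n. \<integral>\<xi>. T k \<xi> \<partial>leb n)"
      by (rule Bochner_Integration.integral_sum) (simp add: T_int)
    finally show ?thesis .
  qed
  \<comment> \<open>There are n equal terms, each with factor (n - 1)!, which restores n!.\<close>
  moreover have "(\<Sum>k<n. \<integral>\<xi>. T k \<xi> \<partial>leb n) = fact n * (case n of 0 \<Rightarrow> 0 | Suc m \<Rightarrow>
      \<integral>\<eta>. K (s, \<eta>) * Bterm K m (Suc p) (case_nat \<eta> x) (case_nat t y) \<partial>lborel)"
  proof (cases n)
    case (Suc m)
    have "(\<Sum>k<n. \<integral>\<xi>. T k \<xi> \<partial>leb n) = (\<Sum>k<n. \<integral>\<xi>. T m \<xi> \<partial>leb n)"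
      by (intro sum.cong refl T_sym) (use Suc in auto)
    then show ?thesis unfolding T_last[OF Suc] using Suc by (simp add: fact_Suc del: of_nat_Suc)
  qed simp
  ultimately have "fact n * Bterm K n (Suc p) (case_nat s x) (case_nat t y) = fact n *
     (K (s, t) * Bterm K n p x y - (\<Sum>j<p. K (s, y j) * Bterm K n p x (y(j := t))) -
    (case n of 0 \<Rightarrow> 0 | Suc m \<Rightarrow>
      \<integral>\<eta>. K (s, \<eta>) * Bterm K m (Suc p) (case_nat \<eta> x) (case_nat t y) \<partial>lborel))"
    by (simp add: algebra_simps sum_distrib_left)
  then show ?thesis by (simp only: mult_cancel_left fact_nonzero) simp
qed

text \<open>Sum \<open>Bterm_row\<close> over n. The integral belongs to index n - 1, so its series
  is shifted by one, and domination allows summation under the integral. This identity yields both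
  the homogeneous solutions and the resolvent equation.\<close>

lemma Dsum_row:
  "Dsum K (Suc p) (case_nat s x) (case_nat t y) +
    (\<integral>\<eta>. K (s, \<eta>) * Dsum K (Suc p) (case_nat \<eta> x) (case_nat t y) \<partial>lborel) =
    K (s, t) * Dsum K p x y - (\<Sum>j<p. K (s, y j) * Dsum K p x (y(j := t)))"
proof -
  define I where "I m = (\<integral>\<eta>. K (s, \<eta>) * Bterm K m (Suc p) (case_nat \<eta> x) (case_nat t y) \<partial>lborel)" for m
  have "I sums (\<integral>\<eta>. (\<Sum>m. K (s, \<eta>) * Bterm K m (Suc p) (case_nat \<eta> x) (case_nat t y)) \<partial>lborel)"
    unfolding I_def
  proof (rule sums_integral_dominated[where w = "\<lambda>\<eta>. a \<eta> * b \<eta>" and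
        c = "\<lambda>m. fredholm_coeff M (Suc p) m * (a s * b t * bnd p x y)"])
    show "(\<lambda>\<eta>. K (s, \<eta>) * Bterm K m (Suc p) (case_nat \<eta> x) (case_nat t y)) \<in> borel_measurable lborel" for m
      using borel_measurable_continuous_onI[OF continuous_on_mult[OF K_slice_continuous(1)
            continuous_on_case_nat(2)]] by simp
    show "summable (\<lambda>m. fredholm_coeff M (Suc p) m * (a s * b t * bnd p x y))"
      by (intro summable_mult2 summable_fredholm_coeff M_nonneg)
    fix m \<eta>
    have "cmod (K (s, \<eta>) * Bterm K m (Suc p) (case_nat \<eta> x) (case_nat t y)) \<le>
        (a s * b \<eta>) * (fredholm_coeff M (Suc p) m * (a \<eta> * b t * bnd p x y))"
      unfolding norm_mult bnd_case_nat[symmetric]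
      by (intro mult_mono K_bound Bterm_bound) (auto simp: a_nonneg b_nonneg)
    then show "cmod (K (s, \<eta>) * Bterm K m (Suc p) (case_nat \<eta> x) (case_nat t y)) \<le>
        fredholm_coeff M (Suc p) m * (a s * b t * bnd p x y) * (a \<eta> * b \<eta>)"
      by (simp only: ac_simps)
  qed (rule integrable_ab)
  moreover have "(\<Sum>m. K (s, \<eta>) * Bterm K m (Suc p) (case_nat \<eta> x) (case_nat t y)) =
      K (s, \<eta>) * Dsum K (Suc p) (case_nat \<eta> x) (case_nat t y)" for \<eta>
    by (rule sums_unique[symmetric, OF sums_mult[OF Bterm_sums]])
  ultimately have "I sums (\<integral>\<eta>. K (s, \<eta>) * Dsum K (Suc p) (case_nat \<eta> x) (case_nat t y) \<partial>lborel)"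
    by (simp only:)
  then have I: "(\<lambda>n. case n of 0 \<Rightarrow> 0 | Suc m \<Rightarrow> I m) sums
      (\<integral>\<eta>. K (s, \<eta>) * Dsum K (Suc p) (case_nat \<eta> x) (case_nat t y) \<partial>lborel)"
    using sums_Suc_imp[of "\<lambda>n. case n of 0 \<Rightarrow> 0 | Suc m \<Rightarrow> I m"] by (simp only: nat.case)
  have row: "Bterm K n (Suc p) (case_nat s x) (case_nat t y) = K (s, t) * Bterm K n p x y -
      (\<Sum>j<p. K (s, y j) * Bterm K n p x (y(j := t))) - (case n of 0 \<Rightarrow> 0 | Suc m \<Rightarrow> I m)" for n
    unfolding I_def by (rule Bterm_row)
  have "(\<lambda>n. Bterm K n (Suc p) (case_nat s x) (case_nat t y)) sums
      (K (s, t) * Dsum K p x y - (\<Sum>j<p. K (s, y j) * Dsum K p x (y(j := t))) -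
      (\<integral>\<eta>. K (s, \<eta>) * Dsum K (Suc p) (case_nat \<eta> x) (case_nat t y) \<partial>lborel))"
    unfolding row
    by (rule sums_diff[OF sums_diff[OF sums_mult[OF Bterm_sums] sums_sum[OF sums_mult[OF Bterm_sums]]] I])
  then have "Dsum K (Suc p) (case_nat s x) (case_nat t y) =
      (K (s, t) * Dsum K p x y - (\<Sum>j<p. K (s, y j) * Dsum K p x (y(j := t))) -
      (\<integral>\<eta>. K (s, \<eta>) * Dsum K (Suc p) (case_nat \<eta> x) (case_nat t y) \<partial>lborel))"
    by (rule sums_unique2[OF Bterm_sums])
  then show ?thesis by simp
qed

text \<open>If all the sums vanish, then by the trace formula so do all derivatives of the entire function
  \<open>z \<mapsto> \<Sum>n. z\<^sup>n B\<^sub>n\<^sup>0\<close> at \<open>1\<close>; but its value at \<open>0\<close> is \<open>1\<close>.\<close>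

lemma Dsum_nonzero: "\<exists>p x y. Dsum K p x y \<noteq> 0"
proof (rule ccontr)
  assume "\<not> ?thesis"
  then have zero: "Dsum K p x y = 0" for p x y by blast
  \<comment> \<open>The weight 2^m is absorbed by doubling M, so the summability already proved
    covers it.\<close>
  have coeff2: "2 ^ m * fredholm_coeff M p m = fredholm_coeff (2 * M) p m" for m p
    by (simp add: fredholm_coeff_def power_mult_distrib)
  have sum2: "summable (fredholm_coeff (2 * M) p)" for p
    by (rule summable_fredholm_coeff) (simp add: M_nonneg)
  have bound: "cmod (of_nat (m choose q) * Bterm K m p x y) \<le> fredholm_coeff (2 * M) p m * bnd p x y" for m q p x y
  proof -
    have "cmod (of_nat (m choose q) * Bterm K m p x y) \<le> 2 ^ m * (fredholm_coeff M p m * bnd p x y)"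
      unfolding norm_mult norm_of_nat by (intro mult_mono real_binomial_le_two_power Bterm_bound) auto
    then show ?thesis by (simp only: coeff2[symmetric] mult.assoc)
  qed
  have summ: "summable (\<lambda>m. of_nat (m choose q) * Bterm K m p x y)" for q p x y
    by (rule summable_comparison_test[OF _ summable_mult2[OF sum2]]) (use bound in blast)
  \<comment> \<open>The induction has to run over all orders and points at once: the q-th moment at
    order p + 1, integrated over the diagonal, is a multiple of the next moment at order p.\<close>
  have moments: "(\<Sum>m. of_nat (m choose q) * Bterm K m p x y) = 0" for q p x y
  proof (induction q arbitrary: p x y)
    case 0
    then show ?case using zero by (simp add: Dsum_def)
  next
    case (Suc q)
    have "(\<lambda>n. \<integral>\<eta>. of_nat (n choose q) * Bterm K n (Suc p) (case_nat \<eta> x) (case_nat \<eta> y) \<partial>lborel) sums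
        (\<integral>\<eta>. (\<Sum>n. of_nat (n choose q) * Bterm K n (Suc p) (case_nat \<eta> x) (case_nat \<eta> y)) \<partial>lborel)"
    proof (rule sums_integral_dominated[where w = "\<lambda>\<eta>. a \<eta> * b \<eta>" and
          c = "\<lambda>m. fredholm_coeff (2 * M) (Suc p) m * bnd p x y"])
      show "(\<lambda>\<eta>. of_nat (n choose q) * Bterm K n (Suc p) (case_nat \<eta> x) (case_nat \<eta> y)) \<in> borel_measurable lborel" for n
        using borel_measurable_continuous_onI[OF continuous_on_case_nat(3)] by simp
      show "cmod (of_nat (m choose q) * Bterm K m (Suc p) (case_nat \<eta> x) (case_nat \<eta> y)) \<le>
          fredholm_coeff (2 * M) (Suc p) m * bnd p x y * (a \<eta> * b \<eta>)" for m \<eta>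
        using bound[of m q "Suc p" "case_nat \<eta> x" "case_nat \<eta> y"] unfolding bnd_case_nat by (simp only: ac_simps)
    qed (intro summable_mult2 sum2 integrable_ab)+
    then have "(\<lambda>n. of_nat (n choose q) * (of_nat (Suc n) * Bterm K (Suc n) p x y)) sums 0"
      unfolding Suc.IH by (simp add: Bterm_trace del: of_nat_Suc)
    \<comment> \<open>Absorption: (n + 1) C(n, q) = (q + 1) C(n + 1, q + 1). The missing summand at
      index 0 is zero.\<close>
    also have "(\<lambda>n. of_nat (n choose q) * (of_nat (Suc n) * Bterm K (Suc n) p x y)) =
        (\<lambda>n. of_nat (Suc q) * (of_nat (Suc n choose Suc q) * Bterm K (Suc n) p x y))"
      by (simp only: mult.assoc[symmetric] of_nat_mult[symmetric] Suc_times_binomial mult.commute[of _ "Suc _"])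
    finally have "(\<lambda>n. of_nat (Suc q) * (of_nat (Suc n choose Suc q) * Bterm K (Suc n) p x y) / of_nat (Suc q))
        sums (0 / of_nat (Suc q))"
      by (rule sums_divide)
    then have "(\<lambda>n. of_nat (Suc n choose Suc q) * Bterm K (Suc n) p x y) sums 0"
      by (simp del: of_nat_Suc binomial_Suc_Suc)
    then have "(\<lambda>n. of_nat (n choose Suc q) * Bterm K n p x y) sums 0"
      by (rule sums_Suc_imp[rotated]) simp
    then show ?case by (rule sums_unique[symmetric])
  qed
  have "Bterm K 0 0 undefined undefined = 0"
  proof (rule binomial_moments_eq_0[OF _ moments])
    show "summable (\<lambda>m. 2 ^ m * cmod (Bterm K m 0 undefined undefined))"
    proof (rule summable_comparison_test[OF _ summable_mult2[OF sum2]], intro exI allI impI)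
      fix m
      have "2 ^ m * cmod (Bterm K m 0 undefined undefined) \<le> 2 ^ m * (fredholm_coeff M 0 m * bnd 0 undefined undefined)"
        by (intro mult_left_mono Bterm_bound) simp
      then show "norm (2 ^ m * cmod (Bterm K m 0 undefined undefined)) \<le>
          fredholm_coeff (2 * M) 0 m * bnd 0 undefined undefined"
        by (simp add: coeff2[symmetric] mult.assoc)
    qed
  qed
  then show False by (simp add: Bterm_zero_zero)
qed

end

section \<open>The Fredholm alternative\<close>

text \<open>Makes Fubini available for the completed measure, over which \<open>L2\<close> and the
  solution sets are defined.\<close>

interpretation lebesgue: sigma_finite_measure "lebesgue :: real measure"
proof
  obtain A :: "real set set" where A: "countable A" "A \<subseteq> sets lborel" "\<Union>A = space lborel"
      "\<forall>a\<in>A. emeasure lborel a \<noteq> \<infinity>"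
    using lborel.sigma_finite_countable by blast
  show "\<exists>A. countable A \<and> A \<subseteq> sets lebesgue \<and> \<Union>A = space (lebesgue :: real measure) \<and>
      (\<forall>a\<in>A. emeasure lebesgue a \<noteq> \<infinity>)"
    by (rule exI[of _ A]) (use A in auto)
qed

interpretation lebesgue_pair: pair_sigma_finite "lebesgue :: real measure" "lebesgue :: real measure" ..

lemma continuous_lebesgue_measurable:
  "continuous_on UNIV f \<Longrightarrow> f \<in> borel_measurable (lebesgue :: real measure)" for f :: "real \<Rightarrow> complex"
  using borel_measurable_continuous_onI[of f] by (simp add: measurable_completion)

lemma integral_lborel_lebesgue:
  "continuous_on UNIV f \<Longrightarrow> (\<integral>x. f x \<partial>lborel) = (\<integral>x. f x \<partial>lebesgue)" for f :: "real \<Rightarrow> complex"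
  using borel_measurable_continuous_onI[of f] by (simp add: integral_completion)

text \<open>The set where f does not vanish is open and null, hence empty. This is what allows point
  evaluation in the proof of linear independence.\<close>

lemma continuous_AE_zero:
  fixes f :: "real \<Rightarrow> complex"
  assumes f: "continuous_on UNIV f" and AE: "AE x in lebesgue. f x = 0"
  shows "f x = 0"
proof (rule ccontr)
  assume "f x \<noteq> 0"
  have "open (f -` (- {0}))" using f by (rule open_vimage[rotated]) auto
  moreover have "negligible (f -` (- {0}))"
    using AE unfolding negligible_iff_null_sets by (auto simp: eventually_ae_filter vimage_def completion.complete2
        intro: null_sets_subset) 
  ultimately show False using open_not_negligible[of "f -` (- {0})"] \<open>f x \<noteq> 0\<close> by auto
qed

lemma L2_basis_ofI:
  assumes lin: "\<And>c i. (\<Sum>i<d. scaleC_L2 (c i) (v i)) = 0 \<Longrightarrow> i < d \<Longrightarrow> c i = 0"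
    and span: "V = range (\<lambda>c. \<Sum>i<d. scaleC_L2 (c i) (v i))"
  shows "basis_of d v V"
proof -
  have inj: "inj_on v {..<d}"
  proof (rule inj_onI, rule ccontr)
    fix i j assume ij: "i \<in> {..<d}" "j \<in> {..<d}" "v i = v j" "i \<noteq> j"
    \<comment> \<open>The relation v i - v j = 0, so that independence of the indexed family also
      excludes repetitions.\<close>
    define c :: "nat \<Rightarrow> complex" where "c k = (if k = i then 1 else 0) - (if k = j then 1 else 0)" for k
    have "(\<Sum>k<d. scaleC_L2 (c k) (v k)) =
        (\<Sum>k<d. (if k = i then v k else 0) - (if k = j then v k else 0))"
      by (intro sum.cong refl) (auto simp: c_def L2.scale_left_diff_distrib)
    also have "\<dots> = v i - v j" using ij(1,2) by (simp add: sum_subtractf)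
    finally have "c i = 0" using ij by (intro lin) auto
    then show False using ij(4) by (simp add: c_def)
  qed
  have reindex: "(\<Sum>w\<in>v ` {..<d}. scaleC_L2 (u w) w) = (\<Sum>i<d. scaleC_L2 (u (v i)) (v i))" for u
    by (rule sum.reindex[OF inj, unfolded comp_def])
  have "L2.independent (v ` {..<d})"
  proof (rule notI)
    assume "L2.dependent (v ` {..<d})"
    then obtain u w where "w \<in> v ` {..<d}" "u w \<noteq> 0" "(\<Sum>w\<in>v ` {..<d}. scaleC_L2 (u w) w) = 0"
      by (auto simp: L2.dependent_finite)
    then show False using lin[of "\<lambda>i. u (v i)"] unfolding reindex by auto
  qed
  moreover have "L2.span (v ` {..<d}) = V"
    unfolding span L2.span_finite[OF finite_imageI[OF finite_lessThan]] reindex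
  proof (intro Set.equalityI subsetI)
    fix w assume "w \<in> range (\<lambda>c. \<Sum>i<d. scaleC_L2 (c i) (v i))"
    then obtain c where w: "w = (\<Sum>i<d. scaleC_L2 (c i) (v i))" by blast
    have "w = (\<Sum>i<d. scaleC_L2 (c (inv_into {..<d} v (v i))) (v i))"
      unfolding w by (intro sum.cong refl) (simp add: inv_into_f_f[OF inj])
    then show "w \<in> range (\<lambda>u. \<Sum>i<d. scaleC_L2 (u (v i)) (v i))"
      by (intro image_eqI[of _ _ "\<lambda>w. c (inv_into {..<d} v w)"]) simp_all
  qed auto
  ultimately show ?thesis using inj by (simp add: basis_of_def)
qed

lemma Dsum_permute: "\<sigma> permutes {0..<p} \<Longrightarrow> Dsum K p (x \<circ> \<sigma>) (y \<circ> \<sigma>) = Dsum K p x y"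
  by (simp add: Dsum_def Bterm_permute)

lemma Dsum_equal_rows:
  "i \<noteq> j \<Longrightarrow> i < p \<Longrightarrow> j < p \<Longrightarrow> x i = x j \<Longrightarrow> Dsum K p x y = 0"
  using Bterm_equal_rows[of i j p x] by (simp add: Dsum_def)

context dominated_kernel
begin

lemma Dsum_dual: "Dsum (dual_kernel K) p y x = cnj (Dsum K p x y)"
proof -
  have "(\<lambda>n. Bterm (dual_kernel K) n p y x) sums cnj (Dsum K p x y)"
    unfolding Bterm_dual sums_cnj by (rule Bterm_sums)
  then show ?thesis unfolding Dsum_def[of "dual_kernel K"] by (rule sums_unique[symmetric])
qed

section \<open>The integral operator of a dominated kernel\<close>

lemma square_integrable_row: "square_integrable (\<lambda>t. K (s, t))"
proof (rule square_integrable_bound[where a = "\<lambda>t. a s * b t"])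
  show "integrable lebesgue (\<lambda>t. (a s * b t)\<^sup>2)" using b_sq by (simp add: power_mult_distrib)
qed (auto intro: K_bound continuous_lebesgue_measurable K_slice_continuous)

text \<open>Acts on functions rather than classes and has a value at every s; the coefficients in
  \<open>homogeneous_expansion\<close> are such point values.\<close>

definition app :: "(real \<Rightarrow> complex) \<Rightarrow> real \<Rightarrow> complex" where
  "app v s = (\<integral>t. K (s, t) * v t \<partial>lebesgue)"

lemma app_integrable: "square_integrable v \<Longrightarrow> integrable lebesgue (\<lambda>t. K (s, t) * v t)"
  by (intro square_integrable_mult square_integrable_row)

lemma app_add: "square_integrable u \<Longrightarrow> square_integrable v \<Longrightarrow> app (\<lambda>t. u t + v t) s = app u s + app v s"
  by (simp add: app_def distrib_left app_integrable)

lemma app_diff: "square_integrable u \<Longrightarrow> square_integrable v \<Longrightarrow> app (\<lambda>t. u t - v t) s = app u s - app v s"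
  by (simp add: app_def right_diff_distrib app_integrable)

lemma app_scale: "app (\<lambda>t. c * v t) s = c * app v s"
  by (simp add: app_def mult.left_commute)

lemma app_sum:
  "finite I \<Longrightarrow> (\<And>i. i \<in> I \<Longrightarrow> square_integrable (v i)) \<Longrightarrow> app (\<lambda>t. \<Sum>i\<in>I. v i t) s = (\<Sum>i\<in>I. app (v i) s)"
  by (simp add: app_def sum_distrib_left app_integrable)

lemma app_cong_AE:
  assumes "square_integrable u" "square_integrable v" "AE t in lebesgue. u t = v t"
  shows "app u s = app v s"
  unfolding app_def
  by (rule integral_cong_AE) (use assms app_integrable in \<open>auto intro: borel_measurable_integrable\<close>)

lemma K_pair_measurable: "K \<in> borel_measurable (lebesgue \<Otimes>\<^sub>M lebesgue)"
proof -
  have "(\<lambda>z. (fst z, snd z)) \<in> (lebesgue \<Otimes>\<^sub>M lebesgue) \<rightarrow>\<^sub>M (borel :: (real \<times> real) measure)"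
    by (intro borel_measurable_Pair measurable_compose[OF measurable_fst] measurable_compose[OF measurable_snd]
        measurable_completion) simp_all
  then show ?thesis using measurable_compose[OF _ K_measurable] by fastforce
qed

text \<open>The value at s is at most a(s) times the integral of b |v|, a finite constant by square
  integrability of b and v.\<close>

lemma app_square_integrable:
  assumes v: "square_integrable v"
  shows "square_integrable (app v)"
proof -
  have vm: "v \<in> borel_measurable lebesgue" using v by (rule square_integrable_measurable)
  have bv: "integrable lebesgue (\<lambda>t. b t * cmod (v t))"
  proof -
    have "square_integrable (\<lambda>t. complex_of_real (b t))"
      using b_sq b_measurable by (auto simp: square_integrable_def intro!: measurable_completion)
    from integrable_norm[OF square_integrable_mult[OF this v]] show ?thesis
      by (simp add: norm_mult b_nonneg)
  qed
  define c where "c = (\<integral>t. b t * cmod (v t) \<partial>lebesgue)"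
  show ?thesis
  proof (rule square_integrable_bound[where a = "\<lambda>s. a s * c"])
    have m: "(\<lambda>z. K z * v (snd z)) \<in> borel_measurable (lebesgue \<Otimes>\<^sub>M lebesgue)"
      by (intro borel_measurable_times K_pair_measurable measurable_compose[OF measurable_snd vm])
    show "app v \<in> borel_measurable lebesgue"
      unfolding app_def[abs_def]
      by (rule lebesgue.borel_measurable_lebesgue_integral) (use m in \<open>simp add: case_prod_beta'\<close>)
    show "integrable lebesgue (\<lambda>s. (a s * c)\<^sup>2)" using a_sq by (simp add: power_mult_distrib)
    show "cmod (app v s) \<le> a s * c" for s
    proof -
      have "cmod (app v s) \<le> (\<integral>t. cmod (K (s, t) * v t) \<partial>lebesgue)"
        unfolding app_def by (rule integral_norm_bound)
      also have "\<dots> \<le> (\<integral>t. a s * (b t * cmod (v t)) \<partial>lebesgue)"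
      proof (rule integral_mono)
        show "cmod (K (s, t) * v t) \<le> a s * (b t * cmod (v t))" for t
          using mult_right_mono[OF K_bound norm_ge_zero, of s t "v t"] by (simp add: norm_mult mult.assoc)
      qed (use bv app_integrable[OF v] in auto)
      finally show ?thesis using bv by (simp add: c_def)
    qed
  qed
qed

text \<open>The triple product is dominated by |u| a in one variable times b |v| in the other, each
  a product of square integrable functions and hence integrable.\<close>

lemma app_Fubini:
  assumes u: "square_integrable u" and v: "square_integrable v"
  shows "(\<integral>\<xi>. u \<xi> * app v \<xi> \<partial>lebesgue) = (\<integral>t. (\<integral>\<xi>. u \<xi> * K (\<xi>, t) \<partial>lebesgue) * v t \<partial>lebesgue)"
proof -
  have um: "u \<in> borel_measurable lebesgue" and vm: "v \<in> borel_measurable lebesgue"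
    using u v by (auto intro: square_integrable_measurable)
  have sqa: "square_integrable (\<lambda>t. complex_of_real (a t))" and sqb: "square_integrable (\<lambda>t. complex_of_real (b t))"
    using a_sq b_sq a_measurable b_measurable by (auto simp: square_integrable_def intro!: measurable_completion)
  define p where "p \<xi> = u \<xi> * complex_of_real (a \<xi>)" for \<xi>
  define q where "q t = complex_of_real (b t) * v t" for t
  have p: "integrable lebesgue p" and q: "integrable lebesgue q"
    unfolding p_def q_def using u v sqa sqb by (intro square_integrable_mult; simp)+
  have "integrable (lebesgue \<Otimes>\<^sub>M lebesgue) (\<lambda>z. p (fst z) * q (snd z))"
  proof (rule lebesgue_pair.Fubini_integrable)
    show "(\<lambda>z. p (fst z) * q (snd z)) \<in> borel_measurable (lebesgue \<Otimes>\<^sub>M lebesgue)"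
      by (intro borel_measurable_times measurable_compose[OF measurable_fst borel_measurable_integrable[OF p]]
          measurable_compose[OF measurable_snd borel_measurable_integrable[OF q]])
    show "integrable lebesgue (\<lambda>\<xi>. \<integral>t. norm (p (fst (\<xi>, t)) * q (snd (\<xi>, t))) \<partial>lebesgue)"
      using p by (simp add: norm_mult)
    show "AE \<xi> in lebesgue. integrable lebesgue (\<lambda>t. p (fst (\<xi>, t)) * q (snd (\<xi>, t)))"
      using q by simp
  qed
  then have "integrable (lebesgue \<Otimes>\<^sub>M lebesgue) (\<lambda>z. u (fst z) * K z * v (snd z))"
  proof (rule Bochner_Integration.integrable_bound)
    show "(\<lambda>z. u (fst z) * K z * v (snd z)) \<in> borel_measurable (lebesgue \<Otimes>\<^sub>M lebesgue)"
      by (intro borel_measurable_times K_pair_measurable measurable_compose[OF measurable_fst um]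
          measurable_compose[OF measurable_snd vm])
    show "AE z in lebesgue \<Otimes>\<^sub>M lebesgue. norm (u (fst z) * K z * v (snd z)) \<le> norm (p (fst z) * q (snd z))"
    proof (rule AE_I2)
      fix z :: "real \<times> real"
      have "cmod (u (fst z)) * cmod (K z) * cmod (v (snd z)) \<le>
          cmod (u (fst z)) * (a (fst z) * b (snd z)) * cmod (v (snd z))"
        using K_bound[of "fst z" "snd z"] by (intro mult_right_mono mult_left_mono) auto
      then show "norm (u (fst z) * K z * v (snd z)) \<le> norm (p (fst z) * q (snd z))"
        by (simp add: p_def q_def norm_mult a_nonneg b_nonneg mult.assoc)
    qed
  qed
  then have int: "integrable (lebesgue \<Otimes>\<^sub>M lebesgue) (\<lambda>(\<xi>, t). u \<xi> * K (\<xi>, t) * v t)"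
    by (simp add: case_prod_beta')
  have "(\<integral>\<xi>. u \<xi> * app v \<xi> \<partial>lebesgue) = (\<integral>\<xi>. (\<integral>t. u \<xi> * K (\<xi>, t) * v t \<partial>lebesgue) \<partial>lebesgue)"
    unfolding app_def by (simp add: mult.assoc)
  also have "\<dots> = (\<integral>t. (\<integral>\<xi>. u \<xi> * K (\<xi>, t) * v t \<partial>lebesgue) \<partial>lebesgue)"
    by (rule lebesgue_pair.Fubini_integral[OF int, symmetric])
  finally show ?thesis by simp
qed

lemma solutions_iff: "f \<in> solutions K g \<longleftrightarrow> (AE s in lebesgue. rep_L2 f s + app (rep_L2 f) s = rep_L2 g s)"
  by (simp add: solutions_def app_integrable square_integrable_rep_L2 flip: app_def)

lemma homogeneous_solutions_iff:
  "f \<in> homogeneous_solutions K \<longleftrightarrow> (AE s in lebesgue. rep_L2 f s + app (rep_L2 f) s = 0)"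
  by (simp add: homogeneous_solutions_def app_integrable square_integrable_rep_L2 flip: app_def)

end

text \<open>The condition \<open>below\<close> removes the right side of \<open>Dsum_row\<close> one
  order lower, and \<open>nonzero\<close> allows division in the resolvent one order higher.\<close>

locale minimal_minor = dominated_kernel +
  fixes d :: nat and x y :: "nat \<Rightarrow> real"
  assumes below: "q < d \<Longrightarrow> Dsum K q u v = 0"
    and nonzero: "Dsum K d x y \<noteq> 0"
begin

lemma dual_minor: "minimal_minor (dual_kernel K) b a d y x"
proof -
  interpret dual: dominated_kernel "dual_kernel K" b a by (rule dual)
  show ?thesis
    by standard (simp_all add: Dsum_dual below nonzero)
qed

definition \<delta> :: complex where "\<delta> = Dsum K d x y"

definition \<phi> :: "nat \<Rightarrow> real \<Rightarrow> complex" where "\<phi> i s = Dsum K d (x(i := s)) y"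

definition \<psi> :: "nat \<Rightarrow> real \<Rightarrow> complex" where "\<psi> l t = Dsum K d x (y(l := t))"

text \<open>Fredholm's pseudo-resolvent kernel: (1 + K)(1 - R) and (1 - R)(1 + K) differ from the
  identity by operators of rank at most d, see \<open>R_row\<close> and
  \<open>R_col\<close>.\<close>

definition R :: "real \<times> real \<Rightarrow> complex" where
  "R = (\<lambda>(s, t). Dsum K (Suc d) (case_nat s x) (case_nat t y) / \<delta>)"

lemma \<delta>_nonzero: "\<delta> \<noteq> 0"
  using nonzero by (simp add: \<delta>_def)

lemma fun_upd_continuous:
  "continuous_on UNIV (\<lambda>s :: real. (u(i := s)) j)" "continuous_on UNIV (\<lambda>s :: real. (u :: nat \<Rightarrow> real) j)"
  by (cases "j = i"; simp add: continuous_on_id)+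

lemma \<phi>_continuous: "continuous_on UNIV (\<phi> i)"
  unfolding \<phi>_def[abs_def] by (intro continuous_on_Dsum_compose fun_upd_continuous)

text \<open>Only one factor of the bound for order d involves s, and that factor is a(s).\<close>

lemma \<phi>_square_integrable:
  assumes "i < d"
  shows "square_integrable (\<phi> i)"
proof (rule square_integrable_bound)
  define c where "c = C d * (b (y i) * (\<Prod>j\<in>{..<d} - {i}. a (x j) * b (y j)))"
  have "bnd d (x(i := s)) y = a s * b (y i) * (\<Prod>j\<in>{..<d} - {i}. a ((x(i := s)) j) * b (y j))" for s
    unfolding bnd_def using assms by (subst prod.remove[of _ i]) auto
  also have "\<dots> s = a s * b (y i) * (\<Prod>j\<in>{..<d} - {i}. a (x j) * b (y j))" for s
    by (intro arg_cong2[where f = "(*)"] prod.cong refl) auto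
  finally have "C d * bnd d (x(i := s)) y = a s * c" for s by (simp add: c_def)
  then show "cmod (\<phi> i s) \<le> a s * c" for s
    unfolding \<phi>_def using Dsum_bound[of d "x(i := s)" y] by simp
  show "integrable lebesgue (\<lambda>s. (a s * c)\<^sup>2)" using a_sq by (simp add: power_mult_distrib)
qed (rule continuous_lebesgue_measurable[OF \<phi>_continuous])

text \<open>Move the i-th pair of variables to the front, which costs no sign because rows and
  columns move together. The right side of \<open>Dsum_row\<close> then consists of sums of order d
  - 1, all zero.\<close>

lemma \<phi>_solution:
  assumes i: "i < d"
  shows "\<phi> i s + app (\<phi> i) s = 0"
proof -
  obtain q where q: "d = Suc q" using i by (cases d) auto
  define \<sigma> where "\<sigma> = Transposition.transpose 0 i"
  have \<sigma>: "\<sigma> permutes {0..<d}" unfolding \<sigma>_def using i by (intro permutes_swap_id) auto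
  define x' y' where "x' k = x (\<sigma> (Suc k))" and "y' k = y (\<sigma> (Suc k))" for k
  have "\<phi> i s = Dsum K (Suc q) (case_nat s x') (case_nat (y i) y')" for s
  proof -
    have "x(i := s) \<circ> \<sigma> = case_nat s x'" "y \<circ> \<sigma> = case_nat (y i) y'"
      by (auto simp: fun_eq_iff x'_def y'_def \<sigma>_def Transposition.transpose_def split: nat.split)
    then show ?thesis
      unfolding \<phi>_def using Dsum_permute[OF \<sigma>, of K "x(i := s)" y] q by simp
  qed
  note \<phi> = this
  have "\<phi> i s + (\<integral>\<eta>. K (s, \<eta>) * \<phi> i \<eta> \<partial>lborel) = 0"
    unfolding \<phi> Dsum_row using below[of q] q by simp
  then show ?thesis
    unfolding app_def by (simp add: integral_lborel_lebesgue continuous_on_mult K_slice_continuous \<phi>_continuous)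
qed

lemma \<phi>_dual: "minimal_minor.\<phi> (dual_kernel K) d y x l t = cnj (\<psi> l t)"
  unfolding minimal_minor.\<phi>_def[OF dual_minor] \<psi>_def by (rule Dsum_dual)

lemma \<psi>_square_integrable: "l < d \<Longrightarrow> square_integrable (\<psi> l)"
  using square_integrable_cnj[OF minimal_minor.\<phi>_square_integrable[OF dual_minor, of l]]
  by (simp add: \<phi>_dual)

lemma \<psi>_solution:
  assumes "l < d"
  shows "\<psi> l t + (\<integral>s. \<psi> l s * K (s, t) \<partial>lebesgue) = 0"
proof -
  interpret dual: dominated_kernel "dual_kernel K" b a by (rule dual)
  have "cnj (\<psi> l t) + (\<integral>s. cnj (\<psi> l s * K (s, t)) \<partial>lebesgue) = 0"
    using minimal_minor.\<phi>_solution[OF dual_minor assms, of t]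
    by (simp add: \<phi>_dual dual.app_def mult.commute)
  then have "cnj (\<psi> l t + (\<integral>s. \<psi> l s * K (s, t) \<partial>lebesgue)) = 0"
    unfolding Bochner_Integration.integral_cnj by simp
  then show ?thesis by (simp only: complex_cnj_zero_iff)
qed

text \<open>Off the diagonal the point x j occurs in two rows. Evaluation at the points x j
  therefore reads off coefficients, which gives linear independence.\<close>

lemma \<phi>_diag: "i < d \<Longrightarrow> j < d \<Longrightarrow> \<phi> i (x j) = (if i = j then \<delta> else 0)"
  using Dsum_equal_rows[of i j d "x(i := x j)" K y] by (auto simp: \<phi>_def \<delta>_def)

lemma R_continuous: "continuous_on UNIV R"
proof -
  have "continuous_on UNIV (\<lambda>z :: real \<times> real. (case_nat (fst z) x :: nat \<Rightarrow> real) j)"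
    "continuous_on UNIV (\<lambda>z :: real \<times> real. (case_nat (snd z) y :: nat \<Rightarrow> real) j)" for j
    by (cases j; simp add: continuous_on_fst continuous_on_snd continuous_on_id)+
  then show ?thesis
    unfolding R_def case_prod_beta'
    by (intro continuous_on_divide continuous_on_Dsum_compose continuous_on_const) (auto simp: \<delta>_nonzero)
qed

definition A :: real where "A = C (Suc d) * bnd d x y / cmod \<delta>"

text \<open>In the bound for order d + 1 the variables s and t contribute only
  \<open>a s * b t\<close>, so R is again dominated and every fact about \<open>app\<close> holds
  for it too.\<close>

lemma R_dominated: "dominated_kernel R (\<lambda>s. A * a s) b"
proof
  have A: "0 \<le> A" unfolding A_def by (simp add: C_nonneg bnd_nonneg)
  show "0 \<le> A * a s" for s using A a_nonneg by simp
  show "((\<lambda>s. A * a s) \<longlongrightarrow> 0) at_infinity" using tendsto_mult_left[OF a_vanish, of A] by simp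
  show "integrable lebesgue (\<lambda>s. (A * a s)\<^sup>2)" using a_sq by (simp add: power_mult_distrib)
  show "cmod (R (s, t)) \<le> A * a s * b t" for s t
    using divide_right_mono[OF Dsum_bound[of "Suc d" "case_nat s x" "case_nat t y"], of "cmod \<delta>"]
    by (simp add: R_def A_def norm_divide bnd_case_nat mult_ac)
qed (intro R_continuous b_nonneg b_vanish b_sq continuous_on_mult_left a_cont b_cont)+

sublocale R: dominated_kernel R "\<lambda>s. A * a s" b
  by (rule R_dominated)

text \<open>\<open>Dsum_row\<close> at order d divided by \<open>\<delta>\<close>; the sums of order
  d with one column variable replaced by t are the functions \<open>\<psi> j\<close>.\<close>

lemma R_row:
  "R (s, t) + (\<integral>\<eta>. K (s, \<eta>) * R (\<eta>, t) \<partial>lebesgue) = K (s, t) - (\<Sum>j<d. K (s, y j) * \<psi> j t) / \<delta>"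
proof -
  define I where "I = (\<integral>\<eta>. K (s, \<eta>) * Dsum K (Suc d) (case_nat \<eta> x) (case_nat t y) \<partial>lborel)"
  have "(\<integral>\<eta>. K (s, \<eta>) * R (\<eta>, t) \<partial>lebesgue) = (\<integral>\<eta>. K (s, \<eta>) * R (\<eta>, t) \<partial>lborel)"
    by (intro integral_lborel_lebesgue[symmetric] continuous_on_mult K_slice_continuous R.K_slice_continuous)
  also have "\<dots> = I / \<delta>"
    by (simp add: R_def I_def)
  finally have "R (s, t) + (\<integral>\<eta>. K (s, \<eta>) * R (\<eta>, t) \<partial>lebesgue) =
      (Dsum K (Suc d) (case_nat s x) (case_nat t y) + I) / \<delta>"
    by (simp only: add_divide_distrib) (simp add: R_def)
  also have "Dsum K (Suc d) (case_nat s x) (case_nat t y) + I = K (s, t) * \<delta> - (\<Sum>j<d. K (s, y j) * \<psi> j t)"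
    unfolding I_def \<delta>_def \<psi>_def by (rule Dsum_row)
  finally show ?thesis using \<delta>_nonzero by (simp add: diff_divide_distrib)
qed

lemma R_dual: "minimal_minor.R (dual_kernel K) d y x (t, s) = cnj (R (s, t))"
  unfolding minimal_minor.R_def[OF dual_minor] minimal_minor.\<delta>_def[OF dual_minor] R_def \<delta>_def
  by (simp add: Dsum_dual)

lemma \<psi>_dual: "minimal_minor.\<psi> (dual_kernel K) d y x i s = cnj (\<phi> i s)"
  unfolding minimal_minor.\<psi>_def[OF dual_minor] \<phi>_def by (rule Dsum_dual)

lemma \<delta>_dual: "minimal_minor.\<delta> (dual_kernel K) d y x = cnj \<delta>"
  unfolding minimal_minor.\<delta>_def[OF dual_minor] \<delta>_def by (rule Dsum_dual)

lemma R_col: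
  "R (s, t) + (\<integral>\<eta>. R (s, \<eta>) * K (\<eta>, t) \<partial>lebesgue) = K (s, t) - (\<Sum>i<d. K (x i, t) * \<phi> i s) / \<delta>"
proof -
  have "cnj (R (s, t)) + (\<integral>\<eta>. cnj (R (s, \<eta>) * K (\<eta>, t)) \<partial>lebesgue) =
      cnj (K (s, t) - (\<Sum>i<d. K (x i, t) * \<phi> i s) / \<delta>)"
    using minimal_minor.R_row[OF dual_minor, of t s]
    by (simp add: R_dual \<psi>_dual \<delta>_dual mult.commute)
  then have "cnj (R (s, t) + (\<integral>\<eta>. R (s, \<eta>) * K (\<eta>, t) \<partial>lebesgue)) =
      cnj (K (s, t) - (\<Sum>i<d. K (x i, t) * \<phi> i s) / \<delta>)"
    unfolding Bochner_Integration.integral_cnj by simp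
  then show ?thesis by (simp only: complex_cnj_cancel_iff)
qed

lemma integral_sum_weights:
  assumes v: "square_integrable v" and h: "\<And>i. i < d \<Longrightarrow> square_integrable (h i)"
  shows "(\<integral>t. (\<Sum>i<d. h i t * w i) / \<delta> * v t \<partial>lebesgue) = (\<Sum>i<d. (\<integral>t. h i t * v t \<partial>lebesgue) * w i) / \<delta>"
    and "integrable lebesgue (\<lambda>t. (\<Sum>i<d. h i t * w i) / \<delta> * v t)"
proof -
  have int: "integrable lebesgue (\<lambda>t. h i t * v t)" if "i < d" for i
    using v h[OF that] by (rule square_integrable_mult[rotated])
  have eq: "(\<Sum>i<d. h i t * w i) / \<delta> * v t = (\<Sum>i<d. (w i / \<delta>) * (h i t * v t))" for t
    unfolding sum_divide_distrib sum_distrib_right by (intro sum.cong refl) simp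
  show "integrable lebesgue (\<lambda>t. (\<Sum>i<d. h i t * w i) / \<delta> * v t)"
    unfolding eq using int by (intro Bochner_Integration.integrable_sum integrable_mult_right) simp
  show "(\<integral>t. (\<Sum>i<d. h i t * w i) / \<delta> * v t \<partial>lebesgue) = (\<Sum>i<d. (\<integral>t. h i t * v t \<partial>lebesgue) * w i) / \<delta>"
  proof -
    have "(\<integral>t. (\<Sum>i<d. (w i / \<delta>) * (h i t * v t)) \<partial>lebesgue) =
        (\<Sum>i<d. \<integral>t. (w i / \<delta>) * (h i t * v t) \<partial>lebesgue)"
      by (rule Bochner_Integration.integral_sum) (use int in \<open>simp only: integrable_mult_right lessThan_iff\<close>)
    also have "\<dots> = (\<Sum>i<d. (\<integral>t. h i t * v t \<partial>lebesgue) * w i) / \<delta>"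
      unfolding sum_divide_distrib integral_mult_right_zero by (intro sum.cong refl) simp
    finally show ?thesis unfolding eq .
  qed
qed

text \<open>Apply \<open>R_col\<close> to f. Since K f = -f almost everywhere, R K f cancels R f,
  which leaves K f equal to the finite rank term, a combination of the
  \<open>\<phi> i\<close>.\<close>

lemma homogeneous_expansion:
  assumes f: "square_integrable f" and sol: "AE s in lebesgue. f s + app f s = 0"
  shows "AE s in lebesgue. f s = (\<Sum>i<d. (- app f (x i) / \<delta>) * \<phi> i s)"
proof -
  \<comment> \<open>Valid at every s; null sets enter only under the integral sign and in the final
    replacement of f by -K f.\<close>
  have key: "app f s = (\<Sum>i<d. app f (x i) * \<phi> i s) / \<delta>" for s
  proof -
    have Rs: "square_integrable (\<lambda>\<eta>. R (s, \<eta>))" by (rule R.square_integrable_row)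
    have w: "(\<Sum>i<d. K (x i, t) * \<phi> i s) / \<delta> =
        K (s, t) - (R (s, t) + (\<integral>\<eta>. R (s, \<eta>) * K (\<eta>, t) \<partial>lebesgue))" for t
      using R_col[of s t] by simp
    have "(\<integral>t. (\<integral>\<eta>. R (s, \<eta>) * K (\<eta>, t) \<partial>lebesgue) * f t \<partial>lebesgue) = (\<integral>\<eta>. R (s, \<eta>) * app f \<eta> \<partial>lebesgue)"
      by (rule app_Fubini[OF Rs f, symmetric])
    also have "\<dots> = (\<integral>\<eta>. - (R (s, \<eta>) * f \<eta>) \<partial>lebesgue)"
    proof (rule integral_cong_AE)
      show "(\<lambda>\<eta>. R (s, \<eta>) * app f \<eta>) \<in> borel_measurable lebesgue"
        by (intro borel_measurable_integrable square_integrable_mult Rs app_square_integrable f)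
      show "(\<lambda>\<eta>. - (R (s, \<eta>) * f \<eta>)) \<in> borel_measurable lebesgue"
        by (intro borel_measurable_integrable Bochner_Integration.integrable_minus square_integrable_mult Rs f)
      show "AE \<eta> in lebesgue. R (s, \<eta>) * app f \<eta> = - (R (s, \<eta>) * f \<eta>)"
        using sol
      proof eventually_elim
        case (elim \<eta>)
        then have "app f \<eta> = - f \<eta>" by (simp add: eq_neg_iff_add_eq_0 add.commute)
        then show ?case by simp
      qed
    qed
    finally have double: "(\<integral>t. (\<integral>\<eta>. R (s, \<eta>) * K (\<eta>, t) \<partial>lebesgue) * f t \<partial>lebesgue) =
        - (\<integral>t. R (s, t) * f t \<partial>lebesgue)" by simp
    define S where "S t = (\<Sum>i<d. K (x i, t) * \<phi> i s) / \<delta>" for t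
    have S: "integrable lebesgue (\<lambda>t. S t * f t)"
      "(\<integral>t. S t * f t \<partial>lebesgue) = (\<Sum>i<d. app f (x i) * \<phi> i s) / \<delta>"
      unfolding S_def app_def
      by (rule integral_sum_weights[OF f square_integrable_row])+
    have I: "integrable lebesgue (\<lambda>t. K (s, t) * f t)" "integrable lebesgue (\<lambda>t. R (s, t) * f t)"
      by (intro app_integrable R.app_integrable f)+
    have "(\<integral>\<eta>. R (s, \<eta>) * K (\<eta>, t) \<partial>lebesgue) * f t = K (s, t) * f t - R (s, t) * f t - S t * f t" for t
      unfolding S_def w by (simp add: algebra_simps)
    then have "(\<integral>t. (\<integral>\<eta>. R (s, \<eta>) * K (\<eta>, t) \<partial>lebesgue) * f t \<partial>lebesgue) =
        (\<integral>t. K (s, t) * f t \<partial>lebesgue) - (\<integral>t. R (s, t) * f t \<partial>lebesgue) - (\<integral>t. S t * f t \<partial>lebesgue)"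
      using I S(1) by simp
    with double S(2) show ?thesis by (simp add: app_def)
  qed
  show ?thesis
    using sol
  proof eventually_elim
    case (elim s)
    then have "f s = - app f s" by (simp only: eq_neg_iff_add_eq_0)
    also have "\<dots> = (\<Sum>i<d. (- app f (x i) / \<delta>) * \<phi> i s)"
      unfolding key[of s] sum_divide_distrib sum_negf[symmetric] by (intro sum.cong refl) simp
    finally show ?case .
  qed
qed

text \<open>Integrate the equation against \<open>\<psi> l\<close> and move K onto
  \<open>\<psi> l\<close>, where it acts as -1.\<close>

lemma orthogonality_necessary:
  assumes f: "square_integrable f" and g: "square_integrable g"
    and sol: "AE s in lebesgue. f s + app f s = g s" and l: "l < d"
  shows "(\<integral>t. \<psi> l t * g t \<partial>lebesgue) = 0"
proof -
  note \<psi> = \<psi>_square_integrable[OF l]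
  have I: "integrable lebesgue (\<lambda>t. \<psi> l t * f t)" "integrable lebesgue (\<lambda>t. \<psi> l t * app f t)"
    by (intro square_integrable_mult \<psi> f app_square_integrable)+
  have "(\<integral>t. \<psi> l t * g t \<partial>lebesgue) = (\<integral>t. \<psi> l t * f t + \<psi> l t * app f t \<partial>lebesgue)"
  proof (rule integral_cong_AE)
    show "(\<lambda>t. \<psi> l t * g t) \<in> borel_measurable lebesgue"
      by (intro borel_measurable_integrable square_integrable_mult \<psi> g)
    show "AE t in lebesgue. \<psi> l t * g t = \<psi> l t * f t + \<psi> l t * app f t"
      using sol by eventually_elim (simp only: distrib_left[symmetric])
  qed (intro borel_measurable_integrable Bochner_Integration.integrable_add I)
  also have "\<dots> = (\<integral>t. \<psi> l t * f t \<partial>lebesgue) + (\<integral>t. (\<integral>s. \<psi> l s * K (s, t) \<partial>lebesgue) * f t \<partial>lebesgue)"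
    using I app_Fubini[OF \<psi> f] by simp
  also have "\<dots> = 0"
  proof -
    have "(\<integral>s. \<psi> l s * K (s, t) \<partial>lebesgue) * f t = - (\<psi> l t * f t)" for t
      using \<psi>_solution[OF l, of t] by (simp add: add_eq_0_iff)
    then show ?thesis by simp
  qed
  finally show ?thesis .
qed

text \<open>By \<open>R_row\<close>, (1 + K)(1 - R) g equals g plus a combination of the integrals
  of \<open>\<psi> l\<close> against g, which vanish. So g - R g is a particular solution.\<close>

lemma orthogonality_sufficient:
  assumes g: "square_integrable g" and orth: "\<And>l. l < d \<Longrightarrow> (\<integral>t. \<psi> l t * g t \<partial>lebesgue) = 0"
  shows "(g s - R.app g s) + app (\<lambda>t. g t - R.app g t) s = g s"
proof -
  have Ks: "square_integrable (\<lambda>\<eta>. K (s, \<eta>))" by (rule square_integrable_row)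
  define S where "S t = (\<Sum>j<d. \<psi> j t * K (s, y j)) / \<delta>" for t
  have "(\<integral>t. S t * g t \<partial>lebesgue) = (\<Sum>j<d. (\<integral>t. \<psi> j t * g t \<partial>lebesgue) * K (s, y j)) / \<delta>"
    unfolding S_def by (intro integral_sum_weights(1) g \<psi>_square_integrable)
  also have "\<dots> = 0" by (simp add: orth)
  finally have S: "(\<integral>t. S t * g t \<partial>lebesgue) = 0" "integrable lebesgue (\<lambda>t. S t * g t)"
    unfolding S_def by (assumption, intro integral_sum_weights(2) g \<psi>_square_integrable)
  have I: "integrable lebesgue (\<lambda>t. K (s, t) * g t)" "integrable lebesgue (\<lambda>t. R (s, t) * g t)"
    by (intro app_integrable R.app_integrable g)+
  have "app (R.app g) s = (\<integral>t. (\<integral>\<eta>. K (s, \<eta>) * R (\<eta>, t) \<partial>lebesgue) * g t \<partial>lebesgue)"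
    unfolding app_def by (rule R.app_Fubini[OF Ks g])
  also have "\<dots> = (\<integral>t. K (s, t) * g t - R (s, t) * g t - S t * g t \<partial>lebesgue)"
  proof (rule Bochner_Integration.integral_cong[OF refl])
    fix t
    have "(\<integral>\<eta>. K (s, \<eta>) * R (\<eta>, t) \<partial>lebesgue) = K (s, t) - R (s, t) - S t"
      using R_row[of s t] unfolding S_def by (simp add: mult.commute algebra_simps)
    then show "(\<integral>\<eta>. K (s, \<eta>) * R (\<eta>, t) \<partial>lebesgue) * g t = K (s, t) * g t - R (s, t) * g t - S t * g t"
      by (simp add: left_diff_distrib)
  qed
  also have "\<dots> = app g s - R.app g s" using I S by (simp add: app_def R.app_def)
  finally show ?thesis using app_diff[OF g R.app_square_integrable[OF g], of s] by simp
qed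

lemma \<phi>_sum_square_integrable: "square_integrable (\<lambda>s. \<Sum>i<d. c i * \<phi> i s)"
  by (intro square_integrable_sum square_integrable_scale \<phi>_square_integrable) auto

lemma \<phi>_sum_solution: "(\<Sum>i<d. c i * \<phi> i s) + app (\<lambda>s. \<Sum>i<d. c i * \<phi> i s) s = 0"
proof -
  have "app (\<lambda>s. \<Sum>i<d. c i * \<phi> i s) s = (\<Sum>i<d. c i * app (\<phi> i) s)"
    by (subst app_sum) (auto intro: square_integrable_scale \<phi>_square_integrable simp: app_scale)
  also have "\<dots> = (\<Sum>i<d. c i * - \<phi> i s)"
    using \<phi>_solution by (intro sum.cong refl) (simp add: add_eq_0_iff)
  finally show ?thesis by (simp add: sum_negf)
qed

lemma abs_\<phi>_sum: "(\<Sum>i<d. scaleC_L2 (c i) (abs_L2 (\<phi> i))) = abs_L2 (\<lambda>s. \<Sum>i<d. c i * \<phi> i s)"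
  by (subst abs_L2_sum) (auto intro: square_integrable_scale \<phi>_square_integrable
      simp: abs_L2_scale \<phi>_square_integrable)

lemma homogeneous_basis: "basis_of d (\<lambda>i. abs_L2 (\<phi> i)) (homogeneous_solutions K)"
proof (rule L2_basis_ofI)
  fix c i assume sum: "(\<Sum>i<d. scaleC_L2 (c i) (abs_L2 (\<phi> i))) = 0" and i: "i < d"
  have "AE s in lebesgue. (\<Sum>i<d. c i * \<phi> i s) = 0"
    using sum unfolding abs_\<phi>_sum abs_L2_zero[symmetric]
    by (simp add: abs_L2_eq_iff \<phi>_sum_square_integrable square_integrable_zero)
  \<comment> \<open>Continuity turns the relation into one valid everywhere, in particular at the
    point x i, which isolates the i-th coefficient.\<close>
  then have "(\<Sum>k<d. c k * \<phi> k (x i)) = 0"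
    by (rule continuous_AE_zero[rotated]) (intro continuous_on_sum continuous_on_mult continuous_on_const \<phi>_continuous)
  also have "(\<Sum>k<d. c k * \<phi> k (x i)) = (\<Sum>k<d. if k = i then c i * \<delta> else 0)"
    by (intro sum.cong refl) (auto simp: \<phi>_diag i)
  finally show "c i = 0" using i \<delta>_nonzero by simp
next
  show "homogeneous_solutions K = range (\<lambda>c. \<Sum>i<d. scaleC_L2 (c i) (abs_L2 (\<phi> i)))"
    unfolding abs_\<phi>_sum
  proof (intro Set.equalityI subsetI)
    fix f assume "f \<in> homogeneous_solutions K"
    then have "AE s in lebesgue. rep_L2 f s = (\<Sum>i<d. (- app (rep_L2 f) (x i) / \<delta>) * \<phi> i s)"
      unfolding homogeneous_solutions_iff by (rule homogeneous_expansion[OF square_integrable_rep_L2])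
    then have exp: "abs_L2 (rep_L2 f) = abs_L2 (\<lambda>s. \<Sum>i<d. (- app (rep_L2 f) (x i) / \<delta>) * \<phi> i s)"
      by (rule abs_L2_eq_iff[OF square_integrable_rep_L2 \<phi>_sum_square_integrable, THEN iffD2])
    show "f \<in> range (\<lambda>c. abs_L2 (\<lambda>s. \<Sum>i<d. c i * \<phi> i s))"
      by (rule range_eqI) (rule exp[unfolded abs_rep_L2])
  next
    fix f assume "f \<in> range (\<lambda>c. abs_L2 (\<lambda>s. \<Sum>i<d. c i * \<phi> i s))"
    then obtain c where f: "f = abs_L2 (\<lambda>s. \<Sum>i<d. c i * \<phi> i s)" by blast
    note sq = \<phi>_sum_square_integrable[of c]
    have AE: "AE s in lebesgue. rep_L2 f s = (\<Sum>i<d. c i * \<phi> i s)"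
      unfolding f by (rule AE_rep_abs_L2[OF sq])
    have eq: "app (rep_L2 f) s = app (\<lambda>s. \<Sum>i<d. c i * \<phi> i s) s" for s
      by (rule app_cong_AE[OF square_integrable_rep_L2 sq AE])
    show "f \<in> homogeneous_solutions K"
      unfolding homogeneous_solutions_iff using AE by eventually_elim (simp only: eq \<phi>_sum_solution)
  qed
qed

lemma solutions_range:
  assumes orth: "\<And>l. l < d \<Longrightarrow> (\<integral>t. \<psi> l t * rep_L2 g t \<partial>lebesgue) = 0"
  defines "F \<equiv> \<lambda>c s. rep_L2 g s - R.app (rep_L2 g) s + (\<Sum>i<d. c i * \<phi> i s)"
  shows "square_integrable (F c)" and "solutions K g = range (\<lambda>c. abs_L2 (F c))"
proof -
  note g = square_integrable_rep_L2[of g]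
  have f0: "square_integrable (\<lambda>s. rep_L2 g s - R.app (rep_L2 g) s)"
    by (intro square_integrable_diff g R.app_square_integrable)
  show F: "square_integrable (F c)" for c
    unfolding F_def by (intro square_integrable_add f0 \<phi>_sum_square_integrable)
  have F_sol: "F c s + app (F c) s = rep_L2 g s" for c s
  proof -
    have "app (F c) s = app (\<lambda>s. rep_L2 g s - R.app (rep_L2 g) s) s + app (\<lambda>s. \<Sum>i<d. c i * \<phi> i s) s"
      unfolding F_def by (rule app_add[OF f0 \<phi>_sum_square_integrable])
    then have "F c s + app (F c) s =
        (rep_L2 g s - R.app (rep_L2 g) s + app (\<lambda>s. rep_L2 g s - R.app (rep_L2 g) s) s) +
        ((\<Sum>i<d. c i * \<phi> i s) + app (\<lambda>s. \<Sum>i<d. c i * \<phi> i s) s)"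
      unfolding F_def by (simp only: add_ac)
    also have "\<dots> = rep_L2 g s"
      by (simp only: orthogonality_sufficient[OF g orth] \<phi>_sum_solution add_0_right)
    finally show ?thesis .
  qed
  show "solutions K g = range (\<lambda>c. abs_L2 (F c))"
  proof (intro Set.equalityI subsetI)
    fix f assume f: "f \<in> solutions K g"
    \<comment> \<open>The difference from the particular solution solves the homogeneous equation
      and is therefore a combination of the \<open>\<phi> i\<close>.\<close>
    define h where "h s = rep_L2 f s - F (\<lambda>_. 0) s" for s
    have h: "square_integrable h"
      unfolding h_def by (intro square_integrable_diff square_integrable_rep_L2 F)
    have "AE s in lebesgue. h s + app h s = 0"
      using f unfolding solutions_iff
    proof eventually_elim
      case (elim s)
      have "app h s = app (rep_L2 f) s - app (F (\<lambda>_. 0)) s"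
        unfolding h_def by (rule app_diff[OF square_integrable_rep_L2 F])
      then have "h s + app h s =
          (rep_L2 f s + app (rep_L2 f) s) - (F (\<lambda>_. 0) s + app (F (\<lambda>_. 0)) s)"
        by (simp only: h_def add_diff_add)
      then show ?case by (simp only: elim F_sol diff_self)
    qed
    from homogeneous_expansion[OF h this]
    have "AE s in lebesgue. rep_L2 f s = F (\<lambda>i. - app h (x i) / \<delta>) s"
    proof eventually_elim
      case (elim s)
      have "rep_L2 f s = F (\<lambda>_. 0) s + h s" by (simp add: h_def)
      then show ?case unfolding elim by (simp add: F_def)
    qed
    then have exp: "abs_L2 (rep_L2 f) = abs_L2 (F (\<lambda>i. - app h (x i) / \<delta>))"
      by (rule abs_L2_eq_iff[OF square_integrable_rep_L2 F, THEN iffD2])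
    show "f \<in> range (\<lambda>c. abs_L2 (F c))"
      by (rule range_eqI) (rule exp[unfolded abs_rep_L2])
  next
    fix f assume "f \<in> range (\<lambda>c. abs_L2 (F c))"
    then obtain c where f: "f = abs_L2 (F c)" by blast
    have AE: "AE s in lebesgue. rep_L2 f s = F c s"
      unfolding f by (rule AE_rep_abs_L2[OF F])
    have eq: "app (rep_L2 f) s = app (F c) s" for s
      by (rule app_cong_AE[OF square_integrable_rep_L2 F AE])
    show "f \<in> solutions K g"
      unfolding solutions_iff using AE by eventually_elim (simp only: eq F_sol)
  qed
qed

lemma solutions_nonempty_iff:
  "solutions K g \<noteq> {} \<longleftrightarrow> (\<forall>l<d. (\<integral>t. \<psi> l t * rep_L2 g t \<partial>lebesgue) = 0)"
proof
  assume "solutions K g \<noteq> {}"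
  then obtain f where "f \<in> solutions K g" by blast
  then show "\<forall>l<d. (\<integral>t. \<psi> l t * rep_L2 g t \<partial>lebesgue) = 0"
    unfolding solutions_iff
    using orthogonality_necessary[OF square_integrable_rep_L2 square_integrable_rep_L2] by blast
next
  assume "\<forall>l<d. (\<integral>t. \<psi> l t * rep_L2 g t \<partial>lebesgue) = 0"
  then have "solutions K g = range (\<lambda>c. abs_L2 (\<lambda>s. rep_L2 g s - R.app (rep_L2 g) s + (\<Sum>i<d. c i * \<phi> i s)))"
    by (intro solutions_range(2)) blast
  then show "solutions K g \<noteq> {}" by simp
qed

lemma homogeneous_dual: "homogeneous_solutions (dual_kernel K) = conjugate_solutions K"
  by (simp add: homogeneous_solutions_def conjugate_solutions_def)

lemma conjugate_basis: "basis_of d (\<lambda>l. abs_L2 (\<lambda>t. cnj (\<psi> l t))) (conjugate_solutions K)"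
  using minimal_minor.homogeneous_basis[OF dual_minor]
  unfolding homogeneous_dual \<phi>_dual[abs_def] by (simp add: \<phi>_dual)

lemma cinner_\<psi>:
  assumes "l < d"
  shows "cinner g (abs_L2 (\<lambda>t. cnj (\<psi> l t))) = (\<integral>t. \<psi> l t * rep_L2 g t \<partial>lebesgue)"
  using cinner_abs_L2[OF square_integrable_rep_L2[of g] square_integrable_cnj[OF \<psi>_square_integrable[OF assms]]]
  by (simp add: abs_rep_L2 mult.commute)

end

section \<open>Linear pencils\<close>

lemma K0_kernel_continuous: "K0_kernel K \<Longrightarrow> continuous_on UNIV K"
  by (simp add: K0_kernel_def C0_def)

lemma K0_kernel_diagonal_vanishes:
  assumes "K0_kernel K"
  shows "((\<lambda>s. K (s, s)) \<longlongrightarrow> 0) at_infinity"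
proof (rule tendstoI)
  fix e :: real assume "0 < e"
  then obtain Q where Q: "compact Q" "\<forall>z\<in>UNIV - Q. norm (K z) < e"
    using assms unfolding K0_kernel_def C0_def by blast
  obtain r where r: "\<forall>z\<in>Q. norm z \<le> r"
    using compact_imp_bounded[OF Q(1)] unfolding bounded_iff by blast
  have "dist (K (s, s)) 0 < e" if "r + 1 \<le> norm s" for s
  proof -
    have "norm s \<le> norm (s, s)" by (rule norm_fst_le)
    then have "(s, s) \<notin> Q" using r that by force
    then show ?thesis using Q(2) by simp
  qed
  then show "\<forall>\<^sub>F s in at_infinity. dist (K (s, s)) 0 < e"
    unfolding eventually_at_infinity by blast
qed

text \<open>The same product bound holds for H and for S, so the pencil costs only the factor 1 +
  |z|, placed in the first function. Its two functions are square roots of the diagonals of A' and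
  A, so integrability of those diagonals is exactly square integrability here.\<close>

lemma pencil_dominated:
  assumes H: "induces H opH" "continuous_on UNIV H" and S: "induces S opS" "continuous_on UNIV S"
    and sqrt: "is_positive_sqrt opA (\<lambda>f. adjoint_op opH (opH f) + adjoint_op opS (opS f))"
    and sqrt': "is_positive_sqrt opA' (\<lambda>f. opH (adjoint_op opH f) + opS (adjoint_op opS f))"
    and A: "K0_kernel A" "induces A opA" "integrable lebesgue (\<lambda>s. A (s, s))"
    and A': "K0_kernel A'" "induces A' opA'" "integrable lebesgue (\<lambda>s. A' (s, s))"
  shows "dominated_kernel (pencil H S z) (\<lambda>s. (1 + cmod z) * sqrt (Re (A' (s, s)))) (\<lambda>t. sqrt (Re (A (t, t))))"
proof
  have pos: "positive_op opA" "positive_op opA'" using sqrt sqrt' by (auto simp: is_positive_sqrt_def)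
  have bop: "bounded_op opH" "bounded_op opS" using H S by (simp_all add: induces_def)
  \<comment> \<open>The adjoint relation reversed: A compares with H and S, A' with their adjoints,
    so both directions are required.\<close>
  have adj: "cinner (adjoint_op U f) g = cinner f (U g)" if "bounded_op U" for U f g
    using adjoint_op(2)[OF that, of g f] cinner_commute[of g "adjoint_op U f"] cinner_commute[of "U g" f]
    by simp
  note cont = K0_kernel_continuous[OF A(1)] K0_kernel_continuous[OF A'(1)]
  have nonneg: "0 \<le> Re (A (s, s))" "0 \<le> Re (A' (s, s))" for s
    using kernel_diagonal_nonneg[OF pos(1) A(2) cont(1)] kernel_diagonal_nonneg[OF pos(2) A'(2) cont(2)] by blast+
  have bound: "cmod (U (s, t)) \<le> sqrt (Re (A' (s, s))) * sqrt (Re (A (t, t)))"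
    if "(cmod (U (s, t)))\<^sup>2 \<le> Re (A (t, t)) * Re (A' (s, s))" for U :: "real \<times> real \<Rightarrow> complex" and s t
    using real_le_rsqrt[OF that] by (simp add: real_sqrt_mult mult.commute)
  note dominates = positive_sqrt_dominates[OF sqrt adj[OF bop(1)] adj[OF bop(2)]]
  note dominates' = positive_sqrt_dominates[OF sqrt' adjoint_op(2)[OF bop(1)] adjoint_op(2)[OF bop(2)]]
  have bH: "cmod (H (s, t)) \<le> sqrt (Re (A' (s, s))) * sqrt (Re (A (t, t)))" for s t
    by (intro bound kernel_Kato[OF H pos(1) A(2) cont(1) pos(2) A'(2) cont(2)] dominates dominates')
  have bS: "cmod (S (s, t)) \<le> sqrt (Re (A' (s, s))) * sqrt (Re (A (t, t)))" for s t
    by (intro bound kernel_Kato[OF S pos(1) A(2) cont(1) pos(2) A'(2) cont(2)] dominates dominates')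
  show "cmod (pencil H S z (s, t)) \<le> (1 + cmod z) * sqrt (Re (A' (s, s))) * sqrt (Re (A (t, t)))" for s t
  proof -
    have "cmod (pencil H S z (s, t)) \<le> cmod (H (s, t)) + cmod z * cmod (S (s, t))"
      unfolding pencil_def using norm_triangle_ineq4[of "H (s, t)" "z * S (s, t)"] by (simp add: norm_mult)
    also have "\<dots> \<le> (1 + cmod z) * (sqrt (Re (A' (s, s))) * sqrt (Re (A (t, t))))"
      using bH[of s t] mult_left_mono[OF bS[of s t], of "cmod z"] by (simp add: distrib_right)
    finally show ?thesis by (simp add: mult.assoc)
  qed
  have diag: "continuous_on UNIV (\<lambda>s. U (s, s))" if "continuous_on UNIV U" for U :: "real \<times> real \<Rightarrow> complex"
    by (rule continuous_on_compose2[OF that]) (auto intro!: continuous_intros)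
  show "continuous_on UNIV (\<lambda>s. (1 + cmod z) * sqrt (Re (A' (s, s))))"
    "continuous_on UNIV (\<lambda>s. sqrt (Re (A (s, s))))"
    by (intro continuous_on_mult continuous_on_const continuous_on_real_sqrt continuous_on_Re diag cont)+
  show "((\<lambda>s. (1 + cmod z) * sqrt (Re (A' (s, s)))) \<longlongrightarrow> 0) at_infinity"
    using tendsto_mult_left[OF tendsto_real_sqrt[OF tendsto_Re[OF K0_kernel_diagonal_vanishes[OF A'(1)]]], of "1 + cmod z"]
    by simp
  show "((\<lambda>s. sqrt (Re (A (s, s)))) \<longlongrightarrow> 0) at_infinity"
    using tendsto_real_sqrt[OF tendsto_Re[OF K0_kernel_diagonal_vanishes[OF A(1)]]] by simp
  show "integrable lebesgue (\<lambda>s. ((1 + cmod z) * sqrt (Re (A' (s, s))))\<^sup>2)"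
    using integrable_Re[OF A'(3)] nonneg by (simp add: power_mult_distrib)
  show "integrable lebesgue (\<lambda>s. (sqrt (Re (A (s, s))))\<^sup>2)"
    using integrable_Re[OF A(3)] nonneg by simp
  show "continuous_on UNIV (pencil H S z)"
    unfolding pencil_def by (intro continuous_on_diff continuous_on_mult continuous_on_const H S)
qed (use kernel_diagonal_nonneg[OF _ A(2) K0_kernel_continuous[OF A(1)]]
    kernel_diagonal_nonneg[OF _ A'(2) K0_kernel_continuous[OF A'(1)]] sqrt sqrt'
    in \<open>auto simp: is_positive_sqrt_def\<close>)

lemma restrict_in_Rn: "restrict x {..<p} \<in> Rn p"
  by (simp add: Rn_def)

lemma (in dominated_kernel) fredholm_sum_eq_theta_iff:
  "fredholm_sum p K = theta p \<longleftrightarrow> (\<forall>x y. Dsum K p x y = 0)"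
proof
  assume eq: "fredholm_sum p K = theta p"
  show "\<forall>x y. Dsum K p x y = 0"
  proof (intro allI)
    fix x y :: "nat \<Rightarrow> real"
    let ?z = "(restrict x {..<p}, restrict y {..<p})"
    have z: "?z \<in> Rn2 p" by (simp add: restrict_in_Rn)
    have "Dsum K p x y = Dsum K p (fst ?z) (snd ?z)" by (rule Dsum_cong) simp_all
    also have "\<dots> = fredholm_sum p K ?z" unfolding fredholm_sum_eq by (rule restrict_apply'[OF z, symmetric])
    also have "\<dots> = 0" unfolding eq theta_def by (rule restrict_apply'[OF z])
    finally show "Dsum K p x y = 0" .
  qed
qed (simp add: fredholm_sum_eq theta_def)

text \<open>If r > 0, the vanishing condition at derivative order 0 would make every sum zero,
  against \<open>Dsum_nonzero\<close>. With r = 0 the remaining conditions say that d is the least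
  order with a nonzero sum.\<close>

lemma is_index_pair_iff:
  assumes dom: "dominated_kernel (T z) a b"
  shows "is_index_pair T z (d, r) \<longleftrightarrow>
    r = 0 \<and> d = (LEAST p. \<exists>x y. Dsum (T z) p x y \<noteq> 0)"
proof -
  interpret dominated_kernel "T z" a b by (rule dom)
  define N where "N p \<longleftrightarrow> (\<exists>x y. Dsum (T z) p x y \<noteq> 0)" for p
  have zero: "fredholm_D T p 0 z = theta p \<longleftrightarrow> \<not> N p" for p
    by (simp add: fredholm_D_def fredholm_sum_eq_theta_iff N_def)
  have ex: "\<exists>p. N p" unfolding N_def by (rule Dsum_nonzero)
  have "r = 0" if "is_index_pair T z (d, r)"
  proof (rule ccontr)
    assume "r \<noteq> 0"
    then have "fredholm_D T p 0 z = theta p" for p using that by (simp add: is_index_pair_def)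
    with ex show False by (simp add: zero)
  qed
  moreover have "is_index_pair T z (d, 0) \<longleftrightarrow> N d \<and> (\<forall>p<d. \<not> N p)"
    by (simp add: is_index_pair_def zero)
  moreover have "N d \<and> (\<forall>p<d. \<not> N p) \<longleftrightarrow> d = (LEAST p. N p)"
  proof
    assume "N d \<and> (\<forall>p<d. \<not> N p)"
    then show "d = (LEAST p. N p)"
      by (intro Least_equality[symmetric]) (auto simp: linorder_not_less[symmetric])
  next
    assume "d = (LEAST p. N p)"
    then show "N d \<and> (\<forall>p<d. \<not> N p)" using LeastI_ex[OF ex] by (auto dest: not_less_Least)
  qed
  ultimately show ?thesis unfolding N_def[symmetric] by blast
qed

lemma index_pair_unique:
  assumes "dominated_kernel (T z) a b"
  shows "\<exists>!dr. is_index_pair T z dr"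
    and "index_d T z = (LEAST p. \<exists>x y. Dsum (T z) p x y \<noteq> 0)" and "index_r T z = 0"
proof -
  let ?d = "LEAST p. \<exists>x y. Dsum (T z) p x y \<noteq> 0"
  have iff: "is_index_pair T z dr \<longleftrightarrow> dr = (?d, 0)" for dr
  proof (cases dr)
    case (Pair d r)
    show ?thesis unfolding Pair is_index_pair_iff[of T z, OF assms] prod.inject by (rule conj_commute)
  qed
  show "\<exists>!dr. is_index_pair T z dr" unfolding iff by (rule ex1I) (rule refl)
  show "index_d T z = ?d" "index_r T z = 0"
    unfolding index_d_def index_r_def iff by simp_all
qed

lemma basis_of_cong: "(\<And>i. i < n \<Longrightarrow> v i = w i) \<Longrightarrow> basis_of n v V \<longleftrightarrow> basis_of n w V"
  using inj_on_cong[of "{..<n}" v w] image_cong[of "{..<n}" "{..<n}" v w] by (simp add: basis_of_def)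

context minimal_minor
begin

lemma fredholm_sum_fun_upd:
  assumes "x \<in> Rn d" "y \<in> Rn d"
  shows "i < d \<Longrightarrow> fredholm_sum d K (x(i := s), y) = \<phi> i s"
    and "i < d \<Longrightarrow> fredholm_sum d K (x, y(i := s)) = \<psi> i s"
proof -
  have upd: "u(i := s) \<in> Rn d" if "u \<in> Rn d" "i < d" for u
    using that by (auto simp: Rn_def PiE_def extensional_def)
  show "i < d \<Longrightarrow> fredholm_sum d K (x(i := s), y) = \<phi> i s"
    "i < d \<Longrightarrow> fredholm_sum d K (x, y(i := s)) = \<psi> i s"
    using upd assms by (simp_all add: fredholm_sum_eq \<phi>_def \<psi>_def)
qed

lemma fredholm_sum_cons_pt: "fredholm_sum (Suc d) K (cons_pt d s x, cons_pt d t y) / \<delta> = R (s, t)"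
proof -
  have "cons_pt d s x \<in> Rn (Suc d)" "cons_pt d t y \<in> Rn (Suc d)"
    unfolding cons_pt_def by (rule restrict_in_Rn)+
  moreover have "Dsum K (Suc d) (cons_pt d s x) (cons_pt d t y) = Dsum K (Suc d) (case_nat s x) (case_nat t y)"
    by (rule Dsum_cong) (simp_all add: cons_pt_def)
  ultimately show ?thesis by (simp add: fredholm_sum_eq R_def)
qed

text \<open>Stated for arbitrary \<open>\<Phi>\<close>, \<open>\<Psi>\<close> and \<open>\<Gamma>\<close> because the functions of the theorem agree with
  \<open>\<phi>\<close> and \<open>\<psi>\<close> only at indices below \<open>d\<close>.\<close>

lemma Fredholm_alternative:
  assumes \<Phi>: "\<And>i. i < d \<Longrightarrow> \<Phi> i = \<phi> i" and \<Psi>: "\<And>l. l < d \<Longrightarrow> \<Psi> l = (\<lambda>t. cnj (\<psi> l t))"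
    and \<Gamma>: "\<And>s t. \<Gamma> s t = R (s, t)"
  shows "(\<forall>i<d. square_integrable (\<Phi> i)) \<and>
     basis_of d (\<lambda>i. abs_L2 (\<Phi> i)) (homogeneous_solutions K) \<and>
     (\<forall>l<d. square_integrable (\<Psi> l)) \<and>
     basis_of d (\<lambda>l. abs_L2 (\<Psi> l)) (conjugate_solutions K) \<and>
     (\<forall>g. (solutions K g \<noteq> {} \<longleftrightarrow> (\<forall>l<d. cinner g (abs_L2 (\<Psi> l)) = 0)) \<and>
          (solutions K g \<noteq> {} \<longrightarrow>
             (AE s in lebesgue. integrable lebesgue (\<lambda>t. \<Gamma> s t * rep_L2 g t)) \<and>
             (let F = (\<lambda>c s. rep_L2 g s - (\<integral>t. \<Gamma> s t * rep_L2 g t \<partial>lebesgue) + (\<Sum>i<d. c i * \<Phi> i s))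
              in (\<forall>c :: nat \<Rightarrow> complex. square_integrable (F c)) \<and>
                 solutions K g = range (\<lambda>c. abs_L2 (F c)))))"
proof (intro conjI allI impI)
  show "square_integrable (\<Phi> i)" if "i < d" for i using that \<Phi> \<phi>_square_integrable by simp
  show "square_integrable (\<Psi> l)" if "l < d" for l using that \<Psi> \<psi>_square_integrable square_integrable_cnj by simp
  show "basis_of d (\<lambda>i. abs_L2 (\<Phi> i)) (homogeneous_solutions K)"
    using homogeneous_basis by (rule basis_of_cong[THEN iffD1, rotated]) (simp add: \<Phi>)
  show "basis_of d (\<lambda>l. abs_L2 (\<Psi> l)) (conjugate_solutions K)"
    using conjugate_basis by (rule basis_of_cong[THEN iffD1, rotated]) (simp add: \<Psi>)
  fix g
  show "solutions K g \<noteq> {} \<longleftrightarrow> (\<forall>l<d. cinner g (abs_L2 (\<Psi> l)) = 0)"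
    unfolding solutions_nonempty_iff by (simp add: \<Psi> cinner_\<psi>)
  assume "solutions K g \<noteq> {}"
  then have orth: "(\<integral>t. \<psi> l t * rep_L2 g t \<partial>lebesgue) = 0" if "l < d" for l
    using that unfolding solutions_nonempty_iff by blast
  show "AE s in lebesgue. integrable lebesgue (\<lambda>t. \<Gamma> s t * rep_L2 g t)"
    unfolding \<Gamma> by (intro AE_I2 R.app_integrable square_integrable_rep_L2)
  have F: "rep_L2 g s - (\<integral>t. \<Gamma> s t * rep_L2 g t \<partial>lebesgue) + (\<Sum>i<d. c i * \<Phi> i s) =
      rep_L2 g s - R.app (rep_L2 g) s + (\<Sum>i<d. c i * \<phi> i s)" for c s
    by (simp add: \<Gamma> \<Phi> R.app_def)
  show "let F = (\<lambda>c s. rep_L2 g s - (\<integral>t. \<Gamma> s t * rep_L2 g t \<partial>lebesgue) + (\<Sum>i<d. c i * \<Phi> i s))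
      in (\<forall>c :: nat \<Rightarrow> complex. square_integrable (F c)) \<and> solutions K g = range (\<lambda>c. abs_L2 (F c))"
    unfolding Let_def F by (intro conjI allI solutions_range orth)
qed

end

theorem theorem4:
  fixes opH opS opA opA' :: "L2 \<Rightarrow> L2"
    and H S A A' :: "real \<times> real \<Rightarrow> complex"
    and T :: "complex \<Rightarrow> real \<times> real \<Rightarrow> complex"
    and \<mu> :: complex
  assumes "nuclear opH" and "induces H opH" and "H \<noteq> (\<lambda>_. 0)"
    and "nuclear opS" and "induces S opS"
    and T: "T = pencil H S"
    and "Mercer_kernel S"
    and "\<And>z. Mercer_kernel (T z)"
    and "is_positive_sqrt opA (\<lambda>f. adjoint_op opH (opH f) + adjoint_op opS (opS f))"
    and "is_positive_sqrt opA' (\<lambda>f. opH (adjoint_op opH f) + opS (adjoint_op opS f))"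
    and "nuclear opA" and "nuclear opA'"
    and "K0_kernel A" and "induces A opA"
    and "K0_kernel A'" and "induces A' opA'"
    and "integrable lebesgue (\<lambda>s. A (s, s))" and "(\<integral>s. A (s, s) \<partial>lebesgue) = op_trace opA"
    and "integrable lebesgue (\<lambda>s. A' (s, s))" and "(\<integral>s. A' (s, s) \<partial>lebesgue) = op_trace opA'"
  shows
    "(\<exists>!dr. is_index_pair T \<mu> dr) \<and>
     (let d = index_d T \<mu>; r = index_r T \<mu>; D = fredholm_D T d r \<mu> in
       \<forall>s' \<in> Rn d. \<forall>t' \<in> Rn d. \<forall>\<delta>. \<delta> = D (s', t') \<and> \<delta> \<noteq> 0 \<longrightarrow>
       (let \<phi> = (\<lambda>i s. D (s'(i := s), t'));
            \<psi> = (\<lambda>l t. cnj (D (s', t'(l := t))));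
            R = (\<lambda>s t. fredholm_D T (Suc d) r \<mu> (cons_pt d s s', cons_pt d t t') / \<delta>)
        in
         (\<forall>i<d. square_integrable (\<phi> i)) \<and>
         basis_of d (\<lambda>i. abs_L2 (\<phi> i)) (homogeneous_solutions (T \<mu>)) \<and>
         (\<forall>l<d. square_integrable (\<psi> l)) \<and>
         basis_of d (\<lambda>l. abs_L2 (\<psi> l)) (conjugate_solutions (T \<mu>)) \<and>
         (\<forall>g. (solutions (T \<mu>) g \<noteq> {} \<longleftrightarrow> (\<forall>l<d. cinner g (abs_L2 (\<psi> l)) = 0)) \<and>
              (solutions (T \<mu>) g \<noteq> {} \<longrightarrow>
                 (AE s in lebesgue. integrable lebesgue (\<lambda>t. R s t * rep_L2 g t)) \<and>
                 (let F = (\<lambda>c s. rep_L2 g s - (\<integral>t. R s t * rep_L2 g t \<partial>lebesgue)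
                            + (\<Sum>i<d. c i * \<phi> i s))
                  in (\<forall>c :: nat \<Rightarrow> complex. square_integrable (F c)) \<and>
                     solutions (T \<mu>) g = range (\<lambda>c. abs_L2 (F c))))))) \<and>
     index_r T \<mu> = 0 \<and>
     (let m = (INF z. index_d T z) in
        fredholm_D T m 0 \<mu> \<noteq> theta m \<longrightarrow> index_d T \<mu> = m)"
proof -
  \<comment> \<open>Continuity of H is that of the pencil at parameter 0, where it equals H.\<close>
  have cont: "continuous_on UNIV H" "continuous_on UNIV S"
    using assms(7) assms(8)[of 0] K0_kernel_continuous by (simp_all add: Mercer_kernel_def T pencil_def)
  note dom = pencil_dominated[OF assms(2) cont(1) assms(5) cont(2) assms(9,10) assms(13,14) assms(17)
      assms(15,16) assms(19), folded T]
  note index = index_pair_unique[of T, OF dom]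
  define a b where "a = (\<lambda>s. (1 + cmod \<mu>) * sqrt (Re (A' (s, s))))" and "b = (\<lambda>t. sqrt (Re (A (t, t))))"
  interpret \<mu>: dominated_kernel "T \<mu>" a b unfolding a_def b_def by (rule dom)
  define d where "d = index_d T \<mu>"
  have D0: "fredholm_D T p 0 \<mu> = fredholm_sum p (T \<mu>)" for p by (simp add: fredholm_D_def)
  have below: "Dsum (T \<mu>) q u v = 0" if "q < d" for q u v
    using not_less_Least[of q "\<lambda>p. \<exists>x y. Dsum (T \<mu>) p x y \<noteq> 0"] that unfolding d_def index(2) by blast
  show ?thesis
    unfolding Let_def index(3) D0 d_def[symmetric]
  proof (intro conjI impI, goal_cases)
    case 1
    show ?case by (rule index(1))
  next
    case 2
    show ?case
    proof (intro ballI allI impI, elim conjE, goal_cases)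
      case (1 s' t' \<delta>)
      then have \<delta>: "\<delta> = Dsum (T \<mu>) d s' t'" by (simp add: \<mu>.fredholm_sum_eq)
      interpret m: minimal_minor "T \<mu>" a b d s' t'
        by standard (use below 1 \<delta> in auto)
      have "fredholm_sum (Suc d) (T \<mu>) (cons_pt d s s', cons_pt d t t') / \<delta> = m.R (s, t)" for s t
        using m.fredholm_sum_cons_pt by (simp add: \<delta> m.\<delta>_def)
      then show ?case
        by (intro m.Fredholm_alternative[unfolded Let_def])
          (simp_all only: m.fredholm_sum_fun_upd[OF 1(1,2)])
    qed
  next
    case 3
    show ?case ..
  next
    case 4
    \<comment> \<open>A nonzero sum of order m at \<mu> bounds the least order d by m; the infimum
      is at most d in any case.\<close>
    show ?case
    proof (rule antisym)
      show "d \<le> (INF z. index_d T z)"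
        unfolding d_def index(2)[of \<mu>] using 4 by (intro Least_le) (simp add: \<mu>.fredholm_sum_eq_theta_iff)
      show "(INF z. index_d T z) \<le> d" unfolding d_def by (rule cINF_lower) auto
    qed
  qed
qed


end
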